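(* Let $\mathbf{w}$ be a $\mathcal{C}$-adic word with directive sequence $(i_n)_{n\in\mathbb{N}}\in\{1,2\}^{\mathbb{N}}$ (i.e. with directive sequence of substitutions $(c_{i_n})_{n\in\mathbb{N}}$). The following are equivalent: (i) $\mathbf{w}$ has factor complexity $p(n)=2n+1$ for all $n\in\mathbb{N}$; (ii) the frequencies of letters in $\mathbf{w}$ are rationally independent; (iii) $(C_{i_n})_{n\in\mathbb{N}}$ is primitive; (iv) $\mathbf{w}$ is a uniformly recurrent dendric word.
   Context: Let $\mathcal{A}=\{1,2,3\}$. Let $\mathcal{C}=\{c_1,c_2\}$, where $c_1,c_2$ are the endomorphisms of the free monoid $\mathcal{A}^*$ given by $c_1:1\mapsto1,\ 2\mapsto13,\ 3\mapsto2$ and $c_2:1\mapsto2,\ 2\mapsto13,\ 3\mapsto3$. Let $C_1=\begin{pmatrix}1&1&0\\0&0&1\\0&1&0\end{pmatrix}$, $C_2=\begin{pmatrix}0&1&0\\1&0&0\\0&1&1\end{pmatrix}$ be their incidence matrices. An infinite word $\mathbf{w}\in\mathcal{A}^{\mathbb{N}}$ is $\mathcal{C}$-adic with directive sequence $(\sigma_n)_{n}\in\mathcal{C}^{\mathbb{N}}$ if there is a sequence of letters $(a_n)_n\in\mathcal{A}^{\mathbb{N}}$ such that $\lim_{n\to\infty}\sigma_0\sigma_1\cdots\sigma_{n-1}(a_n)$ exists and equals $\mathbf{w}$. $\mathcal{L}_{\mathbf{w}}$ is the set of finite words (factors, including the empty word) occurring in $\mathbf{w}$; the factor complexity is $p(n)=\#(\mathcal{L}_{\mathbf{w}}\cap\mathcal{A}^n)$.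 The frequency of a letter $a$ in $\mathbf{w}=w_0w_1\cdots$ is $\lim_{n\to\infty}|w_0\cdots w_{n-1}|_a/n$, where $|u|_a$ is the number of occurrences of $a$ in $u$ (these limits exist for every $\mathcal{C}$-adic word). The frequencies of letters are rationally independent if the frequencies of $1,2,3$ are linearly independent over $\mathbb{Q}$. A sequence $(M_n)_n$ of nonnegative square matrices of the same size is primitive if for all $r\in\mathbb{N}$ there is $s>r$ such that $M_r\cdots M_{s-1}$ has only positive entries. $\mathbf{w}$ is uniformly recurrent if every factor occurs infinitely many times in $\mathbf{w}$ with bounded gaps between successive occurrences. For $u\in\mathcal{L}_{\mathbf{w}}$ let $E^-(u)=\{a\in\mathcal{A}: au\in\mathcal{L}_{\mathbf{w}}\}$, $E^+(u)=\{b\in\mathcal{A}: ub\in\mathcal{L}_{\mathbf{w}}\}$, $E(u)=\{(a,b)\in\mathcal{A}\times\mathcal{A}: aub\in\mathcal{L}_{\mathbf{w}}\}$. The word $u$ is bispecial if $\#E^-(u)>1$ and $\#E^+(u)>1$. The extension graph of $u$ is the undirected bipartite graph whose vertex set is the disjoint union of $E^-(u)$ and $E^+(u)$ and whose edge set is $E(u)$. A bispecial factor is dendric if its extension graph is a tree, and an infinite word is dendric if all its bispecial factors are dendric.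
   Formalization: Condition (iv) additionally requires that all three letters 1, 2, 3 occur in w; without this (iv) does not imply (iii), e.g. w = 111... with directive sequence 1,1,1,... is uniformly recurrent and vacuously dendric, but the matrix sequence is not primitive. *)

theory Defs
  imports "HOL-Analysis.Analysis"
begin

text \<open>
  The alphabet is the three-element type \<open>3\<close>, whose elements are written \<open>1\<close>, \<open>2\<close>, \<open>3\<close>
  (the numeral \<open>3\<close> coincides with \<open>0\<close> in this type). Finite words are lists and infinite words
  are functions on \<open>nat\<close>. An endomorphism of the free monoid is given by its values on letters.
\<close>

definition apply_morphism :: "('a \<Rightarrow> 'b list) \<Rightarrow> 'a list \<Rightarrow> 'b list" where
  "apply_morphism \<sigma> u = concat (map \<sigma> u)"

definition c1 :: "3 \<Rightarrow> 3 list" where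
  "c1 a = (if a = 1 then [1] else if a = 2 then [1, 3] else [2])"

definition c2 :: "3 \<Rightarrow> 3 list" where
  "c2 a = (if a = 1 then [2] else if a = 2 then [1, 3] else [3])"

definition C1 :: "real ^ 3 ^ 3" where
  "C1 = vector [vector [1, 1, 0], vector [0, 0, 1], vector [0, 1, 0]]"

definition C2 :: "real ^ 3 ^ 3" where
  "C2 = vector [vector [0, 1, 0], vector [1, 0, 0], vector [0, 1, 1]]"

definition incidence_matrix :: "('a \<Rightarrow> 'a list) \<Rightarrow> real ^ 'a ^ 'a" where
  "incidence_matrix \<sigma> = (\<chi> a b. real (count_list (\<sigma> b) a))"

lemma c1_letters: "c1 1 = [1]" "c1 2 = [1, 3]" "c1 3 = [2]"
  by (simp_all add: c1_def)

lemma c2_letters: "c2 1 = [2]" "c2 2 = [1, 3]" "c2 3 = [3]"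
  by (simp_all add: c2_def)

lemma incidence_matrix_c1: "incidence_matrix c1 = C1"
  by (simp add: vec_eq_iff forall_3 incidence_matrix_def C1_def c1_letters vector_3)

lemma incidence_matrix_c2: "incidence_matrix c2 = C2"
  by (simp add: vec_eq_iff forall_3 incidence_matrix_def C2_def c2_letters vector_3)

text \<open>Only the indices 1 and 2 are meaningful for \<open>subst_c\<close> and \<open>mat_C\<close>.\<close>

definition subst_c :: "nat \<Rightarrow> 3 \<Rightarrow> 3 list" where
  "subst_c k = (if k = 1 then c1 else c2)"

definition mat_C :: "nat \<Rightarrow> real ^ 3 ^ 3" where
  "mat_C k = (if k = 1 then C1 else C2)"

text \<open>
  The finite words \<open>u n\<close> converge to the infinite word \<open>w\<close> if every prefix of \<open>w\<close> is a prefix of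
  all but finitely many \<open>u n\<close>; in particular the lengths tend to infinity.
\<close>

definition words_tendsto :: "(nat \<Rightarrow> 'a list) \<Rightarrow> (nat \<Rightarrow> 'a) \<Rightarrow> bool" where
  "words_tendsto u w \<longleftrightarrow>
     (\<forall>m. \<forall>\<^sub>F n in sequentially. m \<le> length (u n) \<and> take m (u n) = map w [0..<m])"

text \<open>\<open>directive_word \<sigma> n u\<close> is the word \<open>\<sigma> 0 (\<sigma> 1 (\<dots> (\<sigma> (n - 1) u)))\<close>.\<close>

definition directive_word :: "(nat \<Rightarrow> 'a \<Rightarrow> 'a list) \<Rightarrow> nat \<Rightarrow> 'a list \<Rightarrow> 'a list" where
  "directive_word \<sigma> n u = foldr (\<lambda>k. apply_morphism (\<sigma> k)) [0..<n] u"

definition C_adic :: "(nat \<Rightarrow> 3) \<Rightarrow> (nat \<Rightarrow> 3 \<Rightarrow> 3 list) \<Rightarrow> bool" where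
  "C_adic w \<sigma> \<longleftrightarrow>
     (\<forall>n. \<sigma> n \<in> {c1, c2}) \<and>
     (\<exists>a :: nat \<Rightarrow> 3. words_tendsto (\<lambda>n. directive_word \<sigma> n [a n]) w)"

definition occurs_at :: "(nat \<Rightarrow> 'a) \<Rightarrow> 'a list \<Rightarrow> nat \<Rightarrow> bool" where
  "occurs_at w u k \<longleftrightarrow> map w [k..<k + length u] = u"

definition language :: "(nat \<Rightarrow> 'a) \<Rightarrow> 'a list set" where
  "language w = {u. \<exists>k. occurs_at w u k}"

definition factor_complexity :: "(nat \<Rightarrow> 'a) \<Rightarrow> nat \<Rightarrow> nat" where
  "factor_complexity w n = card {u \<in> language w. length u = n}"

definition letter_ratio :: "(nat \<Rightarrow> 'a) \<Rightarrow> 'a \<Rightarrow> nat \<Rightarrow> real" where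
  "letter_ratio w a n = real (count_list (map w [0..<n]) a) / real n"

definition letter_frequency :: "(nat \<Rightarrow> 'a) \<Rightarrow> 'a \<Rightarrow> real" where
  "letter_frequency w a = lim (letter_ratio w a)"

text \<open>Convergence is required explicitly because \<open>lim\<close> is unspecified for divergent sequences.\<close>

definition frequencies_rationally_independent :: "(nat \<Rightarrow> 'a::finite) \<Rightarrow> bool" where
  "frequencies_rationally_independent w \<longleftrightarrow>
     (\<forall>a. convergent (letter_ratio w a)) \<and>
     (\<forall>q :: 'a \<Rightarrow> rat.
        (\<Sum>a\<in>UNIV. of_rat (q a) * letter_frequency w a) = 0 \<longrightarrow> (\<forall>a. q a = 0))"

definition primitive_seq :: "(nat \<Rightarrow> real ^ 'n ^ 'n) \<Rightarrow> bool" where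
  "primitive_seq M \<longleftrightarrow>
     (\<forall>n i j. M n $ i $ j \<ge> 0) \<and>
     (\<forall>r. \<exists>s>r. \<forall>i j. foldr (**) (map M [r..<s]) (mat 1) $ i $ j > 0)"

definition uniformly_recurrent :: "(nat \<Rightarrow> 'a) \<Rightarrow> bool" where
  "uniformly_recurrent w \<longleftrightarrow>
     (\<forall>u \<in> language w.
        infinite {k. occurs_at w u k} \<and>
        (\<exists>N. \<forall>k l. occurs_at w u k \<and> occurs_at w u l \<and> k < l \<and>
                (\<forall>j. k < j \<and> j < l \<longrightarrow> \<not> occurs_at w u j) \<longrightarrow> l - k \<le> N))"

text \<open>
  An undirected simple graph is given by a vertex set and a set of two-element edges.
  A cycle has at least three distinct vertices, so that traversing one edge back and forth does
  not count as a cycle.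
\<close>

definition graph_connected :: "'v set \<Rightarrow> 'v set set \<Rightarrow> bool" where
  "graph_connected V E \<longleftrightarrow>
     V \<noteq> {} \<and> (\<forall>x\<in>V. \<forall>y\<in>V. (x, y) \<in> {(x, y). {x, y} \<in> E}\<^sup>*)"

definition graph_cycle :: "'v set set \<Rightarrow> 'v list \<Rightarrow> bool" where
  "graph_cycle E xs \<longleftrightarrow>
     length xs \<ge> 3 \<and> distinct xs \<and>
     (\<forall>i<length xs. {xs ! i, xs ! (Suc i mod length xs)} \<in> E)"

definition graph_tree :: "'v set \<Rightarrow> 'v set set \<Rightarrow> bool" where
  "graph_tree V E \<longleftrightarrow> graph_connected V E \<and> (\<nexists>xs. graph_cycle E xs)"

definition left_ext :: "(nat \<Rightarrow> 'a) \<Rightarrow> 'a list \<Rightarrow> 'a set" where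
  "left_ext w u = {a. a # u \<in> language w}"

definition right_ext :: "(nat \<Rightarrow> 'a) \<Rightarrow> 'a list \<Rightarrow> 'a set" where
  "right_ext w u = {b. u @ [b] \<in> language w}"

definition both_ext :: "(nat \<Rightarrow> 'a) \<Rightarrow> 'a list \<Rightarrow> ('a \<times> 'a) set" where
  "both_ext w u = {(a, b). a # u @ [b] \<in> language w}"

definition bispecial :: "(nat \<Rightarrow> 'a) \<Rightarrow> 'a list \<Rightarrow> bool" where
  "bispecial w u \<longleftrightarrow>
     u \<in> language w \<and> card (left_ext w u) > 1 \<and> card (right_ext w u) > 1"

definition ext_graph_verts :: "(nat \<Rightarrow> 'a) \<Rightarrow> 'a list \<Rightarrow> ('a + 'a) set" where
  "ext_graph_verts w u = left_ext w u <+> right_ext w u"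

definition ext_graph_edges :: "(nat \<Rightarrow> 'a) \<Rightarrow> 'a list \<Rightarrow> ('a + 'a) set set" where
  "ext_graph_edges w u = {{Inl a, Inr b} | a b. (a, b) \<in> both_ext w u}"

text \<open>
  The alphabet is finite, so that \<open>card\<close> in \<open>bispecial\<close> is the actual cardinality. The predicate
  does not force every letter to occur: a constant word has no bispecial factor at all, and a
  Sturmian word over two letters satisfies it too. To speak of a dendric word over the whole
  alphabet one adds \<open>range w = UNIV\<close>.
\<close>

definition dendric :: "(nat \<Rightarrow> 'a::finite) \<Rightarrow> bool" where
  "dendric w \<longleftrightarrow>
     (\<forall>u. bispecial w u \<longrightarrow> graph_tree (ext_graph_verts w u) (ext_graph_edges w u))"

end

theory Submission
  imports Defs "HOL-Library.Sublist" "HOL-Real_Asymp.Real_Asymp"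
begin

text \<open>
  Desubstituting \<open>w\<close> again and again gives words \<open>W 0 = w\<close>, \<open>W 1\<close>, \<open>W 2\<close>, \<open>\<dots>\<close>, where
  \<open>W n\<close> is the image of \<open>W (n + 1)\<close> under the \<open>n\<close>-th substitution. Everything is compared with
  condition (iii), primitivity.

  \<^bold>\<open>Frequencies.\<close> An integral relation between the letter frequencies, or more generally a weight
  vector on the letters, is transported through the levels by the transposed incidence matrices,
  which map \<open>(x, y, z)\<close> to \<open>(x, x + z, y)\<close> or \<open>(y, x + z, z)\<close>. There is a norm that these maps do
  not increase on vectors that have entries of both signs. If the averages of some weight
  oscillated, then two translates of the weight would have entries of both signs at all levels
  and so stay bounded, while their difference is a multiple of the unbounded lengths of the images
  of letters: so frequencies exist (\<open>mean_convergent\<close>). If the sequence is primitive, then an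
  integral relation has strictly positive and strictly negative entries at all levels, so its norm
  is eventually constant; a descent shows that this needs an eventually constant directive sequence
  (\<open>no_integer_relation\<close>). If the sequence is not primitive, then it eventually consists of blocks
  \<open>c1 c1\<close> and \<open>c2 c2\<close>, whose transposed matrices fix \<open>(0, 1, 0)\<close>: there is a relation
  (\<open>paired_relation\<close>). Hence (ii) and (iii) are equivalent.

  \<^bold>\<open>Extension graphs.\<close> The second difference of the complexity is the sum of the multiplicities of
  the factors \<open>u\<close>, the numbers of edges of the extension graph minus the number of its
  vertices plus 1. Under \<open>c1 c1\<close> (and, by a mirror symmetry, \<open>c2 c2\<close>) the extension graphs
  of nonempty bispecial factors are those of shorter factors two levels below. Where \<open>c1\<close> is
  followed by \<open>c2\<close> a factor of the level below has two images, and the multiplicities of these add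
  up to the one of the factor (\<open>mult_merge1_restrict1\<close>). It follows that all extension graphs are
  subgraphs of six trees (\<open>tower_subtree\<close>). So multiplicities are at most 0, a factor of
  multiplicity 0 has a tree as its extension graph, and (i) and (iv) both come down to: all letters
  occur and all multiplicities vanish.

  \<^bold>\<open>The link.\<close> For a primitive sequence the extension graph of the empty word is connected, because
  labels of its components would telescope to an integral relation between the frequencies
  (\<open>spreading_ext_Nil\<close>); the multiplicity 0 of the empty word at all levels spreads to all factors
  (\<open>tower_neutral\<close>). Conversely, vanishing multiplicities and the presence of all letters pass to
  infinitely many levels (\<open>tower_full_neutral\<close>), whereas for a sequence that is not primitive the
  words of all late levels miss a letter (\<open>paired_misses_letter\<close>), or else the sequence is eventually
  constant and the complexity is bounded.
\<close>

section \<open>Morphisms acting on finite and infinite words\<close>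

abbreviation app :: "('a \<Rightarrow> 'b list) \<Rightarrow> 'a list \<Rightarrow> 'b list" where
  "app \<equiv> apply_morphism"

lemma app_simps [simp]:
  "app c [] = []" "app c (a # u) = c a @ app c u" "app c (u @ v) = app c u @ app c v"
  by (simp_all add: apply_morphism_def)

lemma app_app: "app c (app d u) = app (\<lambda>a. app c (d a)) u"
  by (induction u) auto

definition nonerasing :: "('a \<Rightarrow> 'b list) \<Rightarrow> bool" where
  "nonerasing c \<longleftrightarrow> (\<forall>a. c a \<noteq> [])"

lemma nonerasingD: "nonerasing c \<Longrightarrow> c a \<noteq> []"
  by (simp add: nonerasing_def)

lemma length_app_ge: "nonerasing c \<Longrightarrow> length u \<le> length (app c u)"
proof (induction u)
  case (Cons a u)
  have "length (c a) \<ge> 1"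
    using Cons.prems nonerasingD[of c a] by (cases "c a") auto
  then show ?case using Cons by simp
qed simp

abbreviation prefix_of :: "(nat \<Rightarrow> 'a) \<Rightarrow> nat \<Rightarrow> 'a list" where
  "prefix_of x n \<equiv> map x [0..<n]"

lemma prefix_of_add: "prefix_of x (n + k) = prefix_of x n @ prefix_of (\<lambda>j. x (n + j)) k"
  by (rule nth_equalityI) (auto simp: nth_append)

text \<open>\<open>cut_pos c x n\<close> is the position in the image of \<open>x\<close> where the image of its \<open>n\<close>-th letter
  begins.\<close>

definition cut_pos :: "('a \<Rightarrow> 'b list) \<Rightarrow> (nat \<Rightarrow> 'a) \<Rightarrow> nat \<Rightarrow> nat" where
  "cut_pos c x n = length (app c (prefix_of x n))"

text \<open>The image of the first \<open>k + 1\<close> letters has more than \<open>k\<close> letters when nothing is erased,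
  so it determines the letter at position \<open>k\<close>.\<close>

definition img :: "('a \<Rightarrow> 'b list) \<Rightarrow> (nat \<Rightarrow> 'a) \<Rightarrow> nat \<Rightarrow> 'b" where
  "img c x k = app c (prefix_of x (Suc k)) ! k"

lemma cut_pos_ge: "nonerasing c \<Longrightarrow> n \<le> cut_pos c x n"
  using length_app_ge[of c "prefix_of x n"] by (simp add: cut_pos_def)

lemma cut_pos_0 [simp]: "cut_pos c x 0 = 0"
  by (simp add: cut_pos_def)

lemma cut_pos_Suc: "cut_pos c x (Suc n) = cut_pos c x n + length (c (x n))"
  by (simp add: cut_pos_def)

lemma cut_pos_between:
  assumes "nonerasing c"
  obtains n where "cut_pos c x n \<le> q" "q < cut_pos c x (Suc n)"
proof -
  let ?P = "\<lambda>n. q < cut_pos c x n"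
  have "?P (Suc q)" using cut_pos_ge[OF assms, of "Suc q" x] by simp
  then obtain n where n: "?P n" "\<forall>m<n. \<not> ?P m"
    using exists_least_iff[of ?P] by blast
  then obtain m where "n = Suc m" by (cases n) auto
  then show ?thesis using n that[of m] by auto
qed

lemma app_prefix_nth:
  assumes "k < cut_pos c x m" "m \<le> n"
  shows "app c (prefix_of x n) ! k = app c (prefix_of x m) ! k"
proof -
  have "app c (prefix_of x n)
      = app c (prefix_of x m) @ app c (prefix_of (\<lambda>j. x (m + j)) (n - m))"
    using assms(2) prefix_of_add[of x m "n - m"] by simp
  then show ?thesis using assms(1) by (simp add: nth_append cut_pos_def)
qed

lemma img_prefix:
  assumes "nonerasing c"
  shows "prefix_of (img c x) (cut_pos c x n) = app c (prefix_of x n)"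
proof (rule nth_equalityI)
  fix k assume "k < length (prefix_of (img c x) (cut_pos c x n))"
  then have k: "k < cut_pos c x n" by simp
  have k': "k < cut_pos c x (Suc k)" using cut_pos_ge[OF assms, of "Suc k" x] by simp
  have "app c (prefix_of x (Suc k)) ! k = app c (prefix_of x n) ! k"
  proof (cases "Suc k \<le> n")
    case True
    then show ?thesis using app_prefix_nth[OF k' True] by simp
  next
    case False
    then have "n \<le> Suc k" by simp
    then show ?thesis using app_prefix_nth[OF k] by blast
  qed
  then show "prefix_of (img c x) (cut_pos c x n) ! k = app c (prefix_of x n) ! k"
    using k by (simp add: img_def)
qed (simp add: cut_pos_def)

lemma img_unique:
  assumes "nonerasing c" "\<And>n. prefix_of y (cut_pos c x n) = app c (prefix_of x n)"
  shows "y = img c x"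
proof
  fix k
  have k: "k < cut_pos c x (Suc k)" using cut_pos_ge[OF assms(1), of "Suc k" x] by simp
  have "y k = prefix_of y (cut_pos c x (Suc k)) ! k" using k by simp
  also have "\<dots> = img c x k" using assms(2)[of "Suc k"] by (simp add: img_def)
  finally show "y k = img c x k" .
qed

lemma cut_pos_add: "cut_pos c x (n + k) = cut_pos c x n + cut_pos c (\<lambda>j. x (n + j)) k"
  unfolding cut_pos_def prefix_of_add by simp

lemma img_shift:
  assumes "nonerasing c"
  shows "img c x (cut_pos c x n + k) = img c (\<lambda>j. x (n + j)) k"
proof -
  let ?x = "\<lambda>j. x (n + j)"
  have "(\<lambda>k. img c x (cut_pos c x n + k)) = img c ?x"
  proof (rule img_unique[OF assms])
    fix m
    have "app c (prefix_of x n) @ prefix_of (\<lambda>k. img c x (cut_pos c x n + k)) (cut_pos c ?x m)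
        = prefix_of (img c x) (cut_pos c x (n + m))"
      unfolding cut_pos_add prefix_of_add[of "img c x"] img_prefix[OF assms] by simp
    also have "\<dots> = app c (prefix_of x n) @ app c (prefix_of ?x m)"
      unfolding img_prefix[OF assms] prefix_of_add by simp
    finally show "prefix_of (\<lambda>k. img c x (cut_pos c x n + k)) (cut_pos c ?x m)
        = app c (prefix_of ?x m)"
      by simp
  qed
  then show ?thesis by metis
qed

lemma img_0: "nonerasing c \<Longrightarrow> img c x 0 = hd (c (x 0))"
  using nonerasingD[of c "x 0"] by (simp add: img_def hd_conv_nth nth_append)

lemma img_comp:
  assumes "nonerasing c" "nonerasing d"
  shows "img c (img d x) = img (\<lambda>a. app c (d a)) x"
proof (rule img_unique)
  show ne: "nonerasing (\<lambda>a. app c (d a))"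
    unfolding nonerasing_def
  proof
    fix a
    show "app c (d a) \<noteq> []"
      using length_app_ge[OF assms(1), of "d a"] nonerasingD[OF assms(2), of a] by auto
  qed
  fix n
  have *: "app (\<lambda>a. app c (d a)) (prefix_of x n) = app c (prefix_of (img d x) (cut_pos d x n))"
    using img_prefix[OF assms(2)] by (simp add: app_app)
  show "prefix_of (img c (img d x)) (cut_pos (\<lambda>a. app c (d a)) x n)
      = app (\<lambda>a. app c (d a)) (prefix_of x n)"
    using img_prefix[OF assms(1), of "img d x" "cut_pos d x n"] *
    by (simp add: cut_pos_def)
qed

section \<open>Languages of infinite words\<close>

lemma occurs_at_prefix:
  assumes "prefix_of w N = p @ u @ s"
  shows "occurs_at w u (length p)"
  unfolding occurs_at_def
proof (rule nth_equalityI)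
  fix j assume "j < length (map w [length p..<length p + length u])"
  then have j: "j < length u" by simp
  have len: "N = length p + length u + length s" using arg_cong[OF assms, of length] by simp
  have "prefix_of w N ! (length p + j) = u ! j" unfolding assms using j by (simp add: nth_append)
  then show "map w [length p..<length p + length u] ! j = u ! j" using j len by simp
qed simp

lemma language_iff_prefix: "u \<in> language w \<longleftrightarrow> (\<exists>N. sublist u (prefix_of w N))"
proof
  assume "u \<in> language w"
  then obtain k where k: "map w [k..<k + length u] = u"
    by (auto simp: language_def occurs_at_def)
  have "prefix_of w (k + length u) = prefix_of w k @ map w [k..<k + length u]"
    by (metis le_add1 le_add_same_cancel1 map_append upt_add_eq_append zero_le)
  then show "\<exists>N. sublist u (prefix_of w N)" using k by (metis sublist_appendI append_Nil2)
next
  assume "\<exists>N. sublist u (prefix_of w N)"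
  then obtain N p s where *: "prefix_of w N = p @ u @ s" by (auto simp: sublist_def)
  from occurs_at_prefix[OF *] show "u \<in> language w" by (auto simp: language_def)
qed

definition factorial_lang :: "'a list set \<Rightarrow> bool" where
  "factorial_lang L \<longleftrightarrow> (\<forall>u\<in>L. \<forall>v. sublist v u \<longrightarrow> v \<in> L)"

lemma factorial_langD: "factorial_lang L \<Longrightarrow> u \<in> L \<Longrightarrow> sublist v u \<Longrightarrow> v \<in> L"
  by (auto simp: factorial_lang_def)

lemma factorial_language: "factorial_lang (language w)"
  unfolding factorial_lang_def using language_iff_prefix sublist_order.order.trans by metis

lemma prefix_in_language: "prefix_of w n \<in> language w"
  unfolding language_iff_prefix by blast

lemma language_right_extendable:
  assumes "u \<in> language w" shows "\<exists>b. u @ [b] \<in> language w"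
proof -
  obtain k where k: "map w [k..<k + length u] = u"
    using assms by (auto simp: language_def occurs_at_def)
  then have "map w [k..<k + length (u @ [w (k + length u)])] = u @ [w (k + length u)]" by simp
  then show ?thesis by (auto simp: language_def occurs_at_def)
qed

lemma in_language_map: "map w [k..<k + n] \<in> language w"
  by (auto simp: language_def occurs_at_def)

lemma letter_in_language: "[a] \<in> language w \<longleftrightarrow> a \<in> range w"
  by (auto simp: language_def occurs_at_def)

definition image_lang :: "('a \<Rightarrow> 'b list) \<Rightarrow> 'a list set \<Rightarrow> 'b list set" where
  "image_lang c L = {u. \<exists>v\<in>L. sublist u (app c v)}"

lemma factorial_image_lang: "factorial_lang (image_lang c L)"
  unfolding factorial_lang_def image_lang_def using sublist_order.order.trans by blast

lemma sublist_app: "sublist u v \<Longrightarrow> sublist (app c u) (app c v)"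
  unfolding sublist_def by force

lemma image_langI: "v \<in> L \<Longrightarrow> app c v \<in> image_lang c L"
  by (auto simp: image_lang_def)

lemma image_lang_comp: "image_lang c (image_lang d L) = image_lang (\<lambda>a. app c (d a)) L"
proof (intro equalityI subsetI)
  fix u assume "u \<in> image_lang c (image_lang d L)"
  then obtain v x where v: "x \<in> L" "sublist v (app d x)" "sublist u (app c v)"
    by (auto simp: image_lang_def)
  then have "sublist u (app c (app d x))"
    using sublist_app sublist_order.order.trans by blast
  then show "u \<in> image_lang (\<lambda>a. app c (d a)) L" using v by (auto simp: image_lang_def app_app)
qed (auto simp: image_lang_def simp flip: app_app)

lemma language_img:
  assumes "nonerasing c"
  shows "language (img c x) = image_lang c (language x)"
proof (intro equalityI subsetI)
  fix u assume "u \<in> language (img c x)"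
  then obtain N where N: "sublist u (prefix_of (img c x) N)" by (auto simp: language_iff_prefix)
  have "cut_pos c x N = N + (cut_pos c x N - N)" using cut_pos_ge[OF assms, of N x] by simp
  then have "prefix (prefix_of (img c x) N) (prefix_of (img c x) (cut_pos c x N))"
    using prefix_of_add by (metis prefixI)
  then have "sublist u (app c (prefix_of x N))"
    using N img_prefix[OF assms, of x N] prefix_imp_sublist sublist_order.order.trans by metis
  then show "u \<in> image_lang c (language x)"
    using prefix_in_language by (auto simp: image_lang_def)
next
  fix u assume "u \<in> image_lang c (language x)"
  then obtain v where v: "v \<in> language x" "sublist u (app c v)" by (auto simp: image_lang_def)
  then obtain N where "sublist v (prefix_of x N)" by (auto simp: language_iff_prefix)
  then have "sublist u (app c (prefix_of x N))"
    using v(2) sublist_app sublist_order.order.trans by blast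
  then show "u \<in> language (img c x)"
    using img_prefix[OF assms, of x N] by (metis language_iff_prefix)
qed

section \<open>Desubstitution of directive words\<close>

lemma directive_word_0 [simp]: "directive_word \<sigma> 0 u = u"
  by (simp add: directive_word_def)

lemma directive_word_Suc:
  "directive_word \<sigma> (Suc n) u = app (\<sigma> 0) (directive_word (\<lambda>k. \<sigma> (Suc k)) n u)"
proof -
  have "[0..<Suc n] = 0 # map Suc [0..<n]"
    by (metis map_Suc_upt upt_conv_Cons zero_less_Suc)
  then show ?thesis by (simp add: directive_word_def foldr_map comp_def)
qed

lemma directive_word_snoc: "directive_word \<sigma> (Suc n) u = directive_word \<sigma> n (app (\<sigma> n) u)"
  by (simp add: directive_word_def)

lemma directive_word_add:
  "directive_word \<sigma> (m + n) u = directive_word \<sigma> m (directive_word (\<lambda>k. \<sigma> (m + k)) n u)"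
  by (induction n arbitrary: u) (simp_all add: directive_word_snoc)

lemma directive_word_conv_app: "directive_word \<sigma> n u = app (\<lambda>a. directive_word \<sigma> n [a]) u"
proof (induction n arbitrary: \<sigma>)
  case 0
  show ?case by (induction u) auto
next
  case (Suc n)
  let ?d = "\<lambda>a. directive_word (\<lambda>k. \<sigma> (Suc k)) n [a]"
  have "directive_word \<sigma> (Suc n) u = app (\<sigma> 0) (app ?d u)"
    using Suc[of "\<lambda>k. \<sigma> (Suc k)"] by (simp add: directive_word_Suc)
  also have "\<dots> = app (\<lambda>a. app (\<sigma> 0) (?d a)) u" by (rule app_app)
  finally show ?case by (simp add: directive_word_Suc)
qed

definition is_C :: "(3 \<Rightarrow> 3 list) \<Rightarrow> bool" where
  "is_C c \<longleftrightarrow> c = c1 \<or> c = c2"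

lemma is_C_cases [consumes 1, case_names c1 c2]:
  "is_C c \<Longrightarrow> (c = c1 \<Longrightarrow> P) \<Longrightarrow> (c = c2 \<Longrightarrow> P) \<Longrightarrow> P"
  by (auto simp: is_C_def)

lemma nonerasing_C: "is_C c \<Longrightarrow> nonerasing c"
  by (auto simp: is_C_def nonerasing_def c1_def c2_def split: if_splits)

lemma length_C_le: "is_C c \<Longrightarrow> length (c a) \<le> 2"
  by (auto simp: is_C_def c1_def c2_def)

lemma letter_cases: obtains "(a::3) = 1" | "a = 2" | "a = 3"
  using exhaust_3[of a] by blast

lemma c1_hd: "u \<noteq> [] \<Longrightarrow> hd (app c1 u) \<noteq> 3"
  by (cases u) (auto simp: c1_def)

text \<open>Decoding needs a delay of one letter: \<open>c1 1\<close> is a prefix of \<open>c1 2\<close>, but the letter 3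
  that tells them apart never begins an image under \<open>c1\<close>. The images under \<open>c2\<close> form a prefix
  code.\<close>

lemma decode_C:
  assumes "is_C c"
    and "take (2 * m + 1) (app c u) = take (2 * m + 1) (app c v)"
    and "2 * m + 1 \<le> length (app c u)" "2 * m + 1 \<le> length (app c v)"
  shows "m \<le> length u \<and> m \<le> length v \<and> take m u = take m v"
  using assms(2-)
proof (induction m arbitrary: u v)
  case (Suc m)
  from Suc.prems obtain a u' where u: "u = a # u'" by (cases u) auto
  from Suc.prems obtain b v' where v: "v = b # v'" by (cases v) auto
  have ab: "a = b"
  proof (rule ccontr)
    assume ne: "a \<noteq> b"
    have u0: "app c u ! 0 = app c v ! 0"
      using Suc.prems(1) by (metis nth_take zero_less_Suc add.commute plus_1_eq_Suc)
    have "1 < 2 * Suc m + 1" by simp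
    then have u1: "app c u ! 1 = app c v ! 1" using Suc.prems(1) by (metis nth_take)
    have n3: "app c1 x ! 0 \<noteq> 3" if "x \<noteq> []" for x
      using c1_hd[OF that] length_app_ge[OF nonerasing_C, of c1 x] that
      by (cases "app c1 x") (auto simp: is_C_def)
    from assms(1) show False
    proof (cases rule: is_C_cases)
      case c1
      have "u' \<noteq> []" "v' \<noteq> []"
        using Suc.prems(2,3) length_C_le[OF assms(1), of a] length_C_le[OF assms(1), of b]
        by (auto simp: u v)
      with n3[of u'] n3[of v'] have "app c u' ! 0 \<noteq> 3" "app c v' ! 0 \<noteq> 3" by (simp_all add: c1)
      with u0 u1 ne c1 show False
        by (cases a rule: letter_cases; cases b rule: letter_cases; simp add: u v c1_letters)
    next
      case c2
      with u0 ne show False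
        by (cases a rule: letter_cases; cases b rule: letter_cases; simp add: u v c2_letters)
    qed
  qed
  have l: "length (c a) \<le> 2" by (rule length_C_le[OF assms(1)])
  have *: "take (2 * m + 1) (app c u') = take (2 * m + 1) (app c v')"
  proof -
    have "take (2 * Suc m + 1 - length (c a)) (app c u')
        = take (2 * Suc m + 1 - length (c a)) (app c v')"
      using Suc.prems(1) by (simp add: u v ab)
    then have "take (2 * m + 1) (take (2 * Suc m + 1 - length (c a)) (app c u'))
        = take (2 * m + 1) (take (2 * Suc m + 1 - length (c a)) (app c v'))" by simp
    moreover have "min (2 * m + 1) (2 * Suc m + 1 - length (c a)) = 2 * m + 1" using l by auto
    ultimately show ?thesis by (simp only: take_take)
  qed
  have "2 * m + 1 \<le> length (app c u')" "2 * m + 1 \<le> length (app c v')"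
    using Suc.prems(2,3) l by (auto simp: u v ab)
  from Suc.IH[OF * this] show ?case by (simp add: u v ab)
qed simp

lemma desubstitute_limit:
  assumes "is_C c" and lim: "words_tendsto (\<lambda>n. app c (v n)) w"
  shows "\<exists>x. words_tendsto v x \<and> w = img c x"
proof -
  have "\<exists>N. \<forall>n\<ge>N. 2 * m + 1 \<le> length (app c (v n))
          \<and> take (2 * m + 1) (app c (v n)) = prefix_of w (2 * m + 1)" for m
    using lim unfolding words_tendsto_def eventually_sequentially by blast
  then obtain N where N: "\<And>m n. n \<ge> N m \<Longrightarrow> 2 * m + 1 \<le> length (app c (v n))
          \<and> take (2 * m + 1) (app c (v n)) = prefix_of w (2 * m + 1)" by metis
  have dec: "m \<le> length (v n) \<and> take m (v n) = take m (v n')" if "n \<ge> N m" "n' \<ge> N m" for m n n'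
    using decode_C[OF assms(1), of m "v n" "v n'"] N[OF that(1)] N[OF that(2)] by simp
  define x where "x k = v (N (Suc k)) ! k" for k
  have x: "take m (v n) = prefix_of x m" if n: "n \<ge> N m" for m n
  proof (rule nth_equalityI)
    have len: "m \<le> length (v n)" using dec[OF n n] by simp
    then show "length (take m (v n)) = length (prefix_of x m)" by simp
    fix k assume "k < length (take m (v n))"
    then have k: "k < m" by simp
    define n' where "n' = max n (N (Suc k))"
    have "take m (v n) ! k = take m (v n') ! k" using dec[of m n n'] n by (simp add: n'_def)
    also have "\<dots> = take (Suc k) (v n') ! k" using k by simp
    also have "\<dots> = take (Suc k) (v (N (Suc k))) ! k"
      using dec[of "Suc k" n' "N (Suc k)"] by (simp add: n'_def)
    finally show "take m (v n) ! k = prefix_of x m ! k" using k by (simp add: x_def)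
  qed
  have 1: "words_tendsto v x"
    unfolding words_tendsto_def eventually_sequentially using x dec by blast
  have "w = img c x"
  proof (rule img_unique[OF nonerasing_C[OF assms(1)]])
    fix n
    obtain K where K: "\<And>k. k \<ge> K \<Longrightarrow> cut_pos c x n \<le> length (app c (v k))
        \<and> take (cut_pos c x n) (app c (v k)) = prefix_of w (cut_pos c x n)"
      using lim unfolding words_tendsto_def eventually_sequentially by meson
    define k where "k = max K (N n)"
    have "app c (v k) = app c (prefix_of x n) @ app c (drop n (v k))"
      using x[of n k] app_simps(3)[of c "take n (v k)" "drop n (v k)"]
      by (metis append_take_drop_id k_def max.cobounded2)
    then show "prefix_of w (cut_pos c x n) = app c (prefix_of x n)"
      using K[of k] by (simp add: k_def cut_pos_def)
  qed
  with 1 show ?thesis by blast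
qed

lemma C_adic_is_C: "C_adic w \<sigma> \<Longrightarrow> is_C (\<sigma> n)"
  by (auto simp: C_adic_def is_C_def)

lemma C_adic_desubstitute:
  assumes "C_adic w \<sigma>"
  shows "\<exists>x. C_adic x (\<lambda>k. \<sigma> (Suc k)) \<and> w = img (\<sigma> 0) x"
proof -
  obtain a where a: "words_tendsto (\<lambda>n. directive_word \<sigma> n [a n]) w"
    using assms by (auto simp: C_adic_def)
  define v where "v n = directive_word (\<lambda>k. \<sigma> (Suc k)) n [a (Suc n)]" for n
  have "words_tendsto (\<lambda>n. app (\<sigma> 0) (v n)) w"
    unfolding words_tendsto_def
  proof
    fix m
    have "\<forall>\<^sub>F n in sequentially. m \<le> length (directive_word \<sigma> n [a n])
        \<and> take m (directive_word \<sigma> n [a n]) = prefix_of w m"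
      using a by (auto simp: words_tendsto_def)
    then have "\<forall>\<^sub>F n in sequentially. m \<le> length (directive_word \<sigma> (Suc n) [a (Suc n)])
        \<and> take m (directive_word \<sigma> (Suc n) [a (Suc n)]) = prefix_of w m"
      by (subst eventually_sequentially_Suc)
    then show "\<forall>\<^sub>F n in sequentially. m \<le> length (app (\<sigma> 0) (v n))
        \<and> take m (app (\<sigma> 0) (v n)) = prefix_of w m"
      by (simp only: v_def directive_word_Suc)
  qed
  from desubstitute_limit[OF C_adic_is_C[OF assms] this]
  obtain x where "words_tendsto v x" "w = img (\<sigma> 0) x" by blast
  moreover have "C_adic x (\<lambda>k. \<sigma> (Suc k))"
    unfolding C_adic_def
  proof
    show "\<forall>n. \<sigma> (Suc n) \<in> {c1, c2}" using assms by (auto simp: C_adic_def)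
    show "\<exists>a. words_tendsto (\<lambda>n. directive_word (\<lambda>k. \<sigma> (Suc k)) n [a n]) x"
      using \<open>words_tendsto v x\<close> unfolding v_def by (rule exI[where x = "\<lambda>n. a (Suc n)"])
  qed
  ultimately show ?thesis by (intro exI[of _ x] conjI)
qed

text \<open>All the arguments below run simultaneously over the levels of the directive sequence:
  \<open>W n\<close> is the word that the substitutions from index \<open>n\<close> on generate.\<close>

definition tower :: "(nat \<Rightarrow> 3 \<Rightarrow> 3 list) \<Rightarrow> (nat \<Rightarrow> nat \<Rightarrow> 3) \<Rightarrow> bool" where
  "tower \<sigma> W \<longleftrightarrow> (\<forall>n. C_adic (W n) (\<lambda>k. \<sigma> (n + k)) \<and> W n = img (\<sigma> n) (W (Suc n)))"

lemma C_adic_tower: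
  assumes "C_adic w \<sigma>"
  obtains W where "tower \<sigma> W" "W 0 = w"
proof -
  let ?P = "\<lambda>n x. C_adic x (\<lambda>k. \<sigma> (n + k)) \<and> (n = 0 \<longrightarrow> x = w)"
  let ?Q = "\<lambda>n x y. x = img (\<sigma> n) y"
  have "\<exists>f. \<forall>n. ?P n (f n) \<and> ?Q n (f n) (f (Suc n))"
  proof (rule dependent_nat_choice)
    show "\<exists>x. ?P 0 x" using assms by auto
  next
    fix x n assume "?P n x"
    then have "C_adic x (\<lambda>k. \<sigma> (n + k))" by (rule conjunct1)
    from C_adic_desubstitute[OF this]
    show "\<exists>y. ?P (Suc n) y \<and> ?Q n x y" by simp
  qed
  then obtain f where "\<forall>n. ?P n (f n) \<and> ?Q n (f n) (f (Suc n))" ..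
  then have "tower \<sigma> f" "f 0 = w" unfolding tower_def by blast+
  then show ?thesis by (rule that)
qed

lemma tower_C_adic: "tower \<sigma> W \<Longrightarrow> C_adic (W n) (\<lambda>k. \<sigma> (n + k))"
  and tower_img: "tower \<sigma> W \<Longrightarrow> W n = img (\<sigma> n) (W (Suc n))"
  unfolding tower_def by blast+

lemma tower_is_C: "tower \<sigma> W \<Longrightarrow> is_C (\<sigma> n)"
  using C_adic_is_C[OF tower_C_adic, of \<sigma> W n 0] by simp

lemma tower_shift: "tower \<sigma> W \<Longrightarrow> tower (\<lambda>k. \<sigma> (m + k)) (\<lambda>n. W (m + n))"
  unfolding tower_def
proof (intro allI)
  fix n
  assume "\<forall>n. C_adic (W n) (\<lambda>k. \<sigma> (n + k)) \<and> W n = img (\<sigma> n) (W (Suc n))"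
  from spec[OF this, of "m + n"]
  show "C_adic (W (m + n)) (\<lambda>k. \<sigma> (m + (n + k)))
      \<and> W (m + n) = img (\<sigma> (m + n)) (W (m + Suc n))"
    unfolding add.assoc add_Suc_right .
qed

lemma tower_language: "tower \<sigma> W \<Longrightarrow> language (W n) = image_lang (\<sigma> n) (language (W (Suc n)))"
  using language_img[OF nonerasing_C[OF tower_is_C], of \<sigma> W n "W (Suc n)"]
  by (metis tower_img)

abbreviation level_image :: "(nat \<Rightarrow> 3 \<Rightarrow> 3 list) \<Rightarrow> nat \<Rightarrow> 3 \<Rightarrow> 3 list" where
  "level_image \<sigma> m \<equiv> \<lambda>a. directive_word \<sigma> m [a]"

lemma tower_nonerasing: "tower \<sigma> W \<Longrightarrow> nonerasing (level_image \<sigma> m)"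
proof (induction m arbitrary: \<sigma> W)
  case 0
  then show ?case by (simp add: nonerasing_def)
next
  case (Suc m)
  have "nonerasing (level_image (\<lambda>k. \<sigma> (Suc k)) m)"
    using Suc.IH[OF tower_shift[OF Suc.prems, of 1]] by simp
  then have "app (\<sigma> 0) (level_image (\<lambda>k. \<sigma> (Suc k)) m a) \<noteq> []" for a
    using length_app_ge[OF nonerasing_C[OF tower_is_C[OF Suc.prems]],
        of "level_image (\<lambda>k. \<sigma> (Suc k)) m a" 0] nonerasingD by fastforce
  then show ?case by (simp add: nonerasing_def directive_word_Suc)
qed

lemma tower_level: "tower \<sigma> W \<Longrightarrow> W 0 = img (level_image \<sigma> m) (W m)"
proof (induction m arbitrary: \<sigma> W)
  case 0
  have "nonerasing (level_image \<sigma> 0)" by (rule tower_nonerasing[OF 0])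
  then have "W 0 = img (level_image \<sigma> 0) (W 0)"
  proof (rule img_unique)
    fix n
    have "app (level_image \<sigma> 0) u = u" for u
      using directive_word_conv_app[of \<sigma> 0 u] by simp
    then show "prefix_of (W 0) (cut_pos (level_image \<sigma> 0) (W 0) n)
        = app (level_image \<sigma> 0) (prefix_of (W 0) n)" by (simp add: cut_pos_def)
  qed
  then show ?case by simp
next
  case (Suc m)
  let ?\<sigma> = "\<lambda>k. \<sigma> (Suc k)"
  have t: "tower ?\<sigma> (\<lambda>n. W (Suc n))" using tower_shift[OF Suc.prems, of 1] by simp
  have "W 0 = img (\<sigma> 0) (img (level_image ?\<sigma> m) (W (Suc m)))"
    using tower_img[OF Suc.prems, of 0] Suc.IH[OF t] by simp
  also have "\<dots> = img (level_image \<sigma> (Suc m)) (W (Suc m))"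
    unfolding directive_word_Suc
    by (rule img_comp[OF nonerasing_C[OF tower_is_C[OF Suc.prems]] tower_nonerasing[OF t]])
  finally show ?case .
qed

section \<open>Bipartite trees\<close>

text \<open>A finite bipartite graph without isolated vertices is given by its set of edges. Trees are
  built by attaching leaves, on the left or on the right; this description makes all counting
  arguments inductions.\<close>

inductive btree :: "('a \<times> 'b) set \<Rightarrow> bool" where
  single: "btree {(a, b)}"
| leafL: "btree E \<Longrightarrow> b \<in> snd ` E \<Longrightarrow> a \<notin> fst ` E \<Longrightarrow> btree (insert (a, b) E)"
| leafR: "btree E \<Longrightarrow> a \<in> fst ` E \<Longrightarrow> b \<notin> snd ` E \<Longrightarrow> btree (insert (a, b) E)"

text \<open>For an extension graph that is spanned by its edges this is the multiplicity of the factor. A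
  nonempty forest with \<open>k\<close> components has value \<open>1 - k\<close>.\<close>

definition mult :: "('a \<times> 'b) set \<Rightarrow> int" where
  "mult E = (if E = {} then 0
     else int (card E) - int (card (fst ` E)) - int (card (snd ` E)) + 1)"

lemma mult_empty [simp]: "mult {} = 0"
  by (simp add: mult_def)

lemma mult_singleton [simp]: "mult {e} = 0"
  by (simp add: mult_def)

lemma mult_leafL:
  assumes "finite E" "E \<noteq> {}" "a \<notin> fst ` E"
  shows "mult (insert (a, b) E) = mult E - (if b \<in> snd ` E then 0 else 1)"
proof -
  have "(a, b) \<notin> E" using assms(3) by force
  then show ?thesis using assms by (simp add: mult_def card_insert_if)
qed

lemma mult_leafR:
  assumes "finite E" "E \<noteq> {}" "b \<notin> snd ` E"
  shows "mult (insert (a, b) E) = mult E - (if a \<in> fst ` E then 0 else 1)"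
proof -
  have "(a, b) \<notin> E" using assms(3) by force
  then show ?thesis using assms by (simp add: mult_def card_insert_if)
qed

lemma btree_finite: "btree T \<Longrightarrow> finite T"
  by (induction rule: btree.induct) auto

text \<open>Removing the last leaf of the tree from a subgraph either removes a pendant edge, or
  a whole component, or nothing.\<close>

lemma subforest:
  assumes "btree T" "S \<subseteq> T"
  shows "mult S \<le> 0 \<and> (S \<noteq> {} \<and> mult S = 0 \<longrightarrow> btree S)"
  using assms
proof (induction arbitrary: S rule: btree.induct)
  case (single a b)
  then have "S = {} \<or> S = {(a, b)}" by auto
  then show ?case by (auto intro: btree.single)
next
  case (leafL E b a)
  define S' where "S' = S - {(a, b)}"
  have S': "S' \<subseteq> E" "finite S'" "a \<notin> fst ` S'"
    using leafL.prems leafL.hyps btree_finite[OF leafL.hyps(1)]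
    by (auto simp: S'_def intro: finite_subset)
  note IH = leafL.IH[OF S'(1)]
  show ?case
  proof (cases "(a, b) \<in> S")
    case False
    then have "S' = S" by (auto simp: S'_def)
    then show ?thesis using IH by simp
  next
    case True
    then have S: "S = insert (a, b) S'" by (auto simp: S'_def)
    show ?thesis
    proof (cases "S' = {}")
      case True
      then show ?thesis by (simp add: S btree.single)
    next
      case False
      have "btree S" if "mult S = 0"
        unfolding S
      proof (rule btree.leafL)
        have "b \<in> snd ` S' \<and> mult S' = 0"
          using that IH mult_leafL[OF S'(2) False S'(3), of b] by (auto simp: S split: if_splits)
        then show "btree S'" "b \<in> snd ` S'" using IH False by auto
        show "a \<notin> fst ` S'" by (rule S'(3))
      qed
      then show ?thesis
        using IH mult_leafL[OF S'(2) False S'(3), of b] by (auto simp: S)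
    qed
  qed
next
  case (leafR E a b)
  define S' where "S' = S - {(a, b)}"
  have S': "S' \<subseteq> E" "finite S'" "b \<notin> snd ` S'"
    using leafR.prems leafR.hyps btree_finite[OF leafR.hyps(1)]
    by (auto simp: S'_def intro: finite_subset)
  note IH = leafR.IH[OF S'(1)]
  show ?case
  proof (cases "(a, b) \<in> S")
    case False
    then have "S' = S" by (auto simp: S'_def)
    then show ?thesis using IH by simp
  next
    case True
    then have S: "S = insert (a, b) S'" by (auto simp: S'_def)
    show ?thesis
    proof (cases "S' = {}")
      case True
      then show ?thesis by (simp add: S btree.single)
    next
      case False
      have "btree S" if "mult S = 0"
        unfolding S
      proof (rule btree.leafR)
        have "a \<in> fst ` S' \<and> mult S' = 0"
          using that IH mult_leafR[OF S'(2) False S'(3), of a] by (auto simp: S split: if_splits)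
        then show "btree S'" "a \<in> fst ` S'" using IH False by auto
        show "b \<notin> snd ` S'" by (rule S'(3))
      qed
      then show ?thesis
        using IH mult_leafR[OF S'(2) False S'(3), of a] by (auto simp: S)
    qed
  qed
qed

text \<open>Removing an edge disconnects a tree: some labelling of the vertices is constant along all
  other edges but not along this one.\<close>

lemma btree_separating_labels:
  assumes "btree T" "e \<in> T"
  shows "\<exists>(\<alpha> :: 'a \<Rightarrow> int) (\<beta> :: 'b \<Rightarrow> int).
    (\<forall>(a, b)\<in>T - {e}. \<alpha> a = \<beta> b) \<and> \<alpha> (fst e) \<noteq> \<beta> (snd e)"
  using assms
proof (induction rule: btree.induct)
  case (single a b)
  then show ?case by (intro exI[of _ "\<lambda>_. 0"] exI[of _ "\<lambda>_. 1"]) auto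
next
  case (leafL E b a)
  show ?case
  proof (cases "e = (a, b)")
    case True
    have "\<alpha> x = 0" if "(x, y) \<in> E" "\<alpha> = (\<lambda>x. if x = a then 1 else (0::int))" for x y \<alpha>
      using leafL.hyps(3) that by force
    then show ?thesis using True
      by (intro exI[of _ "\<lambda>x. if x = a then 1 else 0"] exI[of _ "\<lambda>_. 0"]) auto
  next
    case False
    then have "e \<in> E" using leafL.prems by auto
    then obtain \<alpha> :: "'a \<Rightarrow> int" and \<beta> :: "'b \<Rightarrow> int"
      where *: "\<forall>(a, b)\<in>E - {e}. \<alpha> a = \<beta> b" "\<alpha> (fst e) \<noteq> \<beta> (snd e)"
      using leafL.IH by blast
    have a: "x \<noteq> a" if "(x, y) \<in> E" for x y using that leafL.hyps(3) by force
    have "case e' of (x, y) \<Rightarrow> (\<alpha>(a := \<beta> b)) x = \<beta> y" if "e' \<in> insert (a, b) E - {e}" for e'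
      using that * a by (cases e') auto
    moreover have "(\<alpha>(a := \<beta> b)) (fst e) \<noteq> \<beta> (snd e)"
      using * a[of "fst e" "snd e"] \<open>e \<in> E\<close> by simp
    ultimately show ?thesis by (intro exI[of _ "\<alpha>(a := \<beta> b)"] exI[of _ \<beta>]) simp
  qed
next
  case (leafR E a b)
  show ?case
  proof (cases "e = (a, b)")
    case True
    have "y \<noteq> b" if "(x, y) \<in> E" for x y using that leafR.hyps(3) by force
    then show ?thesis using True
      by (intro exI[of _ "\<lambda>_. 0"] exI[of _ "\<lambda>y. if y = b then 1 else 0"]) auto
  next
    case False
    then have "e \<in> E" using leafR.prems by auto
    then obtain \<alpha> :: "'a \<Rightarrow> int" and \<beta> :: "'b \<Rightarrow> int"
      where *: "\<forall>(a, b)\<in>E - {e}. \<alpha> a = \<beta> b" "\<alpha> (fst e) \<noteq> \<beta> (snd e)"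
      using leafR.IH by blast
    have b: "y \<noteq> b" if "(x, y) \<in> E" for x y using that leafR.hyps(3) by force
    have "case e' of (x, y) \<Rightarrow> \<alpha> x = (\<beta>(b := \<alpha> a)) y" if "e' \<in> insert (a, b) E - {e}" for e'
      using that * b by (cases e') auto
    moreover have "\<alpha> (fst e) \<noteq> (\<beta>(b := \<alpha> a)) (snd e)"
      using * b[of "fst e" "snd e"] \<open>e \<in> E\<close> by simp
    ultimately show ?thesis by (intro exI[of _ \<alpha>] exI[of _ "\<beta>(b := \<alpha> a)"]) simp
  qed
qed

definition bip_edges :: "('a \<times> 'b) set \<Rightarrow> ('a + 'b) set set" where
  "bip_edges E = {{Inl a, Inr b} | a b. (a, b) \<in> E}"

lemma card_bip_edges: "card (bip_edges E) = card E"
proof -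
  have "bip_edges E = (\<lambda>(a, b). {Inl a, Inr b}) ` E" by (auto simp: bip_edges_def)
  moreover have "inj_on (\<lambda>(a, b). {Inl a, Inr b}) E"
    by (auto simp: inj_on_def doubleton_eq_iff)
  ultimately show ?thesis by (simp add: card_image)
qed

lemma finite_bip_edges: "finite E \<Longrightarrow> finite (bip_edges E)"
proof -
  have "bip_edges E = (\<lambda>(a, b). {Inl a, Inr b}) ` E" by (auto simp: bip_edges_def)
  then show "finite E \<Longrightarrow> finite (bip_edges E)" by simp
qed

lemma cycle_two_neighbours:
  assumes "graph_cycle E xs" "z \<in> set xs"
  shows "\<exists>x y. x \<noteq> y \<and> {z, x} \<in> E \<and> {z, y} \<in> E"
proof -
  define n where "n = length xs"
  have n: "n \<ge> 3" and d: "distinct xs"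
    and e: "\<And>i. i < n \<Longrightarrow> {xs ! i, xs ! (Suc i mod n)} \<in> E"
    using assms(1) by (auto simp: graph_cycle_def n_def)
  obtain k where k: "k < n" "xs ! k = z" using assms(2) by (auto simp: in_set_conv_nth n_def)
  define j where "j = (if k = 0 then n - 1 else k - 1)"
  have j: "j < n" "Suc j mod n = k" using k n by (auto simp: j_def)
  have "Suc k mod n = (if Suc k = n then 0 else Suc k)" using k by auto
  then have "Suc k mod n < n" "Suc k mod n \<noteq> j" using k n by (auto simp: j_def)
  then have "xs ! (Suc k mod n) \<noteq> xs ! j"
    using d j(1) by (simp add: nth_eq_iff_index_eq n_def)
  moreover have "{z, xs ! (Suc k mod n)} \<in> E" using e[OF k(1)] k(2) by simp
  moreover have "{z, xs ! j} \<in> E" using e[OF j(1)] j(2) k(2) by (simp add: insert_commute)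
  ultimately show ?thesis by blast
qed

lemma cycle_mono:
  assumes "graph_cycle E xs" "\<And>e. e \<in> E \<Longrightarrow> e \<subseteq> set xs \<Longrightarrow> e \<in> F"
  shows "graph_cycle F xs"
proof -
  have "{xs ! i, xs ! (Suc i mod length xs)} \<in> F" if "i < length xs" for i
  proof (rule assms(2))
    show "{xs ! i, xs ! (Suc i mod length xs)} \<in> E"
      using assms(1) that by (simp add: graph_cycle_def)
    have "Suc i mod length xs < length xs" using that by (intro mod_less_divisor) auto
    then show "{xs ! i, xs ! (Suc i mod length xs)} \<subseteq> set xs" using that by simp
  qed
  then show ?thesis using assms(1) by (simp add: graph_cycle_def)
qed

text \<open>Since a vertex on a cycle has two neighbours there, a leaf lies on no cycle.\<close>

lemma acyclic_leaf:
  assumes "\<nexists>xs. graph_cycle E xs"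
    and "\<And>y. {z, y} \<in> insert {z, x} E \<Longrightarrow> y = x"
  shows "\<nexists>xs. graph_cycle (insert {z, x} E) xs"
proof
  assume "\<exists>xs. graph_cycle (insert {z, x} E) xs"
  then obtain xs where xs: "graph_cycle (insert {z, x} E) xs" ..
  have "z \<notin> set xs" using cycle_two_neighbours[OF xs] assms(2) by metis
  then have "graph_cycle E xs" by (intro cycle_mono[OF xs]) auto
  then show False using assms(1) by blast
qed

lemma connected_leaf:
  assumes "graph_connected V E" "x \<in> V"
  shows "graph_connected (insert z V) (insert {z, x} E)"
proof -
  let ?R = "{(x, y). {x, y} \<in> E}" and ?R' = "{(a, y). {a, y} \<in> insert {z, x} E}"
  have mono: "?R\<^sup>* \<subseteq> ?R'\<^sup>*" by (intro rtrancl_mono) auto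
  have zx: "(z, x) \<in> ?R'" "(x, z) \<in> ?R'" by (auto simp: insert_commute)
  have V: "(u, v) \<in> ?R'\<^sup>*" if "u \<in> V" "v \<in> V" for u v
    using assms(1) that mono unfolding graph_connected_def by blast
  have zV: "(z, v) \<in> ?R'\<^sup>*" "(v, z) \<in> ?R'\<^sup>*" if "v \<in> V" for v
    using V[OF assms(2) that] V[OF that assms(2)] zx
    by (meson converse_rtrancl_into_rtrancl rtrancl.rtrancl_into_rtrancl)+
  show ?thesis
    unfolding graph_connected_def using V zV by blast
qed

lemma bip_edges_insert: "bip_edges (insert (a, b) E) = insert {Inl a, Inr b} (bip_edges E)"
  by (auto simp: bip_edges_def)

lemma graph_tree_bip_edges:
  assumes "btree T"
  shows "graph_tree (fst ` T <+> snd ` T) (bip_edges T)"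
  using assms
proof (induction rule: btree.induct)
  case (single a b)
  have V: "fst ` {(a, b)} <+> snd ` {(a, b)} = {Inl a, Inr b :: 'a + 'b}" by auto
  have E: "bip_edges {(a, b)} = {{Inl a, Inr b :: 'a + 'b}}" by (auto simp: bip_edges_def)
  have "graph_connected {Inr b :: 'a + 'b} {}" by (auto simp: graph_connected_def)
  from connected_leaf[OF this, of "Inr b" "Inl a"]
  have c: "graph_connected {Inl a, Inr b :: 'a + 'b} {{Inl a, Inr b}}" by simp
  have "\<not> graph_cycle {} xs" for xs :: "('a + 'b) list"
  proof
    assume "graph_cycle {} xs"
    then have "length xs \<ge> 3" "\<forall>i<length xs. False" by (simp_all add: graph_cycle_def)
    from spec[OF this(2), of 0] this(1) show False by linarith
  qed
  then have "\<nexists>xs :: ('a + 'b) list. graph_cycle {} xs" by blast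
  from acyclic_leaf[OF this, of "Inl a" "Inr b"]
  show ?case unfolding graph_tree_def V E using c by (auto simp: doubleton_eq_iff)
next
  case (leafL E b a)
  let ?V = "fst ` E <+> snd ` E"
  have V: "fst ` insert (a, b) E <+> snd ` insert (a, b) E = insert (Inl a) ?V"
    using leafL.hyps(2) by auto
  have c: "graph_connected ?V (bip_edges E)" and ac: "\<nexists>xs. graph_cycle (bip_edges E) xs"
    using leafL.IH by (auto simp: graph_tree_def)
  have "y = Inr b" if "{Inl a, y} \<in> insert {Inl a, Inr b} (bip_edges E)" for y
    using that leafL.hyps(3) by (force simp: bip_edges_def doubleton_eq_iff)
  note acyc = acyclic_leaf[OF ac this]
  have "Inr b \<in> ?V" using leafL.hyps(2) by auto
  from connected_leaf[OF c this] acyc show ?case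
    unfolding V bip_edges_insert graph_tree_def by blast
next
  case (leafR E a b)
  let ?V = "fst ` E <+> snd ` E"
  have V: "fst ` insert (a, b) E <+> snd ` insert (a, b) E = insert (Inr b) ?V"
    using leafR.hyps(2) by auto
  have c: "graph_connected ?V (bip_edges E)" and ac: "\<nexists>xs. graph_cycle (bip_edges E) xs"
    using leafR.IH by (auto simp: graph_tree_def)
  have "y = Inl a" if "{Inr b, y} \<in> insert {Inr b, Inl a} (bip_edges E)" for y
    using that leafR.hyps(3) by (force simp: bip_edges_def doubleton_eq_iff)
  from acyclic_leaf[OF ac, of "Inr b" "Inl a", OF this]
  have acyc: "\<nexists>xs. graph_cycle (insert {Inr b, Inl a} (bip_edges E)) xs" .
  have "Inl a \<in> ?V" using leafR.hyps(2) by auto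
  note conn = connected_leaf[OF c this, of "Inr b"]
  have "{Inr b, Inl a} = {Inl a, Inr b :: 'a + 'b}" by auto
  with conn acyc show ?case
    unfolding V bip_edges_insert graph_tree_def by simp
qed

text \<open>Every vertex other than a root has an edge towards the root, and different vertices have
  different such edges.\<close>

lemma connected_card_le:
  assumes "graph_connected V E" "finite V" "finite E"
  shows "card V \<le> card E + 1"
proof -
  let ?R = "{(x, y). {x, y} \<in> E}"
  obtain r where r: "r \<in> V" using assms(1) by (auto simp: graph_connected_def)
  define d where "d y = (LEAST n. (r, y) \<in> ?R ^^ n)" for y
  have dist: "(r, y) \<in> ?R ^^ d y" if "y \<in> V" for y
  proof -
    have "(r, y) \<in> ?R\<^sup>*" using assms(1) r that by (auto simp: graph_connected_def)
    then have "\<exists>n. (r, y) \<in> ?R ^^ n" by (simp add: rtrancl_power)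
    then show ?thesis unfolding d_def by (rule LeastI_ex)
  qed
  have "\<exists>p. {y, p} \<in> E \<and> d p < d y" if y: "y \<in> V - {r}" for y
  proof -
    have yV: "y \<in> V" using y by simp
    have "d y \<noteq> 0"
    proof
      assume "d y = 0"
      then have "(r, y) \<in> ?R ^^ 0" using dist[OF yV] by simp
      then show False using y by simp
    qed
    then obtain m where m: "d y = Suc m" by (cases "d y") auto
    then have "(r, y) \<in> ?R ^^ Suc m" using dist[OF yV] by simp
    then obtain p where p: "(r, p) \<in> ?R ^^ m" "(p, y) \<in> ?R" by auto
    then have "d p \<le> m" unfolding d_def by (intro Least_le)
    then show ?thesis using p m by (auto simp: insert_commute)
  qed
  then obtain p where p: "\<And>y. y \<in> V - {r} \<Longrightarrow> {y, p y} \<in> E \<and> d (p y) < d y" by metis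
  have "inj_on (\<lambda>y. {y, p y}) (V - {r})"
  proof (rule inj_onI)
    fix x y assume xy: "x \<in> V - {r}" "y \<in> V - {r}" "{x, p x} = {y, p y}"
    then show "x = y" using p[OF xy(1)] p[OF xy(2)] by (auto simp: doubleton_eq_iff)
  qed
  then have "card (V - {r}) \<le> card E"
    using p assms(3) by (intro card_inj_on_le[of "\<lambda>y. {y, p y}"]) auto
  then show ?thesis using assms(2) r by (simp add: card_Diff_singleton)
qed

section \<open>The extension graphs that occur\<close>

lemma letter_neq [simp]:
  "(1::3) \<noteq> 2" "(2::3) \<noteq> 1" "(1::3) \<noteq> 3" "(3::3) \<noteq> 1" "(2::3) \<noteq> 3" "(3::3) \<noteq> 2"
  by simp_all

text \<open>How the substitution \<open>c1\<close> acts on the extensions \<open>(a, b)\<close> of a factor: the left letter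
  becomes the last letter of \<open>c1 a\<close>, which determines \<open>a\<close>; the right letter becomes the first
  letter of \<open>c1 b\<close>, which merges the letters 1 and 2. These two are told apart one letter later,
  which is what \<open>restrict1\<close> describes: after the common first letter 1 of \<open>c1 1\<close> and \<open>c1 2\<close>
  follows 3 for the letter 2, and 2 for the letter 1 when the letter after it is 3.\<close>

definition merge1 :: "(3 \<times> 3) set \<Rightarrow> (3 \<times> 3) set" where
  "merge1 E = (\<lambda>(a, b). (last (c1 a), hd (c1 b))) ` E"

definition restrict1 :: "(3 \<times> 3) set \<Rightarrow> (3 \<times> 3) set" where
  "restrict1 E = (\<lambda>(a, b). (last (c1 a), if b = 1 then 2 else 3)) ` (E - UNIV \<times> {3})"

definition swap13 :: "3 \<Rightarrow> 3" where
  "swap13 a = (if a = 1 then 3 else if a = 2 then 2 else 1)"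

lemma swap13_simps [simp]: "swap13 1 = 3" "swap13 2 = 2" "swap13 3 = 1"
  by (simp_all add: swap13_def)

lemma swap13_swap13 [simp]: "swap13 (swap13 a) = a"
  by (cases a rule: letter_cases) simp_all

lemma swap13_eq_iff: "swap13 a = b \<longleftrightarrow> a = swap13 b"
  by (metis swap13_swap13)

definition mirror_edges :: "(3 \<times> 3) set \<Rightarrow> (3 \<times> 3) set" where
  "mirror_edges E = (\<lambda>(a, b). (swap13 b, swap13 a)) ` E"

lemma mirror_edges_iff [simp]: "(a, b) \<in> mirror_edges E \<longleftrightarrow> (swap13 b, swap13 a) \<in> E"
proof
  assume "(swap13 b, swap13 a) \<in> E"
  then show "(a, b) \<in> mirror_edges E"
    unfolding mirror_edges_def by (intro image_eqI[of _ _ "(swap13 b, swap13 a)"]) auto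
qed (auto simp: mirror_edges_def)

lemma mirror_mirror_edges [simp]: "mirror_edges (mirror_edges E) = E"
  by auto

lemma mirror_edges_mono: "E \<subseteq> F \<Longrightarrow> mirror_edges E \<subseteq> mirror_edges F"
  by (auto simp: mirror_edges_def)

lemma inj_swap13: "inj swap13"
  by (metis injI swap13_swap13)

lemma fst_mirror_edges: "fst ` mirror_edges E = swap13 ` snd ` E"
  and snd_mirror_edges: "snd ` mirror_edges E = swap13 ` fst ` E"
  by (force simp: mirror_edges_def)+

lemma card_mirror_edges: "card (mirror_edges E) = card E"
  unfolding mirror_edges_def
  by (rule card_image) (auto simp: inj_on_def swap13_eq_iff)

lemma mult_mirror_edges: "mult (mirror_edges E) = mult E"
proof -
  have "card (swap13 ` A) = card A" for A
    using card_image inj_swap13 inj_on_subset by blast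
  moreover have "mirror_edges E = {} \<longleftrightarrow> E = {}" by (auto simp: mirror_edges_def)
  ultimately show ?thesis
    by (simp add: mult_def fst_mirror_edges snd_mirror_edges card_mirror_edges)
qed

text \<open>The six maximal extension graphs. Each is a tree on all six vertices, and the class of their
  subgraphs is closed under all ways in which extension graphs change under desubstitution. The
  crucial feature is that in each tree the right vertices 1 and 2 have a common neighbour (and
  so have the left vertices 2 and 3): merging them does not create a cycle.\<close>

definition max_trees :: "(3 \<times> 3) set set" where
  "max_trees =
    {{(1, 1), (1, 2), (1, 3), (2, 1), (3, 1)},
     {(1, 2), (1, 3), (2, 1), (2, 2), (3, 2)},
     {(1, 2), (1, 3), (2, 1), (3, 1), (3, 2)},
     {(1, 3), (2, 1), (2, 2), (2, 3), (3, 2)},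
     {(1, 3), (2, 1), (2, 3), (3, 1), (3, 2)},
     {(1, 3), (2, 3), (3, 1), (3, 2), (3, 3)}}"

lemma max_trees_cases [consumes 1, case_names 1 2 3 4 5 6]:
  assumes "T \<in> max_trees"
    and "T = {(1, 1), (1, 2), (1, 3), (2, 1), (3, 1)} \<Longrightarrow> P"
    and "T = {(1, 2), (1, 3), (2, 1), (2, 2), (3, 2)} \<Longrightarrow> P"
    and "T = {(1, 2), (1, 3), (2, 1), (3, 1), (3, 2)} \<Longrightarrow> P"
    and "T = {(1, 3), (2, 1), (2, 2), (2, 3), (3, 2)} \<Longrightarrow> P"
    and "T = {(1, 3), (2, 1), (2, 3), (3, 1), (3, 2)} \<Longrightarrow> P"
    and "T = {(1, 3), (2, 3), (3, 1), (3, 2), (3, 3)} \<Longrightarrow> P"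
  shows P
  using assms(1) unfolding max_trees_def
  by (elim insertE) (erule assms(2-) | erule emptyE)+

lemma btree_insertI:
  "btree E \<Longrightarrow> (a \<in> fst ` E) \<noteq> (b \<in> snd ` E) \<Longrightarrow> btree (insert (a, b) E)"
  by (auto intro: btree.leafL btree.leafR)

lemma max_trees_btree: "T \<in> max_trees \<Longrightarrow> btree T"
proof (induction rule: max_trees_cases)
  case 1
  have "btree {(1, 2), (1, 3), (2, 1), (3, 1), (1::3, 1::3)}"
    by (rule btree_insertI, rule btree_insertI, rule btree_insertI, rule btree_insertI,
        rule btree.single, simp_all)
  then show ?case using 1 by (simp add: insert_commute)
next
  case 2
  have "btree {(1, 3), (1, 2), (2, 1), (2, 2), (3::3, 2::3)}"
    by (rule btree_insertI, rule btree_insertI, rule btree_insertI, rule btree_insertI,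
        rule btree.single, simp_all)
  then show ?case using 2 by (simp add: insert_commute)
next
  case 3
  have "btree {(1, 3), (1, 2), (2, 1), (3, 1), (3::3, 2::3)}"
    by (rule btree_insertI, rule btree_insertI, rule btree_insertI, rule btree_insertI,
        rule btree.single, simp_all)
  then show ?case using 3 by (simp add: insert_commute)
next
  case 4
  have "btree {(1, 3), (2, 1), (2, 3), (2, 2), (3::3, 2::3)}"
    by (rule btree_insertI, rule btree_insertI, rule btree_insertI, rule btree_insertI,
        rule btree.single, simp_all)
  then show ?case using 4 by (simp add: insert_commute)
next
  case 5
  have "btree {(1, 3), (2, 3), (2, 1), (3, 1), (3::3, 2::3)}"
    by (rule btree_insertI, rule btree_insertI, rule btree_insertI, rule btree_insertI,
        rule btree.single, simp_all)
  then show ?case using 5 by (simp add: insert_commute)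
next
  case 6
  have "btree {(1, 3), (2, 3), (3, 1), (3, 2), (3::3, 3::3)}"
    by (rule btree_insertI, rule btree_insertI, rule btree_insertI, rule btree_insertI,
        rule btree.single, simp_all)
  then show ?case using 6 by simp
qed

lemma max_trees_card: "T \<in> max_trees \<Longrightarrow> card T = 5"
  by (induction rule: max_trees_cases) simp_all

lemma max_trees_spanning:
  "T \<in> max_trees \<Longrightarrow> fst ` T = UNIV" "T \<in> max_trees \<Longrightarrow> snd ` T = UNIV"
  by (induction rule: max_trees_cases) (auto simp: UNIV_3)+

lemma max_trees_no_square: "T \<in> max_trees \<Longrightarrow> \<not> {(2, 2), (2, 3), (3, 2), (3, 3)} \<subseteq> T"
  by (induction rule: max_trees_cases) simp_all

lemma c1_hd_last [simp]:
  "hd (c1 1) = 1" "hd (c1 2) = 1" "hd (c1 3) = 2" "last (c1 1) = 1" "last (c1 2) = 3" "last (c1 3) = 2"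
  by (simp_all add: c1_letters)

lemma merge1_insert [simp]: "merge1 {} = {}"
    "merge1 (insert (a, b) E) = insert (last (c1 a), hd (c1 b)) (merge1 E)"
  by (simp_all add: merge1_def)

lemma restrict1_insert [simp]: "restrict1 {} = {}"
    "restrict1 (insert (a, b) E) =
      (if b = 3 then restrict1 E
       else insert (last (c1 a), if b = 1 then 2 else 3) (restrict1 E))"
  by (simp_all add: restrict1_def insert_Diff_if)

definition subtree_of_max :: "(3 \<times> 3) set \<Rightarrow> bool" where
  "subtree_of_max E \<longleftrightarrow> (\<exists>T\<in>max_trees. E \<subseteq> T)"

lemma merge1_mono: "E \<subseteq> F \<Longrightarrow> merge1 E \<subseteq> merge1 F"
  by (auto simp: merge1_def)

lemma restrict1_mono: "E \<subseteq> F \<Longrightarrow> restrict1 E \<subseteq> restrict1 F"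
  by (auto simp: restrict1_def)

lemma max_trees_merge1: "T \<in> max_trees \<Longrightarrow> subtree_of_max (insert (1, 3) (merge1 T))"
  by (induction rule: max_trees_cases) (simp_all add: subtree_of_max_def max_trees_def)

lemma max_trees_restrict1: "T \<in> max_trees \<Longrightarrow> subtree_of_max (restrict1 T)"
  by (induction rule: max_trees_cases) (simp_all add: subtree_of_max_def max_trees_def)

lemma mirror_edges_insert [simp]: "mirror_edges {} = {}"
    "mirror_edges (insert (a, b) E) = insert (swap13 b, swap13 a) (mirror_edges E)"
  by (simp_all add: mirror_edges_def)

lemma max_trees_mirror: "T \<in> max_trees \<Longrightarrow> subtree_of_max (mirror_edges T)"
  by (induction rule: max_trees_cases) (simp_all add: subtree_of_max_def max_trees_def)

lemma subtree_of_max_subset: "subtree_of_max F \<Longrightarrow> E \<subseteq> F \<Longrightarrow> subtree_of_max E"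
  by (auto simp: subtree_of_max_def)

lemma subtree_of_max_empty: "subtree_of_max {}"
  by (auto simp: subtree_of_max_def max_trees_def)

lemma subtree_of_max_merge1:
  assumes "subtree_of_max E" shows "subtree_of_max (insert (1, 3) (merge1 E))"
proof -
  obtain T where "T \<in> max_trees" "E \<subseteq> T" using assms by (auto simp: subtree_of_max_def)
  then show ?thesis
    using subtree_of_max_subset[OF max_trees_merge1 insert_mono[OF merge1_mono]] by blast
qed

lemma subtree_of_max_restrict1:
  assumes "subtree_of_max E" shows "subtree_of_max (restrict1 E)"
proof -
  obtain T where "T \<in> max_trees" "E \<subseteq> T" using assms by (auto simp: subtree_of_max_def)
  then show ?thesis
    using subtree_of_max_subset[OF max_trees_restrict1 restrict1_mono] by blast
qed

lemma subtree_of_max_mirror: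
  assumes "subtree_of_max E" shows "subtree_of_max (mirror_edges E)"
proof -
  obtain T where "T \<in> max_trees" "E \<subseteq> T" using assms by (auto simp: subtree_of_max_def)
  then show ?thesis
    using subtree_of_max_subset[OF max_trees_mirror mirror_edges_mono] by blast
qed

lemma mult_nonpos: "subtree_of_max E \<Longrightarrow> mult E \<le> 0"
  using subforest max_trees_btree unfolding subtree_of_max_def by blast

lemma mult_0_btree: "subtree_of_max E \<Longrightarrow> E \<noteq> {} \<Longrightarrow> mult E = 0 \<Longrightarrow> btree E"
  using subforest max_trees_btree unfolding subtree_of_max_def by blast

abbreviation column :: "(3 \<times> 3) set \<Rightarrow> 3 \<Rightarrow> 3 set" where
  "column E b \<equiv> {a. (a, b) \<in> E}"

lemma card_columns:
  "card (E :: (3 \<times> 3) set) = card (column E 1) + card (column E 2) + card (column E 3)"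
proof -
  have "E = prod.swap ` (SIGMA b:UNIV. column E b)" by (auto simp: image_iff)
  then have "card E = card (SIGMA b:UNIV. column E b)" by (metis card_image inj_swap inj_on_subset subset_UNIV)
  also have "\<dots> = (\<Sum>b\<in>UNIV. card (column E b))" by simp
  finally show ?thesis by (simp add: sum_3)
qed

lemma mult_columns:
  fixes E :: "(3 \<times> 3) set"
  defines "A \<equiv> column E 1" and "B \<equiv> column E 2" and "C \<equiv> column E 3"
  shows "mult E = (if A \<union> B \<union> C = {} then 0
    else int (card A) + int (card B) + int (card C) - int (card (A \<union> B \<union> C))
      - of_bool (A \<noteq> {}) - of_bool (B \<noteq> {}) - of_bool (C \<noteq> {}) + 1)"
proof -
  have all: "P 1 \<or> P 2 \<or> P 3" if "P b" for P and b :: 3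
    using that exhaust_3[of b] by auto
  have f: "fst ` E = A \<union> B \<union> C"
  proof (intro equalityI subsetI)
    fix a assume "a \<in> fst ` E"
    then obtain b where "(a, b) \<in> E" by auto
    then show "a \<in> A \<union> B \<union> C" using all[of "\<lambda>b. (a, b) \<in> E" b] by (auto simp: A_def B_def C_def)
  qed (force simp: A_def B_def C_def)
  have "snd ` E = (if A = {} then {} else {1}) \<union> (if B = {} then {} else {2})
      \<union> (if C = {} then {} else {3})" (is "_ = ?S")
  proof (intro equalityI subsetI)
    fix b assume "b \<in> snd ` E"
    then obtain a where "(a, b) \<in> E" by auto
    then show "b \<in> ?S" by (cases b rule: letter_cases) (auto simp: A_def B_def C_def)
  qed (force simp: A_def B_def C_def split: if_splits)
  then have s: "int (card (snd ` E)) = of_bool (A \<noteq> {}) + of_bool (B \<noteq> {}) + of_bool (C \<noteq> {})"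
    by auto
  have e: "E = {} \<longleftrightarrow> A \<union> B \<union> C = {}" using f by auto
  show ?thesis
    unfolding mult_def e f s using card_columns[of E] by (simp add: A_def B_def C_def)
qed

text \<open>The substitution splits the multiplicity of a factor between its two images: the edges lost
  by merging the columns 1 and 2 are those that \<open>restrict1\<close> counts as a surplus.\<close>

lemma mult_merge1_restrict1: "mult (merge1 E) + mult (restrict1 E) = mult E"
proof -
  define A B C where "A = column E 1" and "B = column E 2" and "C = column E 3"
  define l where "l a = last (c1 a)" for a
  have inj: "inj l" unfolding l_def inj_def forall_3 by simp
  have card_l: "card (l ` X) = card X" for X using card_image inj inj_on_subset by blast
  have hd: "hd (c1 b) = 1 \<longleftrightarrow> b = 1 \<or> b = 2" "hd (c1 b) = 2 \<longleftrightarrow> b = 3" "hd (c1 b) \<noteq> 3" for b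
    by (cases b rule: letter_cases; simp)+
  have merge: "(x, y) \<in> merge1 E \<longleftrightarrow> (\<exists>a b. (a, b) \<in> E \<and> x = l a \<and> hd (c1 b) = y)" for x y
    unfolding merge1_def l_def by (auto simp: image_iff Bex_def)
  have m: "column (merge1 E) 1 = l ` (A \<union> B)" "column (merge1 E) 2 = l ` C"
      "column (merge1 E) 3 = {}"
    unfolding merge A_def B_def C_def by (auto simp: image_iff Bex_def hd)
  have "(x, y) \<in> restrict1 E \<longleftrightarrow>
      (\<exists>a b. (a, b) \<in> E \<and> b \<noteq> 3 \<and> x = l a \<and> y = (if b = 1 then 2 else 3))" for x y
    unfolding restrict1_def l_def by (auto simp: image_iff Bex_def)
  moreover have "(\<exists>a b. (a, b) \<in> E \<and> b \<noteq> 3 \<and> x = l a \<and> y = (if b = 1 then 2 else 3))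
      \<longleftrightarrow> (\<exists>a. x = l a \<and> ((a, 1) \<in> E \<and> y = 2 \<or> (a, 2) \<in> E \<and> y = 3))" for x y :: 3
  proof -
    have n3: "b \<noteq> 3 \<longleftrightarrow> b = 1 \<or> b = (2::3)" for b by (cases b rule: letter_cases) simp_all
    show ?thesis
    proof
      assume "\<exists>a b. (a, b) \<in> E \<and> b \<noteq> 3 \<and> x = l a \<and> y = (if b = 1 then 2 else 3)"
      then show "\<exists>a. x = l a \<and> ((a, 1) \<in> E \<and> y = 2 \<or> (a, 2) \<in> E \<and> y = 3)"
        unfolding n3 by auto
    next
      assume "\<exists>a. x = l a \<and> ((a, 1) \<in> E \<and> y = 2 \<or> (a, 2) \<in> E \<and> y = 3)"
      then obtain a where "x = l a" "(a, 1) \<in> E \<and> y = 2 \<or> (a, 2) \<in> E \<and> y = 3" by blast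
      then have "(a, 1) \<in> E \<and> 1 \<noteq> (3::3) \<and> x = l a \<and> y = (if 1 = (1::3) then 2 else 3)
          \<or> (a, 2) \<in> E \<and> 2 \<noteq> (3::3) \<and> x = l a \<and> y = (if 2 = (1::3) then 2 else 3)" by simp
      then show "\<exists>a b. (a, b) \<in> E \<and> b \<noteq> 3 \<and> x = l a \<and> y = (if b = 1 then 2 else 3)"
        by blast
    qed
  qed
  ultimately have restrict: "(x, y) \<in> restrict1 E \<longleftrightarrow>
      (\<exists>a. x = l a \<and> ((a, 1) \<in> E \<and> y = 2 \<or> (a, 2) \<in> E \<and> y = 3))" for x y
    by simp
  have r: "column (restrict1 E) 1 = {}" "column (restrict1 E) 2 = l ` A"
      "column (restrict1 E) 3 = l ` B"
    unfolding restrict A_def B_def C_def by (auto simp: image_iff)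
  have "mult (merge1 E) = (if A \<union> B \<union> C = {} then 0
    else int (card (A \<union> B)) + int (card C) - int (card (A \<union> B \<union> C))
      - of_bool (A \<union> B \<noteq> {}) - of_bool (C \<noteq> {}) + 1)"
    unfolding mult_columns[of "merge1 E"] m by (simp add: card_l flip: image_Un)
  moreover have "mult (restrict1 E) = (if A \<union> B = {} then 0
    else int (card A) + int (card B) - int (card (A \<union> B))
      - of_bool (A \<noteq> {}) - of_bool (B \<noteq> {}) + 1)"
    unfolding mult_columns[of "restrict1 E"] r by (simp add: card_l flip: image_Un)
  ultimately show ?thesis
    unfolding mult_columns[of E] A_def[symmetric] B_def[symmetric] C_def[symmetric]
    by (cases "A = {}"; cases "B = {}"; cases "C = {}") auto
qed

section \<open>Desubstitution of factors\<close>

definition ext :: "'a list set \<Rightarrow> 'a list \<Rightarrow> ('a \<times> 'a) set" where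
  "ext L u = {(a, b). a # u @ [b] \<in> L}"

lemma ext_iff [simp]: "(a, b) \<in> ext L u \<longleftrightarrow> a # u @ [b] \<in> L"
  by (simp add: ext_def)

definition biextendable :: "'a list set \<Rightarrow> bool" where
  "biextendable L \<longleftrightarrow> (\<forall>u\<in>L. (\<exists>a. a # u \<in> L) \<and> (\<exists>b. u @ [b] \<in> L))"

lemma image_lang_iff: "u \<in> image_lang c L \<longleftrightarrow> (\<exists>z\<in>L. \<exists>p s. app c z = p @ u @ s)"
  by (auto simp: image_lang_def sublist_def)

lemma c1_hd_Cons: "app c1 z \<noteq> 3 # s"
  using c1_hd[of z] by (cases z) auto

text \<open>Only the letter 3 occurs inside the image of a letter; so an image can be cut in front of every
  other letter.\<close>

lemma c1_cut:
  assumes "app c1 z = p @ q" "q = [] \<or> hd q \<noteq> 3"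
  shows "\<exists>z1 z2. z = z1 @ z2 \<and> app c1 z1 = p \<and> app c1 z2 = q"
  using assms
proof (induction z arbitrary: p)
  case (Cons a z)
  show ?case
  proof (cases p)
    case Nil
    then show ?thesis using Cons.prems by (intro exI[of _ "[]"] exI[of _ "a # z"]) auto
  next
    case (Cons x p')
    have "\<exists>p''. p = c1 a @ p'' \<and> app c1 z = p'' @ q"
      using Cons.prems Cons by (cases a rule: letter_cases; cases p') (auto simp: c1_letters)
    then obtain p'' where p: "p = c1 a @ p''" "app c1 z = p'' @ q" by blast
    from Cons.IH[OF p(2) Cons.prems(2)] obtain z1 z2
      where "z = z1 @ z2" "app c1 z1 = p''" "app c1 z2 = q" by blast
    then show ?thesis using p by (intro exI[of _ "a # z1"] exI[of _ z2]) auto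
  qed
qed simp

lemma c1_inj: "app c1 u = app c1 v \<Longrightarrow> u = v"
proof (induction u arbitrary: v)
  case Nil
  then show ?case
    using length_app_ge[OF nonerasing_C, of c1 v] by (auto simp: is_C_def)
next
  case (Cons a u)
  then obtain b v' where v: "v = b # v'" by (cases v) (cases a rule: letter_cases; auto simp: c1_letters)+
  have "a = b"
    using Cons.prems c1_hd_Cons[of u] c1_hd_Cons[of v'] c1_hd_Cons[of v', symmetric]
    unfolding v by (cases a rule: letter_cases; cases b rule: letter_cases) (auto simp: c1_letters)
  then show ?case using Cons v by simp
qed

lemma app_c1_ConsE:
  assumes "app c1 z = b # s"
  obtains b' z' where "z = b' # z'" "hd (c1 b') = b"
  using assms that by (cases z; cases "c1 (hd z)") (auto simp: c1_def split: if_splits)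

lemma app_c1_snocE:
  assumes "app c1 z = p @ [a]"
  obtains z' a' where "z = z' @ [a']" "last (c1 a') = a"
proof (cases z rule: rev_cases)
  case (snoc z' a')
  have "c1 a' \<noteq> []" by (cases a' rule: letter_cases) (simp_all add: c1_letters)
  then have "last (app c1 z) = last (c1 a')" by (simp add: snoc)
  then show ?thesis using that[OF snoc] assms by simp
qed (use assms in simp)

lemma c1_before_3: "app c1 z = p @ x # 3 # s \<Longrightarrow> x = 1"
proof (induction z arbitrary: p)
  case (Cons a z)
  have "a = 2 \<and> x = 1 \<or> (\<exists>p'. app c1 z = p' @ x # 3 # s)"
    using Cons.prems c1_hd_Cons[of z s] c1_hd_Cons[of z "3 # s"]
    by (cases p; cases "tl p"; cases a rule: letter_cases) (auto simp: c1_letters)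
  then show ?case using Cons.IH by blast
qed simp

text \<open>The occurrence of \<open>app c1 v\<close> can be cut in front, and also at its end when the next letter is
  not 3; so it comes from an occurrence of \<open>v\<close>.\<close>

lemma ext_image_c1_subset:
  assumes "factorial_lang L" "(a, b) \<in> ext (image_lang c1 L) (app c1 v)" "b \<noteq> 3"
  shows "(a, b) \<in> merge1 (ext L v)"
proof -
  obtain z p s where z: "z \<in> L" "app c1 z = (p @ [a]) @ (app c1 v @ b # s)"
    using assms(2) by (auto simp: image_lang_iff)
  have "hd (app c1 v @ b # s) \<noteq> 3" using c1_hd_Cons[of v] assms(3) by (cases "app c1 v") auto
  from c1_cut[OF z(2)] this obtain z1 z2
    where 1: "z = z1 @ z2" "app c1 z1 = p @ [a]" "app c1 z2 = app c1 v @ b # s" by blast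
  from c1_cut[OF 1(3)] assms(3) obtain z3 z4
    where 2: "z2 = z3 @ z4" "app c1 z3 = app c1 v" "app c1 z4 = b # s" by auto
  obtain a' z1' where 3: "z1 = z1' @ [a']" "last (c1 a') = a" using app_c1_snocE[OF 1(2)] .
  obtain b' z4' where 4: "z4 = b' # z4'" "hd (c1 b') = b" using app_c1_ConsE[OF 2(3)] .
  have "z = z1' @ (a' # v @ [b']) @ z4'" using 1 2 3 4 c1_inj[OF 2(2)] by simp
  then have "a' # v @ [b'] \<in> L"
    using factorial_langD[OF assms(1) z(1)] by (metis sublist_appendI)
  then show ?thesis using 3 4 by (force simp: merge1_def)
qed

lemma merge1_ext_subset: "merge1 (ext L v) \<subseteq> ext (image_lang c1 L) (app c1 v)"
proof
  fix e assume "e \<in> merge1 (ext L v)"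
  then obtain a b where e: "e = (last (c1 a), hd (c1 b))" "a # v @ [b] \<in> L"
    by (auto simp: merge1_def)
  obtain p where p: "c1 a = p @ [last (c1 a)]"
    by (cases a rule: letter_cases) (auto simp: c1_letters)
  obtain s where s: "c1 b = hd (c1 b) # s"
    by (cases b rule: letter_cases) (auto simp: c1_letters)
  have "app c1 (a # v @ [b]) = (p @ [last (c1 a)]) @ app c1 v @ (hd (c1 b) # s)"
    using p s by simp
  then have "\<exists>p s. app c1 (a # v @ [b]) = p @ (last (c1 a) # app c1 v @ [hd (c1 b)]) @ s"
    by (intro exI[of _ p] exI[of _ s]) simp
  then have "last (c1 a) # app c1 v @ [hd (c1 b)] \<in> image_lang c1 L"
    using e(2) unfolding image_lang_iff by blast
  then show "e \<in> ext (image_lang c1 L) (app c1 v)" using e(1) by simp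
qed

lemma last_app_c1: "v \<noteq> [] \<Longrightarrow> last (app c1 v) = last (c1 (last v))"
proof (cases v rule: rev_cases)
  case (snoc v' a)
  have "c1 a \<noteq> []" by (cases a rule: letter_cases) (simp_all add: c1_letters)
  then show ?thesis by (simp add: snoc)
qed simp

lemma last_c1_eq_1: "last (c1 a) = 1 \<longleftrightarrow> a = 1"
  by (cases a rule: letter_cases) simp_all

lemma app_c1_eq_Nil [simp]: "app c1 v = [] \<longleftrightarrow> v = []"
  using c1_inj[of v "[]"] by auto

text \<open>The condition on the last letter of \<open>v\<close> excludes that the image continues with a 3.\<close>

lemma ext_image_c1_app:
  assumes "factorial_lang L" "v \<noteq> []" "last v \<noteq> 1"
  shows "ext (image_lang c1 L) (app c1 v) = merge1 (ext L v)"
proof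
  show "ext (image_lang c1 L) (app c1 v) \<subseteq> merge1 (ext L v)"
  proof
    fix e assume e: "e \<in> ext (image_lang c1 L) (app c1 v)"
    obtain a b where ab: "e = (a, b)" by (cases e)
    obtain z p s where z: "app c1 z = p @ (a # app c1 v @ [b]) @ s"
      using e by (auto simp: ab image_lang_iff)
    have l: "last (app c1 v) \<noteq> 1" using assms(2,3) by (simp add: last_app_c1 last_c1_eq_1)
    have "b \<noteq> 3"
    proof
      assume "b = 3"
      moreover have "app c1 v = butlast (app c1 v) @ [last (app c1 v)]" using assms(2) by simp
      ultimately have "app c1 z = (p @ a # butlast (app c1 v)) @ last (app c1 v) # 3 # s"
        using z by (metis append_Cons append_assoc append_Nil)
      then show False using c1_before_3 l by blast
    qed
    then show "e \<in> merge1 (ext L v)" using ext_image_c1_subset[OF assms(1)] e ab by blast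
  qed
qed (rule merge1_ext_subset)

text \<open>Two consecutive letters either form the image 13 of the letter 2 or lie in the images of two
  consecutive letters.\<close>

lemma ext_image_c1_Nil:
  assumes "factorial_lang L"
  shows "ext (image_lang c1 L) [] \<subseteq> insert (1, 3) (merge1 (ext L []))"
proof
  fix e assume e: "e \<in> ext (image_lang c1 L) []"
  obtain a b where ab: "e = (a, b)" by (cases e)
  have "a = 1" if b: "b = 3"
  proof -
    obtain z p s where "app c1 z = p @ a # 3 # s" using e b by (auto simp: ab image_lang_iff)
    then show ?thesis by (rule c1_before_3)
  qed
  then show "e \<in> insert (1, 3) (merge1 (ext L []))"
    using ext_image_c1_subset[OF assms, of a b "[]"] e by (auto simp: ab)
qed

text \<open>The final letter 1 is the beginning of \<open>c1 2\<close>, and then 3 follows, or it is \<open>c1 1\<close>, and then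
  2 follows because it is the image of the only letter that can follow 1.\<close>

lemma ext_image_c1_app_snoc:
  assumes L: "factorial_lang L" and follow: "\<And>b. [1, b] \<in> L \<Longrightarrow> b = 3"
  shows "ext (image_lang c1 L) (app c1 v @ [1]) \<subseteq> restrict1 (ext L v)"
proof
  fix e assume e: "e \<in> ext (image_lang c1 L) (app c1 v @ [1])"
  obtain a b where ab: "e = (a, b)" by (cases e)
  obtain z p s where z: "z \<in> L" "app c1 z = (p @ [a]) @ (app c1 v @ 1 # b # s)"
    using e by (auto simp: ab image_lang_iff)
  have "hd (app c1 v @ 1 # b # s) \<noteq> 3" using c1_hd_Cons[of v] by (cases "app c1 v") auto
  from c1_cut[OF z(2)] this obtain z1 z2
    where 1: "z = z1 @ z2" "app c1 z1 = p @ [a]" "app c1 z2 = app c1 v @ 1 # b # s" by blast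
  from c1_cut[OF 1(3)] obtain z3 z4
    where 2: "z2 = z3 @ z4" "app c1 z3 = app c1 v" "app c1 z4 = 1 # b # s" by auto
  obtain a' z1' where 3: "z1 = z1' @ [a']" "last (c1 a') = a" using app_c1_snocE[OF 1(2)] .
  obtain b' z4' where 4: "z4 = b' # z4'" "hd (c1 b') = 1" using app_c1_ConsE[OF 2(3)] .
  have zz: "z = z1' @ (a' # v @ [b']) @ z4'" using 1 2 3 4 c1_inj[OF 2(2)] by simp
  then have a'b': "(a', b') \<in> ext L v"
    using factorial_langD[OF L z(1)] by (metis sublist_appendI ext_iff)
  consider "b' = 1" | "b' = 2" using 4(2) by (cases b' rule: letter_cases) auto
  then have "b' \<noteq> 3 \<and> b = (if b' = 1 then 2 else 3)"
  proof cases
    case 1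
    then have z4': "app c1 z4' = b # s" using 2(3) 4(1) by (simp add: c1_letters)
    obtain d z5 where d: "z4' = d # z5" "hd (c1 d) = b" using app_c1_ConsE[OF z4'] .
    have "z = (z1' @ a' # v) @ [1, d] @ z5" using zz d 1 by simp
    then have "[1, d] \<in> L" using factorial_langD[OF L z(1)] by (metis sublist_appendI)
    then have "d = 3" by (rule follow)
    then show ?thesis using d 1 by simp
  next
    case 2
    then show ?thesis using \<open>app c1 z4 = 1 # b # s\<close> 4(1) by (simp add: c1_letters)
  qed
  then show "e \<in> restrict1 (ext L v)"
    unfolding restrict1_def ab using a'b' 3(2)
    by (intro image_eqI[of _ _ "(a', b')"]) auto
qed

lemma restrict1_ext_subset:
  assumes "biextendable L" "factorial_lang L" "\<And>b. [1, b] \<in> L \<Longrightarrow> b = 3"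
  shows "restrict1 (ext L v) \<subseteq> ext (image_lang c1 L) (app c1 v @ [1])"
proof
  fix e assume "e \<in> restrict1 (ext L v)"
  then obtain e' where e': "e' \<in> ext L v - UNIV \<times> {3}"
      "e = (case e' of (a, b) \<Rightarrow> (last (c1 a), if b = 1 then 2 else 3))"
    unfolding restrict1_def by blast
  obtain a b where "e' = (a, b)" by (cases e')
  with e' have e: "e = (last (c1 a), if b = 1 then 2 else 3)" "a # v @ [b] \<in> L" "b \<noteq> 3"
    by simp_all
  obtain p where p: "c1 a = p @ [last (c1 a)]"
    by (cases a rule: letter_cases) (auto simp: c1_letters)
  show "e \<in> ext (image_lang c1 L) (app c1 v @ [1])"
  proof (cases "b = 1")
    case True
    obtain d where d: "(a # v @ [b]) @ [d] \<in> L" using assms(1) e(2) by (auto simp: biextendable_def)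
    have "(a # v @ [b]) @ [d] = (a # v) @ [1, d] @ []" using True by simp
    then have "[1, d] \<in> L" using factorial_langD[OF assms(2) d] by (metis sublist_appendI)
    then have "d = 3" by (rule assms(3))
    then have "app c1 ((a # v @ [b]) @ [d]) = p @ (last (c1 a) # (app c1 v @ [1]) @ [2]) @ []"
      using True p by (simp add: c1_letters)
    then have "last (c1 a) # (app c1 v @ [1]) @ [2] \<in> image_lang c1 L"
      using d unfolding image_lang_iff by blast
    then show ?thesis using e True by simp
  next
    case False
    then have b: "b = 2" using e(3) exhaust_3[of b] by auto
    then have "app c1 (a # v @ [b]) = p @ (last (c1 a) # (app c1 v @ [1]) @ [3]) @ []"
      using p by (simp add: c1_letters)
    then have "last (c1 a) # (app c1 v @ [1]) @ [3] \<in> image_lang c1 L"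
      using e(2) unfolding image_lang_iff by blast
    then show ?thesis using e b by simp
  qed
qed

text \<open>A left special factor does not begin with 3, so it begins at a cut. It ends at a cut,
  or else with a letter 1 whose preimage is undetermined.\<close>

lemma left_special_image_c1:
  assumes "u \<noteq> []" "(a, b) \<in> ext (image_lang c1 L) u" "(a', b') \<in> ext (image_lang c1 L) u" "a \<noteq> a'"
  shows "\<exists>v. (u = app c1 v \<and> v \<noteq> [] \<and> last v \<noteq> 1) \<or> u = app c1 v @ [1]"
proof -
  obtain z p s where z: "app c1 z = p @ (a # u @ [b]) @ s"
    using assms(2) by (auto simp: image_lang_iff)
  obtain z' p' s' where z': "app c1 z' = p' @ (a' # u @ [b']) @ s'"
    using assms(3) by (auto simp: image_lang_iff)
  have hd_u: "hd u \<noteq> 3"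
  proof
    assume "hd u = 3"
    then obtain t where "u = 3 # t" using assms(1) by (cases u) auto
    then have "a = 1" "a' = 1"
      using c1_before_3[of z p a] c1_before_3[of z' p' a'] z z' by auto
    then show False using assms(4) by simp
  qed
  have "app c1 z = (p @ [a]) @ (u @ b # s)" using z by simp
  then obtain z2 where z2: "app c1 z2 = u @ b # s"
    using c1_cut[of z "p @ [a]" "u @ b # s"] hd_u assms(1) by auto
  obtain t x where u: "u = t @ [x]" using assms(1) by (cases u rule: rev_cases) auto
  show ?thesis
  proof (cases "x = 1")
    case True
    then have "app c1 z2 = t @ (1 # b # s)" using z2 u by simp
    then obtain v where "app c1 v = t" using c1_cut[of z2 t "1 # b # s"] by auto
    then show ?thesis using u True by blast
  next
    case False
    have "b \<noteq> 3" using c1_before_3[of z2 t x s] z2 u False by auto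
    then obtain v where v: "app c1 v = u" using c1_cut[of z2 u "b # s"] z2 by auto
    then have "v \<noteq> []" using assms(1) by auto
    then have "last v \<noteq> 1" using last_app_c1[of v] v u False by (auto simp: last_c1_eq_1)
    then show ?thesis using v \<open>v \<noteq> []\<close> by blast
  qed
qed

text \<open>The square of \<open>c1\<close> maps 1, 2, 3 to 1, 12, 13. The letters 2 and 3 of an image are isolated
  by letters 1, so that every extension graph reappears unchanged.\<close>

abbreviation c11 :: "3 \<Rightarrow> 3 list" where
  "c11 \<equiv> \<lambda>a. app c1 (c1 a)"

lemma c11_hd: "app c11 z = b # s \<Longrightarrow> b = 1"
proof (cases z)
  case (Cons a z')
  then show "app c11 z = b # s \<Longrightarrow> b = 1"
    by (cases a rule: letter_cases) (auto simp: c1_letters)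
qed simp

lemma c11_cut:
  assumes "app c11 z = p @ q" "q = [] \<or> hd q = 1"
  shows "\<exists>z1 z2. z = z1 @ z2 \<and> app c11 z1 = p \<and> app c11 z2 = q"
  using assms
proof (induction z arbitrary: p)
  case (Cons a z)
  show ?case
  proof (cases p)
    case Nil
    then show ?thesis using Cons.prems by (intro exI[of _ "[]"] exI[of _ "a # z"]) auto
  next
    case (Cons x p')
    have "\<exists>p''. p = c11 a @ p'' \<and> app c11 z = p'' @ q"
      using Cons.prems Cons by (cases a rule: letter_cases; cases p') (auto simp: c1_letters)
    then obtain p'' where p: "p = c11 a @ p''" "app c11 z = p'' @ q" by blast
    from Cons.IH[OF p(2) Cons.prems(2)] obtain z1 z2
      where "z = z1 @ z2" "app c11 z1 = p''" "app c11 z2 = q" by blast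
    then show ?thesis using p by (intro exI[of _ "a # z1"] exI[of _ z2]) auto
  qed
qed simp

lemma c11_inj: "app c11 u = app c11 v \<Longrightarrow> u = v"
  using c1_inj by (metis app_app)

lemma last_c11: "last (c11 a) = a"
  by (cases a rule: letter_cases) (simp_all add: c1_letters)

lemma app_c11_snocE:
  assumes "app c11 z = p @ [a]"
  obtains z' where "z = z' @ [a]"
proof (cases z rule: rev_cases)
  case (snoc z' a')
  have "c11 a' \<noteq> []" by (cases a' rule: letter_cases) (simp_all add: c1_letters)
  then have "last (app c11 z) = a'" using last_c11[of a'] by (simp add: snoc)
  then show ?thesis using that[of z'] snoc assms by simp
qed (use assms in simp)

lemma ext_image_c11_subset:
  assumes L: "factorial_lang L"
  shows "ext (image_lang c11 L) (app c11 v @ [1]) \<subseteq> ext L v"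
proof
  fix e assume e: "e \<in> ext (image_lang c11 L) (app c11 v @ [1])"
  obtain a b where ab: "e = (a, b)" by (cases e)
  obtain z p s where z: "z \<in> L" "app c11 z = (p @ [a]) @ (app c11 v @ 1 # b # s)"
    using e by (auto simp: ab image_lang_iff)
  have "hd (app c11 v @ 1 # b # s) = 1" using c11_hd[of v] by (cases "app c11 v") auto
  from c11_cut[OF z(2)] this obtain z1 z2
    where 1: "z = z1 @ z2" "app c11 z1 = p @ [a]" "app c11 z2 = app c11 v @ 1 # b # s" by blast
  obtain z1' where 2: "z1 = z1' @ [a]" using app_c11_snocE[OF 1(2)] .
  have "\<exists>z4. z2 = v @ b # z4"
  proof (cases "b = 1")
    case True
    have "app c11 z2 = app c11 (v @ [1]) @ (b # s)" using 1(3) by (simp add: c1_letters)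
    from c11_cut[OF this] True obtain z3 z4
      where 3: "z2 = z3 @ z4" "app c11 z3 = app c11 (v @ [1])" by auto
    show ?thesis using c11_inj[OF 3(2)] 3(1) True by auto
  next
    case False
    from c11_cut[OF 1(3)] obtain z3 z4
      where 3: "z2 = z3 @ z4" "app c11 z3 = app c11 v" "app c11 z4 = 1 # b # s" by auto
    obtain d z5 where 4: "z4 = d # z5" using 3(3) by (cases z4) auto
    have "d = b"
      using 3(3) 4 False c11_hd[of z5 b s]
      by (cases d rule: letter_cases) (auto simp: c1_letters)
    then show ?thesis using 3 4 c11_inj[OF 3(2)] by auto
  qed
  then obtain z4 where "z = z1' @ (a # v @ [b]) @ z4" using 1(1) 2 by auto
  then have "a # v @ [b] \<in> L"
    using factorial_langD[OF L z(1)] by (metis sublist_appendI)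
  then show "e \<in> ext L v" using ab by simp
qed

lemma ext_subset_image_c11:
  assumes "biextendable L"
  shows "ext L v \<subseteq> ext (image_lang c11 L) (app c11 v @ [1])"
proof
  fix e assume e: "e \<in> ext L v"
  obtain a b where ab: "e = (a, b)" by (cases e)
  obtain d where d: "(a # v @ [b]) @ [d] \<in> L"
    using assms e unfolding ab ext_iff biextendable_def by blast
  obtain p where p: "c11 a = p @ [a]"
    by (cases a rule: letter_cases) (auto simp: c1_letters)
  obtain s where s: "c11 b @ c11 d = 1 # b # s"
    by (cases b rule: letter_cases; cases d rule: letter_cases) (auto simp: c1_letters)
  have "app c11 ((a # v @ [b]) @ [d]) = p @ (a # (app c11 v @ [1]) @ [b]) @ s"
    using p s by simp
  then have "a # (app c11 v @ [1]) @ [b] \<in> image_lang c11 L"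
    using d unfolding image_lang_iff by blast
  then show "e \<in> ext (image_lang c11 L) (app c11 v @ [1])" using ab by simp
qed

lemma c11_isolated: "app c11 z = p @ x # y # s \<Longrightarrow> x = 1 \<or> y = 1"
proof (induction z arbitrary: p)
  case (Cons a z)
  have "x = 1 \<or> y = 1 \<or> (\<exists>p'. app c11 z = p' @ x # y # s)"
    using Cons.prems c11_hd[of z y s]
    by (cases p; cases "tl p"; cases a rule: letter_cases) (auto simp: c1_letters)
  then show ?case using Cons.IH by blast
qed simp

lemma bispecial_image_c11:
  assumes "u \<noteq> []" "(a, b) \<in> ext (image_lang c11 L) u" "(a', b') \<in> ext (image_lang c11 L) u"
    "(a'', b'') \<in> ext (image_lang c11 L) u" "a \<noteq> a'" "b \<noteq> b''"
  shows "\<exists>v. u = app c11 v @ [1]"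
proof -
  obtain z p s where z: "app c11 z = p @ (a # u @ [b]) @ s"
    using assms(2) by (auto simp: image_lang_iff)
  obtain z' p' s' where z': "app c11 z' = p' @ (a' # u @ [b']) @ s'"
    using assms(3) by (auto simp: image_lang_iff)
  obtain z'' p'' s'' where z'': "app c11 z'' = p'' @ (a'' # u @ [b'']) @ s''"
    using assms(4) by (auto simp: image_lang_iff)
  have hd_u: "hd u = 1"
  proof (rule ccontr)
    assume h: "hd u \<noteq> 1"
    obtain x t where "u = x # t" using assms(1) by (cases u) auto
    then have "a = 1" "a' = 1"
      using c11_isolated[of z p a x] c11_isolated[of z' p' a' x] z z' h by auto
    then show False using assms(5) by simp
  qed
  obtain t x where u: "u = t @ [x]" using assms(1) by (cases u rule: rev_cases) auto
  have x: "x = 1"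
  proof (rule ccontr)
    assume "x \<noteq> 1"
    then have "b = 1" "b'' = 1"
      using c11_isolated[of z "p @ a # t" x b s] c11_isolated[of z'' "p'' @ a'' # t" x b'' s'']
        z z'' u by auto
    then show False using assms(6) by simp
  qed
  have "app c11 z = (p @ [a]) @ (u @ b # s)" using z by simp
  then obtain z2 where z2: "app c11 z2 = u @ b # s"
    using c11_cut[of z "p @ [a]" "u @ b # s"] hd_u assms(1) by auto
  then have "app c11 z2 = t @ (1 # b # s)" using u x by simp
  then obtain v where "app c11 v = t" using c11_cut[of z2 t "1 # b # s"] by auto
  then show ?thesis using u x by blast
qed

text \<open>Desubstitution need not shorten a factor, because \<open>c1\<close> and \<open>c2\<close> permute some letters; it
  does decrease the length in which the letter 2 counts one and a half.\<close>

definition weight :: "3 list \<Rightarrow> nat" where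
  "weight u = 2 * length u + count_list u 2"

lemma weight_simps [simp]: "weight [] = 0" "weight (u @ v) = weight u + weight v"
    "weight (a # u) = (if a = 2 then 3 else 2) + weight u"
  by (simp_all add: weight_def)

lemma weight_app_c1: "weight u \<le> weight (app c1 u)"
proof (induction u)
  case (Cons a u)
  then show ?case by (cases a rule: letter_cases) (simp_all add: c1_letters)
qed simp

lemma weight_app_c1_less:
  assumes "u \<noteq> []" "last u \<noteq> 1"
  shows "weight u < weight (app c1 u)"
proof -
  obtain v a where u: "u = v @ [a]" using assms(1) by (cases u rule: rev_cases) auto
  then have "weight [a] < weight (c1 a)"
    using assms(2) by (cases a rule: letter_cases) (simp_all add: c1_letters)
  then show ?thesis using weight_app_c1[of v] by (simp add: u)
qed

section \<open>The mirror symmetry\<close>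

text \<open>Reversing all words and exchanging the letters 1 and 3 turns \<open>c1\<close> into \<open>c2\<close>.\<close>

definition mirror_word :: "3 list \<Rightarrow> 3 list" where
  "mirror_word u = rev (map swap13 u)"

lemma mirror_word_simps [simp]:
  "mirror_word [] = []" "mirror_word (a # u) = mirror_word u @ [swap13 a]"
  "mirror_word (u @ v) = mirror_word v @ mirror_word u" "mirror_word (mirror_word u) = u"
  by (simp_all add: mirror_word_def rev_map comp_def)

lemma weight_mirror_word: "weight (mirror_word u) = weight u"
  by (induction u) (auto simp: swap13_eq_iff)

definition mirror_lang :: "3 list set \<Rightarrow> 3 list set" where
  "mirror_lang L = mirror_word ` L"

lemma mirror_lang_iff: "u \<in> mirror_lang L \<longleftrightarrow> mirror_word u \<in> L"
  unfolding mirror_lang_def by (metis image_iff mirror_word_simps(4))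

lemma mirror_mirror_lang [simp]: "mirror_lang (mirror_lang L) = L"
  by (auto simp: mirror_lang_iff)

lemma sublist_mirror_word: "sublist (mirror_word u) (mirror_word v) \<longleftrightarrow> sublist u v"
proof -
  have "sublist (mirror_word u) (mirror_word v)" if "sublist u v" for u v
    using that unfolding sublist_def by (metis mirror_word_simps(3) append_assoc)
  then show ?thesis by (metis mirror_word_simps(4))
qed

lemma app_c2: "app c2 u = mirror_word (app c1 (mirror_word u))"
proof (induction u)
  case (Cons a u)
  have "c2 a = mirror_word (c1 (swap13 a))"
    by (cases a rule: letter_cases) (simp_all add: c1_letters c2_letters)
  then show ?case using Cons by simp
qed simp

lemma mirror_image_lang_c1: "mirror_lang (image_lang c1 L) = image_lang c2 (mirror_lang L)"
  and mirror_image_lang_c2: "mirror_lang (image_lang c2 L) = image_lang c1 (mirror_lang L)"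
proof -
  have *: "mirror_lang (image_lang c1 L) = image_lang c2 (mirror_lang L)" for L
  proof (intro set_eqI)
    fix u
    have "u \<in> mirror_lang (image_lang c1 L) \<longleftrightarrow> (\<exists>v\<in>L. sublist (mirror_word u) (app c1 v))"
      by (simp add: mirror_lang_iff image_lang_def)
    also have "\<dots> \<longleftrightarrow> (\<exists>v\<in>L. sublist u (app c2 (mirror_word v)))"
      unfolding app_c2 using sublist_mirror_word by (metis mirror_word_simps(4))
    also have "\<dots> \<longleftrightarrow> u \<in> image_lang c2 (mirror_lang L)"
      by (simp add: image_lang_def mirror_lang_def)
    finally show "u \<in> mirror_lang (image_lang c1 L) \<longleftrightarrow> u \<in> image_lang c2 (mirror_lang L)" .
  qed
  show "mirror_lang (image_lang c1 L) = image_lang c2 (mirror_lang L)" by (rule *)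
  show "mirror_lang (image_lang c2 L) = image_lang c1 (mirror_lang L)"
    using *[of "mirror_lang L"] by (metis mirror_mirror_lang)
qed

lemma ext_mirror_lang: "ext (mirror_lang L) u = mirror_edges (ext L (mirror_word u))"
proof (rule set_eqI)
  fix e
  show "e \<in> ext (mirror_lang L) u \<longleftrightarrow> e \<in> mirror_edges (ext L (mirror_word u))"
    by (cases e) (simp add: mirror_lang_iff)
qed

lemma factorial_mirror_lang: "factorial_lang L \<Longrightarrow> factorial_lang (mirror_lang L)"
  unfolding factorial_lang_def by (metis mirror_lang_iff sublist_mirror_word)

lemma biextendable_mirror_lang:
  assumes "biextendable L" shows "biextendable (mirror_lang L)"
  unfolding biextendable_def mirror_lang_iff
proof
  fix u assume "u \<in> mirror_lang L"
  then have "mirror_word u \<in> L" by (simp add: mirror_lang_iff)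
  then obtain a b where "a # mirror_word u \<in> L" "mirror_word u @ [b] \<in> L"
    using assms by (auto simp: biextendable_def)
  then have "mirror_word (u @ [swap13 a]) \<in> L" "mirror_word (swap13 b # u) \<in> L" by simp_all
  then show "(\<exists>a. mirror_word (a # u) \<in> L) \<and> (\<exists>b. mirror_word (u @ [b]) \<in> L)" by blast
qed

section \<open>Multiplicities under desubstitution\<close>

lemma after_1_in_image_c2:
  assumes "[1, b] \<in> image_lang c2 L"
  shows "b = 3"
proof -
  have "mirror_word [1, b] \<in> mirror_lang (image_lang c2 L)" using assms by (simp add: mirror_lang_iff)
  then have "[swap13 b, 3] \<in> image_lang c1 (mirror_lang L)"
    by (simp add: mirror_image_lang_c2)
  then obtain z p s where "app c1 z = p @ swap13 b # 3 # s" by (auto simp: image_lang_iff)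
  then have "swap13 b = 1" by (rule c1_before_3)
  then show ?thesis by (simp add: swap13_eq_iff)
qed

text \<open>Bispeciality expressed by the edges of the extension graph alone. It also makes sense for the
  finite approximations of a language, whose words need not extend.\<close>

definition two_sided :: "('a \<times> 'b) set \<Rightarrow> bool" where
  "two_sided E \<longleftrightarrow> (\<exists>a b a' b'. (a, b) \<in> E \<and> (a', b') \<in> E \<and> a \<noteq> a')
     \<and> (\<exists>a b a' b'. (a, b) \<in> E \<and> (a', b') \<in> E \<and> b \<noteq> b')"

lemma not_two_sided:
  assumes "\<not> two_sided E"
  obtains a where "E \<subseteq> {a} \<times> UNIV" | b where "E \<subseteq> UNIV \<times> {b}"
proof (cases "E = {}")
  case False
  then obtain a b where ab: "(a, b) \<in> E" by auto
  have "E \<subseteq> {a} \<times> UNIV \<or> E \<subseteq> UNIV \<times> {b}"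
    using assms ab unfolding two_sided_def by (auto; metis)
  then show ?thesis using that by blast
qed (use that in blast)

lemma not_two_sided_mult:
  assumes "\<not> two_sided E"
  shows "mult E = 0"
proof (cases "E = {}")
  case False
  from not_two_sided[OF assms] show ?thesis
  proof cases
    case (1 a)
    then have "fst ` E \<subseteq> {a}" "inj_on snd E" by (auto simp: inj_on_def)
    then have "fst ` E = {a}" using False by blast
    with \<open>inj_on snd E\<close> show ?thesis using False by (simp add: mult_def card_image)
  next
    case (2 b)
    then have "snd ` E \<subseteq> {b}" "inj_on fst E" by (auto simp: inj_on_def)
    then have "snd ` E = {b}" using False by blast
    with \<open>inj_on fst E\<close> show ?thesis using False by (simp add: mult_def card_image)
  qed
qed simp

lemma not_two_sided_subtree:
  assumes "\<not> two_sided E"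
  shows "subtree_of_max E"
  using assms
proof (cases rule: not_two_sided)
  case (1 a)
  then have "E \<subseteq> {(a, 1), (a, 2), (a, 3)}" using exhaust_3 by auto
  moreover have "subtree_of_max {(a, 1), (a, 2), (a, 3)}"
    by (cases a rule: letter_cases) (simp_all add: subtree_of_max_def max_trees_def)
  ultimately show ?thesis using subtree_of_max_subset by blast
next
  case (2 b)
  then have "E \<subseteq> {(1, b), (2, b), (3, b)}" using exhaust_3 by auto
  moreover have "subtree_of_max {(1, b), (2, b), (3, b)}"
    by (cases b rule: letter_cases) (simp_all add: subtree_of_max_def max_trees_def)
  ultimately show ?thesis using subtree_of_max_subset by blast
qed

lemma image_lang_c1_c1: "image_lang c1 (image_lang c1 L) = image_lang c11 L"
  by (rule image_lang_comp)

text \<open>How a bispecial factor arises from a shorter one. For \<open>c1\<close> after \<open>c1\<close> one passes two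
  levels down and the extension graph is the same.\<close>

lemma bispecial_desubstitute_c1_c1:
  assumes L: "factorial_lang L"
    and u: "u \<noteq> []" "two_sided (ext (image_lang c1 (image_lang c1 L)) u)"
  obtains v where "weight v < weight u" "ext (image_lang c1 (image_lang c1 L)) u \<subseteq> ext L v"
    "biextendable L \<Longrightarrow> ext (image_lang c1 (image_lang c1 L)) u = ext L v"
proof -
  from u(2) obtain a b a' b' where 1: "(a, b) \<in> ext (image_lang c11 L) u"
      "(a', b') \<in> ext (image_lang c11 L) u" "a \<noteq> a'"
    unfolding image_lang_c1_c1 two_sided_def by blast
  have "\<exists>e\<in>ext (image_lang c11 L) u. snd e \<noteq> b"
    using u(2) unfolding image_lang_c1_c1 two_sided_def by (metis snd_conv)
  then obtain a'' b'' where 2: "(a'', b'') \<in> ext (image_lang c11 L) u" "b \<noteq> b''"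
    by (metis prod.collapse)
  obtain v where v: "u = app c11 v @ [1]"
    using bispecial_image_c11[OF u(1) 1(1,2) 2(1) 1(3) 2(2)] by blast
  have "weight v \<le> weight (app c1 (app c1 v))" using weight_app_c1 le_trans by blast
  then have "weight v < weight u" by (simp add: v app_app)
  moreover have "ext (image_lang c1 (image_lang c1 L)) u \<subseteq> ext L v"
    unfolding image_lang_c1_c1 v by (rule ext_image_c11_subset[OF L])
  moreover have "ext L v \<subseteq> ext (image_lang c1 (image_lang c1 L)) u" if "biextendable L"
    unfolding image_lang_c1_c1 v by (rule ext_subset_image_c11[OF that])
  ultimately show ?thesis using that by blast
qed

text \<open>For \<open>c1\<close> before \<open>c2\<close> one passes one level down only. In an image under \<open>c2\<close> the letter 1 is
  always followed by 3, so the image of \<open>v\<close> and its continuation by 1 account for all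
  bispecial factors.\<close>

lemma bispecial_desubstitute_c1_c2:
  assumes L: "L = image_lang c2 L'"
    and u: "u \<noteq> []" "two_sided (ext (image_lang c1 L) u)"
  obtains v f where "weight v < weight u" "f = merge1 \<or> f = restrict1"
    "ext (image_lang c1 L) u \<subseteq> f (ext L v)"
    "biextendable L \<Longrightarrow> ext (image_lang c1 L) u = f (ext L v)"
proof -
  have fac: "factorial_lang L" unfolding L by (rule factorial_image_lang)
  have follow: "\<And>b. [1, b] \<in> L \<Longrightarrow> b = 3" using after_1_in_image_c2 unfolding L by blast
  obtain a b a' b' where "(a, b) \<in> ext (image_lang c1 L) u"
      "(a', b') \<in> ext (image_lang c1 L) u" "a \<noteq> a'"
    using u(2) unfolding two_sided_def by blast
  from left_special_image_c1[OF u(1) this] consider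
      v where "u = app c1 v" "v \<noteq> []" "last v \<noteq> 1" | v where "u = app c1 v @ [1]"
    by blast
  then show ?thesis
  proof cases
    case 1
    then show ?thesis
      using that[of v merge1] weight_app_c1_less[of v] ext_image_c1_app[OF fac, of v] by simp
  next
    case 2
    have "weight v < weight u" using weight_app_c1[of v] by (simp add: 2)
    then show ?thesis
      using that[of v restrict1] ext_image_c1_app_snoc[OF fac follow, of v]
        restrict1_ext_subset[OF _ fac follow, of v] unfolding 2 by blast
  qed
qed

text \<open>Both multiplicities are at most 0, and their sum is 0.\<close>

lemma mult_merge1_0:
  assumes "subtree_of_max E" "mult E = 0"
  shows "mult (merge1 E) = 0" "mult (restrict1 E) = 0"
proof -
  have "mult (merge1 E) \<le> 0"
    using subtree_of_max_merge1[OF assms(1)] subtree_of_max_subset mult_nonpos by blast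
  moreover have "mult (restrict1 E) \<le> 0"
    using subtree_of_max_restrict1[OF assms(1)] mult_nonpos by blast
  ultimately show "mult (merge1 E) = 0" "mult (restrict1 E) = 0"
    using mult_merge1_restrict1[of E] assms(2) by linarith+
qed

text \<open>The factors of the finite words \<open>\<sigma> 0 (\<dots> (\<sigma> (k - 1) a))\<close>. They approximate the
  language of the infinite word from inside, and they provide the induction on \<open>k\<close> that the
  infinite word lacks: the empty word desubstitutes to itself for ever.\<close>

fun finite_level :: "(nat \<Rightarrow> 3 \<Rightarrow> 3 list) \<Rightarrow> nat \<Rightarrow> 3 list set" where
  "finite_level \<sigma> 0 = {u. length u \<le> 1}"
| "finite_level \<sigma> (Suc k) = image_lang (\<sigma> 0) (finite_level (\<lambda>n. \<sigma> (Suc n)) k)"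

lemma factorial_finite_level: "factorial_lang (finite_level \<sigma> k)"
proof (cases k)
  case 0
  then show ?thesis using sublist_length_le by (force simp: factorial_lang_def)
qed (simp add: factorial_image_lang)

lemma directive_word_finite_level: "directive_word \<sigma> k [a] \<in> finite_level \<sigma> k"
  by (induction k arbitrary: \<sigma>) (auto simp: directive_word_Suc intro: image_langI)

text \<open>The induction step when the first substitution is \<open>c1\<close>. The short words form the bottom level,
  which has no level below.\<close>

lemma subtree_ext_image_c1:
  assumes L: "factorial_lang L" "L = {u. length u \<le> 1} \<or> L = image_lang c1 L' \<or> L = image_lang c2 L'"
    and "factorial_lang L'"
    and L_sub: "\<And>v. subtree_of_max (ext L v)"
    and L'_sub: "L \<noteq> {u. length u \<le> 1} \<Longrightarrow> (\<And>v. subtree_of_max (ext L' v))"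
  shows "subtree_of_max (ext (image_lang c1 L) u)"
proof (cases "u = []")
  case True
  then show ?thesis
    using subtree_of_max_subset[OF subtree_of_max_merge1[OF L_sub] ext_image_c1_Nil[OF L(1)]] by simp
next
  case u: False
  show ?thesis
  proof (cases "two_sided (ext (image_lang c1 L) u)")
    case False
    then show ?thesis by (rule not_two_sided_subtree)
  next
    case True
    have nL: "L \<noteq> {u. length u \<le> 1}"
    proof
      assume L0: "L = {u. length u \<le> 1}"
      obtain a b where "a # u @ [b] \<in> image_lang c1 L" using True by (auto simp: two_sided_def)
      then obtain z where z: "length z \<le> 1" "sublist (a # u @ [b]) (app c1 z)"
        by (auto simp: image_lang_def L0)
      have "length (app c1 z) \<le> 2"
      proof (cases z)
        case (Cons x z')
        then show ?thesis using z(1) length_C_le[of c1 x] by (simp add: is_C_def)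
      qed simp
      then show False using sublist_length_le[OF z(2)] u by (cases u) auto
    qed
    then have "L = image_lang c1 L' \<or> L = image_lang c2 L'" using L(2) by blast
    then show ?thesis
    proof
      assume L1: "L = image_lang c1 L'"
      obtain v where "ext (image_lang c1 (image_lang c1 L')) u \<subseteq> ext L' v"
        using bispecial_desubstitute_c1_c1[OF assms(3) u True[unfolded L1]] .
      then show ?thesis using L'_sub[OF nL] subtree_of_max_subset unfolding L1 by blast
    next
      assume L1: "L = image_lang c2 L'"
      obtain v f where f: "f = merge1 \<or> f = restrict1" "ext (image_lang c1 L) u \<subseteq> f (ext L v)"
        using bispecial_desubstitute_c1_c2[OF L1 u True] .
      have "subtree_of_max (merge1 (ext L v))"
        using subtree_of_max_merge1[OF L_sub] subtree_of_max_subset by blast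
      then have "subtree_of_max (f (ext L v))"
        using f(1) subtree_of_max_restrict1[OF L_sub] by auto
      then show ?thesis using f(2) subtree_of_max_subset by blast
    qed
  qed
qed

lemma mirror_lang_short: "mirror_lang {u. length u \<le> 1} = {u. length u \<le> 1}"
  by (auto simp: mirror_lang_iff) (auto simp: mirror_word_def)

lemma subtree_ext_mirror: "subtree_of_max (ext (mirror_lang L) u) \<longleftrightarrow> subtree_of_max (ext L (mirror_word u))"
  unfolding ext_mirror_lang using subtree_of_max_mirror by (metis mirror_mirror_edges)

lemma subtree_finite_level:
  assumes "\<And>n. is_C (\<sigma> n)"
  shows "subtree_of_max (ext (finite_level \<sigma> k) u)"
  using assms
proof (induction k arbitrary: \<sigma> u rule: less_induct)
  case (less k)
  show ?case
  proof (cases k)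
    case 0
    then have "ext (finite_level \<sigma> k) u = {}" by auto
    then show ?thesis using subtree_of_max_empty by simp
  next
    case (Suc m)
    let ?\<sigma> = "\<lambda>n. \<sigma> (Suc n)"
    define L where "L = finite_level ?\<sigma> m"
    define L' where "L' = finite_level (\<lambda>n. \<sigma> (Suc (Suc n))) (m - 1)"
    have C: "is_C (\<sigma> n)" for n by (rule less.prems)
    have fL: "factorial_lang L" "factorial_lang L'"
      by (auto simp: L_def L'_def factorial_finite_level)
    have LL': "L = {u. length u \<le> 1} \<or> L = image_lang c1 L' \<or> L = image_lang c2 L'"
      using C[of "Suc 0"] by (cases m) (auto simp: L_def L'_def is_C_def)
    have sL: "subtree_of_max (ext L v)" for v
      unfolding L_def by (rule less.IH) (use Suc C in auto)
    have sL': "subtree_of_max (ext L' v)" for v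
      unfolding L'_def by (rule less.IH) (use Suc C in auto)
    have k: "finite_level \<sigma> k = image_lang (\<sigma> 0) L" by (simp add: Suc L_def)
    show ?thesis
      using C[of 0]
    proof (cases rule: is_C_cases)
      case c1
      then show ?thesis
        using subtree_ext_image_c1[OF fL(1) LL' fL(2) sL sL'] k by simp
    next
      case c2
      have "mirror_lang L = {u. length u \<le> 1} \<or> mirror_lang L = image_lang c1 (mirror_lang L')
          \<or> mirror_lang L = image_lang c2 (mirror_lang L')"
        using LL' by (metis mirror_lang_short mirror_image_lang_c1 mirror_image_lang_c2)
      from subtree_ext_image_c1[OF factorial_mirror_lang[OF fL(1)] this factorial_mirror_lang[OF fL(2)]]
      have "subtree_of_max (ext (image_lang c1 (mirror_lang L)) (mirror_word u))"
        using sL sL' by (simp add: subtree_ext_mirror)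
      then have "subtree_of_max (ext (mirror_lang (image_lang c2 L)) (mirror_word u))"
        by (simp add: mirror_image_lang_c2)
      then show ?thesis using k c2 by (simp add: subtree_ext_mirror)
    qed
  qed
qed

text \<open>An extension graph has finitely many edges, which all show up in a single prefix, hence in the
  image of a single letter.\<close>

lemma tower_subtree:
  assumes "tower \<sigma> W"
  shows "subtree_of_max (ext (language (W n)) u)"
proof -
  let ?E = "ext (language (W n)) u" and ?\<sigma> = "\<lambda>k. \<sigma> (n + k)"
  have "\<exists>N. sublist (fst e # u @ [snd e]) (prefix_of (W n) N)" if "e \<in> ?E" for e
    using that language_iff_prefix by (cases e) auto
  then obtain N where N: "\<And>e. e \<in> ?E \<Longrightarrow> sublist (fst e # u @ [snd e]) (prefix_of (W n) (N e))"
    by metis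
  define M where "M = Max (insert 0 (N ` ?E))"
  have fin: "finite ?E" by (rule finite_subset[OF subset_UNIV]) simp
  have M: "N e \<le> M" if "e \<in> ?E" for e
    unfolding M_def using that fin by (intro Max_ge) auto
  obtain a where "words_tendsto (\<lambda>k. directive_word ?\<sigma> k [a k]) (W n)"
    using tower_C_adic[OF assms] by (auto simp: C_adic_def)
  then obtain k where k: "take M (directive_word ?\<sigma> k [a k]) = prefix_of (W n) M"
    unfolding words_tendsto_def eventually_sequentially by blast
  have "?E \<subseteq> ext (finite_level ?\<sigma> k) u"
  proof
    fix e assume e: "e \<in> ?E"
    have "prefix_of (W n) M = prefix_of (W n) (N e) @ prefix_of (\<lambda>j. W n (N e + j)) (M - N e)"
      using M[OF e] prefix_of_add[of "W n" "N e" "M - N e"] by simp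
    then have "sublist (prefix_of (W n) (N e)) (prefix_of (W n) M)"
      by (metis sublist_append_rightI)
    moreover have "sublist (prefix_of (W n) M) (directive_word ?\<sigma> k [a k])"
      using k by (metis sublist_take)
    ultimately have "sublist (fst e # u @ [snd e]) (directive_word ?\<sigma> k [a k])"
      using N[OF e] sublist_order.order.trans by blast
    then have "fst e # u @ [snd e] \<in> finite_level ?\<sigma> k"
      by (rule factorial_langD[OF factorial_finite_level directive_word_finite_level])
    then show "e \<in> ext (finite_level ?\<sigma> k) u" by (cases e) simp
  qed
  moreover have "subtree_of_max (ext (finite_level ?\<sigma> k) u)"
    using tower_is_C[OF assms] by (intro subtree_finite_level)
  ultimately show ?thesis using subtree_of_max_subset by blast
qed

definition neutral :: "3 list set \<Rightarrow> bool" where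
  "neutral L \<longleftrightarrow> (\<forall>u. mult (ext L u) = 0)"

lemma neutral_mirror: "neutral (mirror_lang L) \<longleftrightarrow> neutral L"
proof -
  have "mult (ext (mirror_lang L) u) = mult (ext L (mirror_word u))" for u
    by (simp add: ext_mirror_lang mult_mirror_edges)
  then show ?thesis unfolding neutral_def by (metis mirror_word_simps(4))
qed

text \<open>The induction step for the propagation of multiplicity 0 from short to long factors.\<close>

lemma mult_image_c1_0:
  assumes L: "factorial_lang L'" "L = image_lang c1 L' \<or> L = image_lang c2 L'"
    and bi: "biextendable L" "biextendable L'"
    and sub: "\<And>v. subtree_of_max (ext L v)"
    and IH: "\<And>v. weight v < weight u \<Longrightarrow> mult (ext L v) = 0 \<and> mult (ext L' v) = 0"
    and u: "u \<noteq> []"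
  shows "mult (ext (image_lang c1 L) u) = 0"
proof (cases "two_sided (ext (image_lang c1 L) u)")
  case False
  then show ?thesis by (rule not_two_sided_mult)
next
  case True
  from L(2) show ?thesis
  proof
    assume L1: "L = image_lang c1 L'"
    show ?thesis
      using bispecial_desubstitute_c1_c1[OF L(1) u True[unfolded L1]] IH bi(2)
      unfolding L1 by metis
  next
    assume L1: "L = image_lang c2 L'"
    obtain v f where "weight v < weight u" "f = merge1 \<or> f = restrict1"
      "ext (image_lang c1 L) u = f (ext L v)"
      using bispecial_desubstitute_c1_c2[OF L1 u True] bi(1) by metis
    then show ?thesis using mult_merge1_0[OF sub[of v]] IH[of v] by auto
  qed
qed

lemma tower_neutral:
  assumes t: "tower \<sigma> W"
    and bi: "\<And>n. biextendable (language (W n))"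
    and eps: "\<And>n. mult (ext (language (W n)) []) = 0"
  shows "neutral (language (W n))"
  unfolding neutral_def
proof
  fix u
  show "mult (ext (language (W n)) u) = 0"
  proof (induction u arbitrary: n rule: measure_induct_rule[of weight])
    case (less u)
    show ?case
    proof (cases "u = []")
      case False
      let ?L = "language (W (Suc n))" and ?L' = "language (W (Suc (Suc n)))"
      have LL': "?L = image_lang c1 ?L' \<or> ?L = image_lang c2 ?L'"
        using tower_language[OF t, of "Suc n"] tower_is_C[OF t, of "Suc n"]
        unfolding is_C_def by metis
      have sub: "subtree_of_max (ext ?L v)" for v by (rule tower_subtree[OF t])
      have IH: "mult (ext ?L v) = 0 \<and> mult (ext ?L' v) = 0" if "weight v < weight u" for v
        using less.IH[OF that, of "Suc n"] less.IH[OF that, of "Suc (Suc n)"] by simp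
      show ?thesis
        using tower_is_C[OF t, of n]
      proof (cases rule: is_C_cases)
        case c1
        have "mult (ext (image_lang c1 ?L) u) = 0"
          by (rule mult_image_c1_0[OF factorial_language LL' bi bi sub IH False])
        then show ?thesis unfolding tower_language[OF t, of n] c1 .
      next
        case c2
        have LLm: "mirror_lang ?L = image_lang c1 (mirror_lang ?L')
            \<or> mirror_lang ?L = image_lang c2 (mirror_lang ?L')"
          using LL' by (metis mirror_image_lang_c1 mirror_image_lang_c2)
        have "mult (ext (image_lang c1 (mirror_lang ?L)) (mirror_word u)) = 0"
        proof (rule mult_image_c1_0[OF factorial_mirror_lang[OF factorial_language] LLm])
          show "biextendable (mirror_lang ?L)" "biextendable (mirror_lang ?L')"
            using bi by (simp_all add: biextendable_mirror_lang)
          show "subtree_of_max (ext (mirror_lang ?L) v)" for v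
            using sub by (simp add: subtree_ext_mirror)
          show "mirror_word u \<noteq> []" using False by (simp add: mirror_word_def)
          fix v assume "weight v < weight (mirror_word u)"
          then have "weight (mirror_word v) < weight u" by (simp add: weight_mirror_word)
          from IH[OF this]
          show "mult (ext (mirror_lang ?L) v) = 0 \<and> mult (ext (mirror_lang ?L') v) = 0"
            by (simp add: ext_mirror_lang mult_mirror_edges)
        qed
        then have "mult (ext (mirror_lang (image_lang c2 ?L)) (mirror_word u)) = 0"
          unfolding mirror_image_lang_c2 .
        then show ?thesis
          unfolding tower_language[OF t, of n] c2 by (simp add: ext_mirror_lang mult_mirror_edges)
      qed
    qed (use eps in simp)
  qed
qed

text \<open>Neutrality also passes downwards, by one or two levels, together with the presence of all
  letters.\<close>

definition full_neutral :: "3 list set \<Rightarrow> bool" where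
  "full_neutral L \<longleftrightarrow> neutral L \<and> (\<forall>a. [a] \<in> L)"

lemma full_neutral_mirror: "full_neutral (mirror_lang L) \<longleftrightarrow> full_neutral L"
proof -
  have "(\<forall>a. [a] \<in> mirror_lang L) \<longleftrightarrow> (\<forall>a. [a] \<in> L)"
    unfolding forall_3 by (auto simp: mirror_lang_iff)
  then show ?thesis by (simp add: full_neutral_def neutral_mirror)
qed

lemma ext_Nil_letters:
  assumes "factorial_lang L" "biextendable L"
  shows "fst ` ext L [] = {a. [a] \<in> L}" "snd ` ext L [] = {a. [a] \<in> L}"
proof -
  have sub: "[a] \<in> L \<and> [b] \<in> L" if "[a, b] \<in> L" for a b
    using factorial_langD[OF assms(1) that, of "[a]"] factorial_langD[OF assms(1) that, of "[b]"]
    by (simp add: sublist_Cons_right)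
  have right: "\<exists>b. [a, b] \<in> L" and left: "\<exists>b. [b, a] \<in> L" if a: "[a] \<in> L" for a
  proof -
    obtain b c where "c # [a] \<in> L" "[a] @ [b] \<in> L"
      using assms(2) a unfolding biextendable_def by blast
    then show "\<exists>b. [a, b] \<in> L" "\<exists>b. [b, a] \<in> L" by auto
  qed
  have "fst ` ext L [] = {a. \<exists>b. [a, b] \<in> L}" "snd ` ext L [] = {a. \<exists>b. [b, a] \<in> L}"
    by (force simp: ext_def)+
  then show "fst ` ext L [] = {a. [a] \<in> L}" "snd ` ext L [] = {a. [a] \<in> L}"
    using sub right left by (simp_all only: set_eq_iff mem_Collect_eq) meson+
qed

lemma card_ext_Nil:
  fixes L :: "3 list set"
  assumes "factorial_lang L" "biextendable L" "\<forall>a. [a] \<in> L"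
  shows "mult (ext L []) = int (card (ext L [])) - 5"
proof -
  note e = ext_Nil_letters[OF assms(1,2)]
  have "fst ` ext L [] = UNIV" "snd ` ext L [] = UNIV" using e assms(3) by auto
  then show ?thesis by (auto simp: mult_def)
qed

lemma letter_image_lang:
  assumes "factorial_lang L" "[x] \<in> image_lang c L"
  shows "\<exists>a. [a] \<in> L \<and> x \<in> set (c a)"
proof -
  obtain v where v: "v \<in> L" "sublist [x] (app c v)" using assms(2) by (auto simp: image_lang_def)
  then have "x \<in> set (app c v)" using set_mono_sublist[OF v(2)] by simp
  then obtain a where a: "a \<in> set v" "x \<in> set (c a)" by (auto simp: apply_morphism_def)
  then obtain p s where "v = p @ [a] @ s" using split_list[OF a(1)] by auto
  then have "[a] \<in> L"
    using factorial_langD[OF assms(1) v(1), of "[a]"] sublist_appendI[of "[a]" p s] by simp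
  then show ?thesis using a(2) by blast
qed

lemma in_c1_iff: "2 \<in> set (c1 a) \<longleftrightarrow> a = 3" "3 \<in> set (c1 a) \<longleftrightarrow> a = 2"
  by (cases a rule: letter_cases; simp add: c1_letters)+

lemma ext_Nil_without_1:
  fixes L :: "3 list set"
  assumes "factorial_lang L" "[1] \<notin> L"
  shows "ext L [] \<subseteq> {(2, 2), (2, 3), (3, 2), (3, 3)}"
proof
  fix e assume e: "e \<in> ext L []"
  obtain a b where ab: "e = (a, b)" by (cases e)
  have "[a] \<in> L" "[b] \<in> L"
    using factorial_langD[OF assms(1), of "[a, b]"] e by (auto simp: ab sublist_Cons_right)
  then show "e \<in> {(2, 2), (2, 3), (3, 2), (3, 3)}"
    using assms(2) unfolding ab
    by (cases a rule: letter_cases; cases b rule: letter_cases) auto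
qed

text \<open>Every factor two levels below occurs with the same extension graph in the image. If the letter
  1 did not occur there, then the image would have at most four words of length 2 instead of
  five.\<close>

lemma full_neutral_desubstitute_c1_c1:
  assumes L: "factorial_lang L" "biextendable L"
    and full: "full_neutral (image_lang c1 (image_lang c1 L))"
    and bi: "biextendable (image_lang c1 (image_lang c1 L))"
  shows "full_neutral L"
proof -
  let ?L1 = "image_lang c1 L" and ?L0 = "image_lang c1 (image_lang c1 L)"
  have "ext L v = ext ?L0 (app c11 v @ [1])" for v
    unfolding image_lang_c1_c1
    by (rule equalityI[OF ext_subset_image_c11[OF L(2)] ext_image_c11_subset[OF L(1)]])
  then have neutral: "neutral L" using full unfolding full_neutral_def neutral_def by metis
  have letter: "[2] \<in> ?L1" "[3] \<in> ?L1"
    using letter_image_lang[OF factorial_image_lang, of 2 c1 c1 L]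
      letter_image_lang[OF factorial_image_lang, of 3 c1 c1 L] full
    by (auto simp: full_neutral_def in_c1_iff)
  then have letters: "[2] \<in> L" "[3] \<in> L"
    using letter_image_lang[OF L(1), of 2 c1] letter_image_lang[OF L(1), of 3 c1]
    by (auto simp: in_c1_iff)
  have "[1] \<in> L"
  proof (rule ccontr)
    assume "[1] \<notin> L"
    have "ext ?L1 [] \<subseteq> insert (1, 3) (merge1 {(2, 2), (2, 3), (3, 2), (3, 3)})"
      by (rule order.trans[OF ext_image_c1_Nil[OF L(1)]
          insert_mono[OF merge1_mono[OF ext_Nil_without_1[OF L(1) \<open>[1] \<notin> L\<close>]]]])
    then have "ext ?L0 [] \<subseteq>
        insert (1, 3) (merge1 (insert (1, 3) (merge1 {(2, 2), (2, 3), (3, 2), (3, 3)})))"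
      by (rule order.trans[OF ext_image_c1_Nil[OF factorial_image_lang]
          insert_mono[OF merge1_mono]])
    also have "\<dots> = {(1, 3), (1, 2), (2, 1), (3, 1)}" by auto
    finally have "card (ext ?L0 []) \<le> card {(1::3, 3::3), (1, 2), (2, 1), (3, 1)}"
      by (intro card_mono) auto
    then have "card (ext ?L0 []) \<le> 4" by simp
    moreover have "mult (ext ?L0 []) = int (card (ext ?L0 [])) - 5"
      using card_ext_Nil[OF factorial_image_lang bi] full by (simp add: full_neutral_def)
    ultimately show False using full by (simp add: full_neutral_def neutral_def)
  qed
  then have "[a] \<in> L" for a using letters by (cases a rule: letter_cases) auto
  then show ?thesis using neutral by (simp add: full_neutral_def)
qed

text \<open>The two images of a nonempty factor have multiplicity 0, hence so has the factor. For the empty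
  word one of the images is again the empty word, whose extension graph has the additional edge
  \<open>(1, 3)\<close>. If the letter 1 did not occur, then four edges between the letters 2 and 3 would be
  left, but these form a cycle.\<close>

lemma full_neutral_desubstitute_c1_c2:
  assumes L: "L = image_lang c2 L'" "biextendable L"
    and full: "full_neutral (image_lang c1 L)" and bi: "biextendable (image_lang c1 L)"
    and sub: "subtree_of_max (ext L [])"
  shows "full_neutral L"
proof -
  let ?L0 = "image_lang c1 L"
  have fac: "factorial_lang L" unfolding L(1) by (rule factorial_image_lang)
  have follow: "\<And>b. [1, b] \<in> L \<Longrightarrow> b = 3" using after_1_in_image_c2 unfolding L(1) by blast
  have mult0: "mult (ext ?L0 u) = 0" for u using full by (simp add: full_neutral_def neutral_def)
  have restrict: "ext ?L0 (app c1 v @ [1]) = restrict1 (ext L v)" for v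
    using ext_image_c1_app_snoc[OF fac follow, of v] restrict1_ext_subset[OF L(2) fac follow, of v]
    by blast
  have letters: "[2] \<in> L" "[3] \<in> L"
    using letter_image_lang[OF fac, of 2 c1] letter_image_lang[OF fac, of 3 c1] full
    unfolding full_neutral_def in_c1_iff by blast+
  let ?E = "ext L []"
  have "(1, 3) \<in> ext ?L0 []"
    using image_langI[OF letters(1), of c1] by (simp add: c1_letters)
  moreover have "merge1 ?E \<subseteq> ext ?L0 []" using merge1_ext_subset[of L "[]"] by simp
  ultimately have ext0: "ext ?L0 [] = insert (1, 3) (merge1 ?E)"
    using ext_image_c1_Nil[OF fac] by blast
  have "card (ext ?L0 []) = 5"
    using card_ext_Nil[OF factorial_image_lang bi] full mult0[of "[]"] by (simp add: full_neutral_def)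
  moreover have no3: "(a, 3) \<notin> merge1 ?E" for a
  proof
    assume "(a, 3) \<in> merge1 ?E"
    then obtain b where "hd (c1 b) = 3" by (auto simp: merge1_def)
    then show False by (cases b rule: letter_cases) simp_all
  qed
  ultimately have card4: "card (merge1 ?E) = 4" unfolding ext0 by simp
  have finE: "finite ?E" by (rule finite_subset[OF subset_UNIV]) simp
  have one: "[1] \<in> L"
  proof (rule ccontr)
    assume "[1] \<notin> L"
    note E = ext_Nil_without_1[OF fac this]
    have "4 \<le> card ?E" using card4 card_image_le[OF finE, of "\<lambda>(a, b). (last (c1 a), hd (c1 b))"]
      unfolding merge1_def by simp
    moreover have "card {(2, 2), (2, 3), (3, 2), (3::3, 3::3)} = 4" by simp
    ultimately have "card {(2, 2), (2, 3), (3, 2), (3::3, 3::3)} \<le> card ?E" by linarith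
    then have eq: "?E = {(2, 2), (2, 3), (3, 2), (3, 3)}"
      by (rule card_seteq[OF finite.insertI[OF finite.insertI[OF finite.insertI[OF
          finite.insertI[OF finite.emptyI]]]] E])
    obtain T where T: "T \<in> max_trees" "?E \<subseteq> T" using sub unfolding subtree_of_max_def by blast
    show False using max_trees_no_square[OF T(1)] T(2) unfolding eq by (rule notE)
  qed
  have all: "[a] \<in> L" for a using one letters by (cases a rule: letter_cases) auto
  note E = ext_Nil_letters[OF fac L(2)]
  have fstE: "fst ` ?E = UNIV" and sndE: "snd ` ?E = UNIV" using E all by auto
  have "fst ` merge1 ?E = (\<lambda>a. last (c1 a)) ` fst ` ?E"
    "snd ` merge1 ?E = (\<lambda>b. hd (c1 b)) ` snd ` ?E"
    by (auto simp: merge1_def image_image case_prod_beta)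
  then have "fst ` merge1 ?E = UNIV" "snd ` merge1 ?E = {1, 2}"
    unfolding fstE sndE by (auto simp: UNIV_3)
  then have "mult (merge1 ?E) = 0" using card4 by (auto simp: mult_def)
  moreover have "mult (restrict1 ?E) = 0" using restrict[of "[]"] mult0[of "[1]"] by simp
  ultimately have eps: "mult ?E = 0" using mult_merge1_restrict1[of ?E] by simp
  have "mult (ext L v) = 0" for v
  proof -
    consider "v = []" | "v \<noteq> []" "last v = 1" | "v \<noteq> []" "last v \<noteq> 1" by blast
    then show ?thesis
    proof cases
      case 2
      then obtain v' where v: "v = v' @ [1]" by (metis append_butlast_last_id)
      have "b = 3" if "(a, b) \<in> ext L v" for a b
      proof -
        have "(a # v') @ [1, b] @ [] \<in> L" using that by (simp add: v)
        then have "[1, b] \<in> L" using factorial_langD[OF fac] by (metis sublist_appendI)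
        then show ?thesis by (rule follow)
      qed
      then have "\<not> two_sided (ext L v)" unfolding two_sided_def by blast
      then show ?thesis by (rule not_two_sided_mult)
    next
      case 3
      then have "mult (merge1 (ext L v)) = 0"
        using mult0[of "app c1 v"] ext_image_c1_app[OF fac] by simp
      moreover have "mult (restrict1 (ext L v)) = 0" using restrict mult0 by metis
      ultimately show ?thesis using mult_merge1_restrict1[of "ext L v"] by simp
    qed (use eps in simp)
  qed
  then show ?thesis using all by (simp add: full_neutral_def neutral_def)
qed

lemma tower_full_neutral:
  assumes t: "tower \<sigma> W"
    and bi: "\<And>n. biextendable (language (W n))"
    and full: "full_neutral (language (W n))"
  shows "full_neutral (language (W (Suc n))) \<or> full_neutral (language (W (Suc (Suc n))))"
proof -
  let ?L = "\<lambda>n. language (W n)"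
  have L: "?L n = image_lang (\<sigma> n) (?L (Suc n))"
    "?L (Suc n) = image_lang (\<sigma> (Suc n)) (?L (Suc (Suc n)))"
    by (rule tower_language[OF t])+
  have bi_m: "biextendable (mirror_lang (?L n))" for n by (rule biextendable_mirror_lang[OF bi])
  have fac_m: "factorial_lang (mirror_lang (?L n))" for n
    by (rule factorial_mirror_lang[OF factorial_language])
  show ?thesis
    using tower_is_C[OF t, of n]
  proof (cases rule: is_C_cases)
    case c1
    note n = c1
    show ?thesis
      using tower_is_C[OF t, of "Suc n"]
    proof (cases rule: is_C_cases)
      case c1
      show ?thesis
        using full_neutral_desubstitute_c1_c1[OF factorial_language bi, of "Suc (Suc n)"] full bi[of n]
          L n c1 by metis
    next
      case c2
      show ?thesis
        using full_neutral_desubstitute_c1_c2[OF _ bi, of "Suc n" "?L (Suc (Suc n))"] full bi[of n]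
          tower_subtree[OF t] L n c2 by metis
    qed
  next
    case c2
    have Lm: "mirror_lang (?L n) = image_lang c1 (mirror_lang (?L (Suc n)))"
      unfolding L(1) c2 by (rule mirror_image_lang_c2)
    have fm: "full_neutral (mirror_lang (?L n))" using full by (simp add: full_neutral_mirror)
    show ?thesis
      using tower_is_C[OF t, of "Suc n"]
    proof (cases rule: is_C_cases)
      case c2
      have "mirror_lang (?L (Suc n)) = image_lang c1 (mirror_lang (?L (Suc (Suc n))))"
        unfolding L(2) c2 by (rule mirror_image_lang_c2)
      then show ?thesis
        using full_neutral_desubstitute_c1_c1[OF fac_m bi_m, of "Suc (Suc n)"] fm bi_m[of n] Lm
        by (metis full_neutral_mirror)
    next
      case c1
      have "mirror_lang (?L (Suc n)) = image_lang c2 (mirror_lang (?L (Suc (Suc n))))"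
        unfolding L(2) c1 by (rule mirror_image_lang_c1)
      moreover have "subtree_of_max (ext (mirror_lang (?L (Suc n))) [])"
        using tower_subtree[OF t] by (simp add: subtree_ext_mirror)
      ultimately show ?thesis
        using full_neutral_desubstitute_c1_c2[OF _ bi_m, of "Suc n"] fm bi_m[of n] Lm
        by (metis full_neutral_mirror)
    qed
  qed
qed

section \<open>Dual vectors\<close>

text \<open>A vector \<open>l\<close> assigns a weight to each letter. \<open>level_sum \<sigma> n l\<close> gives the total weights of
  the words \<open>\<sigma> 0 (\<dots> (\<sigma> (n - 1) a))\<close>; this is the transposed product of incidence matrices
  applied to \<open>l\<close>.\<close>

definition wsum :: "('a \<Rightarrow> 'b::comm_monoid_add) \<Rightarrow> 'a list \<Rightarrow> 'b" where
  "wsum l u = sum_list (map l u)"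

lemma wsum_simps [simp]: "wsum l [] = 0" "wsum l (a # u) = l a + wsum l u"
    "wsum l (u @ v) = wsum l u + wsum l v"
  by (simp_all add: wsum_def)

lemma wsum_app: "wsum l (app c u) = wsum (\<lambda>a. wsum l (c a)) u"
  by (induction u) simp_all

lemma wsum_const: "wsum (\<lambda>_. 1) u = of_nat (length u)"
  by (induction u) simp_all

lemma wsum_of_int: "wsum (\<lambda>a. of_int (p a)) u = of_int (wsum p u)"
  by (induction u) simp_all

lemma wsum_diff: "wsum (\<lambda>a. l a - t * k a) u = wsum l u - (t::real) * wsum k u"
  by (induction u) (simp_all add: algebra_simps)

lemma wsum_uminus: "wsum (\<lambda>a. - l a) u = - (wsum l u :: 'b::ab_group_add)"
  by (induction u) simp_all

lemma wsum_count: "wsum (\<lambda>x. of_bool (x = a)) u = of_nat (count_list u a)"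
  by (induction u) auto

lemma wsum_eq_sum:
  fixes l :: "3 \<Rightarrow> real"
  shows "wsum l u = (\<Sum>a\<in>UNIV. l a * real (count_list u a))"
proof (induction u)
  case (Cons x u)
  have "(\<Sum>a\<in>UNIV. l a * real (count_list (x # u) a))
      = (\<Sum>a\<in>UNIV. (if a = x then l a else 0) + l a * real (count_list u a))"
    by (intro sum.cong) (auto simp: algebra_simps)
  also have "\<dots> = l x + (\<Sum>a\<in>UNIV. l a * real (count_list u a))"
    by (simp add: sum.distrib)
  finally show ?case using Cons by simp
qed simp

lemma wsum_nonneg: "(\<And>a. l a \<ge> (0::'b::ordered_comm_monoid_add)) \<Longrightarrow> wsum l u \<ge> 0"
  by (induction u) (simp_all add: add_nonneg_nonneg)

lemma wsum_abs_le:
  fixes l :: "'a \<Rightarrow> real"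
  assumes "\<And>a. \<bar>l a\<bar> \<le> B"
  shows "\<bar>wsum l u\<bar> \<le> B * real (length u)"
proof (induction u)
  case (Cons a u)
  then show ?case using assms[of a] by (simp add: algebra_simps)
qed simp

definition level_sum :: "(nat \<Rightarrow> 3 \<Rightarrow> 3 list) \<Rightarrow> nat \<Rightarrow> (3 \<Rightarrow> 'b) \<Rightarrow> 3 \<Rightarrow> 'b::comm_monoid_add" where
  "level_sum \<sigma> n l a = wsum l (directive_word \<sigma> n [a])"

lemma level_sum_0 [simp]: "level_sum \<sigma> 0 l = l"
  by (simp add: level_sum_def fun_eq_iff)

lemma wsum_directive_word: "wsum l (directive_word \<sigma> n u) = wsum (level_sum \<sigma> n l) u"
  using wsum_app[of l "\<lambda>a. directive_word \<sigma> n [a]" u]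
  unfolding directive_word_conv_app[of \<sigma> n u, symmetric] level_sum_def[abs_def] .

lemma level_sum_add:
  "level_sum \<sigma> (m + n) l = level_sum (\<lambda>k. \<sigma> (m + k)) n (level_sum \<sigma> m l)"
proof
  fix a
  show "level_sum \<sigma> (m + n) l a = level_sum (\<lambda>k. \<sigma> (m + k)) n (level_sum \<sigma> m l) a"
    unfolding level_sum_def[of \<sigma> "m + n"] level_sum_def[of _ n] directive_word_add
    by (rule wsum_directive_word)
qed

lemma level_sum_Suc: "level_sum \<sigma> (Suc n) l a = wsum (level_sum \<sigma> n l) (\<sigma> n a)"
  by (simp add: level_sum_def[of _ "Suc n"] directive_word_snoc wsum_directive_word)

lemma level_sum_c1:
  assumes "\<sigma> n = c1"
  shows "level_sum \<sigma> (Suc n) l 1 = level_sum \<sigma> n l 1"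
    "level_sum \<sigma> (Suc n) l 2 = level_sum \<sigma> n l 1 + level_sum \<sigma> n l 3"
    "level_sum \<sigma> (Suc n) l 3 = level_sum \<sigma> n l 2"
  by (simp_all add: level_sum_Suc assms c1_letters)

lemma level_sum_c2:
  assumes "\<sigma> n = c2"
  shows "level_sum \<sigma> (Suc n) l 1 = level_sum \<sigma> n l 2"
    "level_sum \<sigma> (Suc n) l 2 = level_sum \<sigma> n l 1 + level_sum \<sigma> n l 3"
    "level_sum \<sigma> (Suc n) l 3 = level_sum \<sigma> n l 3"
  by (simp_all add: level_sum_Suc assms c2_letters)

lemma level_sum_diff:
  "level_sum \<sigma> n (\<lambda>a. l a - t * k a) a = level_sum \<sigma> n l a - (t::real) * level_sum \<sigma> n k a"
  by (simp add: level_sum_def wsum_diff)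

lemma level_sum_uminus:
  "level_sum \<sigma> n (\<lambda>a. - l a) a = - (level_sum \<sigma> n l a :: 'b::ab_group_add)"
  by (simp add: level_sum_def wsum_uminus)

lemma level_sum_of_int: "level_sum \<sigma> n (\<lambda>a. of_int (p a)) a = of_int (level_sum \<sigma> n p a)"
  by (simp add: level_sum_def wsum_of_int)

lemma level_sum_const: "level_sum \<sigma> n (\<lambda>_. 1) a = of_nat (length (directive_word \<sigma> n [a]))"
  by (simp add: level_sum_def wsum_const)

section \<open>Existence of letter frequencies\<close>

text \<open>Invariance was the guide in the choice of the five terms: under \<open>c1\<close> all of them are permuted up to
  sign, except that \<open>l 1 - l 2\<close> is replaced by \<open>l 2\<close>; under \<open>c2\<close> the same happens to
  \<open>l 2 - l 3\<close>.\<close>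

definition dual_norm :: "(3 \<Rightarrow> 'b) \<Rightarrow> 'b::linordered_idom" where
  "dual_norm l = Max {\<bar>l 1\<bar>, \<bar>l 3\<bar>, \<bar>l 1 - l 2\<bar>, \<bar>l 2 - l 3\<bar>, \<bar>l 1 - l 2 + l 3\<bar>}"

definition mixed :: "(3 \<Rightarrow> 'b::linordered_idom) \<Rightarrow> bool" where
  "mixed l \<longleftrightarrow> (\<exists>a. l a \<le> 0) \<and> (\<exists>a. l a \<ge> 0)"

lemma ex_letter: "(\<exists>a::3. P a) \<longleftrightarrow> P 1 \<or> P 2 \<or> P 3"
  by (metis exhaust_3)

lemma dual_norm_le_iff: "dual_norm l \<le> B \<longleftrightarrow> \<bar>l 1\<bar> \<le> B \<and> \<bar>l 3\<bar> \<le> B \<and> \<bar>l 1 - l 2\<bar> \<le> B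
    \<and> \<bar>l 2 - l 3\<bar> \<le> B \<and> \<bar>l 1 - l 2 + l 3\<bar> \<le> B"
  by (simp add: dual_norm_def)

lemma dual_norm_ge: "\<bar>l 1\<bar> \<le> dual_norm l" "\<bar>l 3\<bar> \<le> dual_norm l" "\<bar>l 1 - l 2\<bar> \<le> dual_norm l"
    "\<bar>l 2 - l 3\<bar> \<le> dual_norm l" "\<bar>l 1 - l 2 + l 3\<bar> \<le> dual_norm l"
  using dual_norm_le_iff[of l "dual_norm l"] by simp_all

text \<open>One of the outer entries vanishes or has a sign opposite to that of \<open>l 2\<close>, unless
  \<open>l 2\<close> itself vanishes.\<close>

lemma dual_norm_ge_2:
  assumes "mixed l" shows "\<bar>l 2\<bar> \<le> dual_norm l"
proof -
  have "\<bar>l 2\<bar> \<le> \<bar>l 1 - l 2\<bar> \<or> \<bar>l 2\<bar> \<le> \<bar>l 2 - l 3\<bar>"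
    using assms unfolding mixed_def ex_letter by linarith
  then show ?thesis using dual_norm_ge[of l] by linarith
qed

text \<open>The only new term \<open>\<bar>l 2\<bar>\<close> is bounded by the old norm, since the vector is mixed.\<close>

lemma dual_norm_step:
  fixes l :: "3 \<Rightarrow> 'b::linordered_idom"
  assumes "is_C (\<sigma> n)" "mixed (level_sum \<sigma> n l)"
  shows "dual_norm (level_sum \<sigma> (Suc n) l) \<le> dual_norm (level_sum \<sigma> n l)"
proof -
  note b = dual_norm_ge[of "level_sum \<sigma> n l"] dual_norm_ge_2[OF assms(2)]
  show ?thesis
    using assms(1)
  proof (cases rule: is_C_cases)
    case c1
    show ?thesis using b unfolding dual_norm_le_iff level_sum_c1[of \<sigma> n, OF c1]
      by (simp add: algebra_simps abs_minus_commute)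
  next
    case c2
    show ?thesis using b unfolding dual_norm_le_iff level_sum_c2[of \<sigma> n, OF c2]
      by (simp add: algebra_simps abs_minus_commute)
  qed
qed

lemma dual_norm_bounded:
  fixes l :: "3 \<Rightarrow> 'b::linordered_idom"
  assumes "\<And>n. is_C (\<sigma> n)" "\<And>n. mixed (level_sum \<sigma> n l)"
  shows "\<bar>level_sum \<sigma> n l a\<bar> \<le> dual_norm l"
proof -
  have "dual_norm (level_sum \<sigma> n l) \<le> dual_norm l"
  proof (induction n)
    case (Suc n)
    then show ?case using dual_norm_step[of \<sigma> n l, OF assms] by simp
  qed simp
  then show ?thesis
    using dual_norm_ge[of "level_sum \<sigma> n l"] dual_norm_ge_2[OF assms(2), of n]
    by (cases a rule: letter_cases) simp_all
qed

text \<open>A prefix of the word is an image at level \<open>n\<close> up to a bounded rest.\<close>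

lemma wsum_prefix_lower:
  fixes l :: "3 \<Rightarrow> real"
  assumes t: "tower \<sigma> W" and pos: "\<And>a. level_sum \<sigma> n l a \<ge> 0"
  shows "\<exists>K. \<forall>m. wsum l (prefix_of (W 0) m) \<ge> - K"
proof -
  let ?\<tau> = "level_image \<sigma> n"
  define H where "H = Max (range (\<lambda>a. length (?\<tau> a)))"
  define B where "B = Max (range (\<lambda>a. \<bar>l a\<bar>))"
  have H: "length (?\<tau> a) \<le> H" for a unfolding H_def by (rule Max_ge) auto
  have B: "\<bar>l a\<bar> \<le> B" for a unfolding B_def by (rule Max_ge) auto
  then have B0: "B \<ge> 0" using abs_ge_zero order.trans by blast
  have "wsum l (prefix_of (W 0) m) \<ge> - (B * real H)" for m
  proof -
    obtain j where j: "cut_pos ?\<tau> (W n) j \<le> m" "m < cut_pos ?\<tau> (W n) (Suc j)"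
      using cut_pos_between[OF tower_nonerasing[OF t]] by blast
    define r where "r = prefix_of (\<lambda>k. W 0 (cut_pos ?\<tau> (W n) j + k)) (m - cut_pos ?\<tau> (W n) j)"
    have "prefix_of (W 0) m = prefix_of (W 0) (cut_pos ?\<tau> (W n) j) @ r"
      using prefix_of_add[of "W 0" "cut_pos ?\<tau> (W n) j" "m - cut_pos ?\<tau> (W n) j"] j(1)
      by (simp add: r_def)
    also have "prefix_of (W 0) (cut_pos ?\<tau> (W n) j) = app ?\<tau> (prefix_of (W n) j)"
      using img_prefix[OF tower_nonerasing[OF t], of n "W n" j] tower_level[OF t, of n] by simp
    also have "\<dots> = directive_word \<sigma> n (prefix_of (W n) j)"
      by (rule directive_word_conv_app[symmetric])
    finally have "wsum l (prefix_of (W 0) m) = wsum (level_sum \<sigma> n l) (prefix_of (W n) j) + wsum l r"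
      by (simp add: wsum_directive_word)
    moreover have "wsum (level_sum \<sigma> n l) (prefix_of (W n) j) \<ge> 0"
      using pos by (rule wsum_nonneg)
    moreover have "wsum l r \<ge> - (B * real H)"
    proof -
      have "length r \<le> H"
        using j(2) H[of "W n j"] by (simp add: r_def cut_pos_Suc)
      then have "B * real (length r) \<le> B * real H" using B0 by (intro mult_left_mono) auto
      moreover have "\<bar>wsum l r\<bar> \<le> B * real (length r)" using B by (rule wsum_abs_le)
      ultimately show ?thesis by linarith
    qed
    ultimately show ?thesis by linarith
  qed
  then show ?thesis by blast
qed

definition mean :: "(3 \<Rightarrow> real) \<Rightarrow> (nat \<Rightarrow> 3) \<Rightarrow> nat \<Rightarrow> real" where
  "mean l w m = wsum l (prefix_of w m) / real m"

lemma mean_diff_const: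
  "m > 0 \<Longrightarrow> mean (\<lambda>a. l a - t) w m = mean l w m - t"
  using wsum_diff[of l t "\<lambda>_. 1" "prefix_of w m"]
  by (simp add: mean_def wsum_const diff_divide_distrib)

lemma mean_uminus: "mean (\<lambda>a. - l a) w m = - mean l w m"
  by (simp add: mean_def wsum_uminus)

lemma mean_lower:
  assumes t: "tower \<sigma> W" and pos: "\<And>a. level_sum \<sigma> n (\<lambda>a. l a - t) a \<ge> 0" and "e > 0"
  shows "\<forall>\<^sub>F m in sequentially. mean l (W 0) m > t - e"
proof -
  obtain K where K: "\<And>m. wsum (\<lambda>a. l a - t) (prefix_of (W 0) m) \<ge> - K"
    using wsum_prefix_lower[OF t pos] by blast
  have "(\<lambda>m. - K / real m) \<longlonglongrightarrow> 0" by real_asymp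
  then have "\<forall>\<^sub>F m in sequentially. - K / real m > - e"
    using \<open>e > 0\<close> by (intro order_tendstoD) auto
  then show ?thesis
    using eventually_gt_at_top[of 0]
  proof eventually_elim
    case (elim m)
    have "- K / real m \<le> mean (\<lambda>a. l a - t) (W 0) m"
      unfolding mean_def using K[of m] elim by (intro divide_right_mono) auto
    then show ?case using mean_diff_const[of m l t "W 0"] elim by linarith
  qed
qed

lemma mean_upper:
  assumes t: "tower \<sigma> W" and neg: "\<And>a. level_sum \<sigma> n (\<lambda>a. l a - t) a \<le> 0" and "e > 0"
  shows "\<forall>\<^sub>F m in sequentially. mean l (W 0) m < t + e"
proof -
  have "level_sum \<sigma> n (\<lambda>a. - l a - (- t)) a \<ge> 0" for a
    using neg[of a] level_sum_uminus[of \<sigma> n "\<lambda>a. l a - t" a] by (simp add: algebra_simps)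
  from mean_lower[OF t this \<open>e > 0\<close>] show ?thesis
    by eventually_elim (simp add: mean_uminus)
qed

text \<open>Some subsequence converges, and infinitely many terms keep a distance from its limit, on the
  same side.\<close>

lemma not_convergent_gap:
  fixes r :: "nat \<Rightarrow> real"
  assumes "Bseq r" "\<not> convergent r"
  shows "\<exists>s t. s < t \<and> (\<exists>\<^sub>F n in sequentially. r n < s) \<and> (\<exists>\<^sub>F n in sequentially. r n > t)"
proof -
  obtain f l where f: "strict_mono f" "(r \<circ> f) \<longlonglongrightarrow> l"
    using bounded_imp_convergent_subsequence assms(1) by (metis Bseq_eq_bounded)
  have near: "\<exists>\<^sub>F n in sequentially. \<bar>r n - l\<bar> < e" if "e > 0" for e
  proof -
    have "\<forall>\<^sub>F n in sequentially. \<bar>(r \<circ> f) n - l\<bar> < e"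
      using f(2) that by (simp add: tendsto_iff dist_real_def)
    then obtain M where M: "\<And>n. n \<ge> M \<Longrightarrow> \<bar>r (f n) - l\<bar> < e"
      by (auto simp: eventually_sequentially)
    show ?thesis
      unfolding frequently_sequentially
    proof
      fix N
      have "f (max M N) \<ge> N" using seq_suble[OF f(1), of "max M N"] by linarith
      then show "\<exists>n\<ge>N. \<bar>r n - l\<bar> < e" using M[of "max M N"] by auto
    qed
  qed
  have "\<not> r \<longlonglongrightarrow> l" using assms(2) by (auto simp: convergent_def)
  then obtain e where e: "e > 0" "\<exists>\<^sub>F n in sequentially. \<not> \<bar>r n - l\<bar> < e"
    unfolding tendsto_iff dist_real_def frequently_def by auto
  have "\<exists>\<^sub>F n in sequentially. r n > l + 2 * e / 3 \<or> r n < l - 2 * e / 3"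
    using e(2) by (rule frequently_elim1) (use e(1) in auto)
  then have "(\<exists>\<^sub>F n in sequentially. r n > l + 2 * e / 3) \<or> (\<exists>\<^sub>F n in sequentially. r n < l - 2 * e / 3)"
    by (simp add: frequently_disj_iff)
  then show ?thesis
  proof
    assume "\<exists>\<^sub>F n in sequentially. r n > l + 2 * e / 3"
    moreover have "\<exists>\<^sub>F n in sequentially. r n < l + e / 3"
      by (rule frequently_elim1[OF near[of "e / 3"]]) (use e(1) in linarith)+
    ultimately show ?thesis using e(1) by (intro exI[of _ "l + e / 3"] exI[of _ "l + 2 * e / 3"]) auto
  next
    assume "\<exists>\<^sub>F n in sequentially. r n < l - 2 * e / 3"
    moreover have "\<exists>\<^sub>F n in sequentially. r n > l - e / 3"
      by (rule frequently_elim1[OF near[of "e / 3"]]) (use e(1) in linarith)+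
    ultimately show ?thesis using e(1) by (intro exI[of _ "l - 2 * e / 3"] exI[of _ "l - e / 3"]) auto
  qed
qed

lemma length_directive_word_unbounded:
  assumes "C_adic w \<sigma>"
  shows "\<exists>n a. length (directive_word \<sigma> n [a]) \<ge> m"
  using assms unfolding C_adic_def words_tendsto_def eventually_sequentially by blast

text \<open>If the means of \<open>l\<close> oscillated, then for two different values of \<open>t\<close> the vectors \<open>l - t\<close>
  would be mixed at all levels, hence bounded; so their difference, a multiple of the lengths of
  the images of letters, would be bounded.\<close>

lemma mean_convergent:
  assumes t: "tower \<sigma> W"
  shows "convergent (mean l (W 0))"
proof (rule ccontr)
  assume not_conv: "\<not> convergent (mean l (W 0))"
  define B where "B = Max (range (\<lambda>a. \<bar>l a\<bar>))"
  have B: "\<bar>l a\<bar> \<le> B" for a unfolding B_def by (rule Max_ge) auto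
  have "\<bar>mean l (W 0) m\<bar> \<le> B" for m
  proof (cases "m = 0")
    case True
    then show ?thesis using B[of 1] by (simp add: mean_def)
  next
    case False
    then show ?thesis using wsum_abs_le[of l B "prefix_of (W 0) m"] B
      by (simp add: mean_def divide_le_eq)
  qed
  then have "Bseq (mean l (W 0))" by (intro BseqI'[of _ B]) simp
  then obtain s1 s2 where s: "s1 < s2" "\<exists>\<^sub>F m in sequentially. mean l (W 0) m < s1"
      "\<exists>\<^sub>F m in sequentially. mean l (W 0) m > s2"
    using not_convergent_gap not_conv by blast
  have mixed: "mixed (level_sum \<sigma> n (\<lambda>a. l a - t))" if "s1 < t" "t < s2" for n t
  proof (rule ccontr)
    assume "\<not> mixed (level_sum \<sigma> n (\<lambda>a. l a - t))"
    then have "(\<forall>a. level_sum \<sigma> n (\<lambda>a. l a - t) a \<ge> 0) \<or> (\<forall>a. level_sum \<sigma> n (\<lambda>a. l a - t) a \<le> 0)"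
      unfolding mixed_def by (meson linear)
    then show False
    proof
      assume "\<forall>a. level_sum \<sigma> n (\<lambda>a. l a - t) a \<ge> 0"
      then have "\<forall>\<^sub>F m in sequentially. mean l (W 0) m > t - (t - s1)"
        using that by (intro mean_lower[OF assms]) auto
      then have "\<forall>\<^sub>F m in sequentially. \<not> mean l (W 0) m < s1" by (rule eventually_mono) simp
      then show False using s(2) unfolding frequently_def by blast
    next
      assume "\<forall>a. level_sum \<sigma> n (\<lambda>a. l a - t) a \<le> 0"
      then have "\<forall>\<^sub>F m in sequentially. mean l (W 0) m < t + (s2 - t)"
        using that by (intro mean_upper[OF assms]) auto
      then have "\<forall>\<^sub>F m in sequentially. \<not> mean l (W 0) m > s2" by (rule eventually_mono) simp
      then show False using s(3) unfolding frequently_def by blast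
    qed
  qed
  \<comment> \<open>any two different values strictly between the bounds of the oscillation\<close>
  define t1 t2 where "t1 = s1 + (s2 - s1) / 3" and "t2 = s1 + 2 * (s2 - s1) / 3"
  have t: "s1 < t1" "t1 < t2" "t2 < s2" using s(1) by (simp_all add: t1_def t2_def field_simps)
  define D where "D = dual_norm (\<lambda>a. l a - t1) + dual_norm (\<lambda>a. l a - t2)"
  note C = tower_is_C[OF assms]
  have "(t2 - t1) * real (length (directive_word \<sigma> n [a])) \<le> D" for n a
  proof -
    have "\<bar>level_sum \<sigma> n (\<lambda>a. l a - t1) a\<bar> \<le> dual_norm (\<lambda>a. l a - t1)"
      "\<bar>level_sum \<sigma> n (\<lambda>a. l a - t2) a\<bar> \<le> dual_norm (\<lambda>a. l a - t2)"
      using t by (intro dual_norm_bounded C mixed; simp)+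
    moreover have "level_sum \<sigma> n (\<lambda>a. l a - t1) a - level_sum \<sigma> n (\<lambda>a. l a - t2) a
        = (t2 - t1) * real (length (directive_word \<sigma> n [a]))"
      using level_sum_diff[of \<sigma> n l t1 "\<lambda>_. 1" a] level_sum_diff[of \<sigma> n l t2 "\<lambda>_. 1" a]
      by (simp add: level_sum_const algebra_simps)
    ultimately show ?thesis unfolding D_def by linarith
  qed
  then have bounded: "real (length (directive_word \<sigma> n [a])) \<le> D / (t2 - t1)" for n a
    using t by (simp add: field_simps)
  have "C_adic (W 0) \<sigma>" using tower_C_adic[OF assms, of 0] by simp
  then obtain n a where "length (directive_word \<sigma> n [a]) \<ge> Suc (nat \<lceil>D / (t2 - t1)\<rceil>)"
    using length_directive_word_unbounded by blast
  then show False using bounded[of n a] by linarith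
qed

lemma letter_ratio_mean: "letter_ratio w a = mean (\<lambda>x. of_bool (x = a)) w"
  by (simp add: fun_eq_iff letter_ratio_def mean_def wsum_count)

lemma letter_ratio_tendsto:
  assumes "tower \<sigma> W"
  shows "convergent (letter_ratio (W 0) a)" "letter_ratio (W 0) a \<longlonglongrightarrow> letter_frequency (W 0) a"
  using mean_convergent[OF assms]
  by (simp_all add: letter_ratio_mean letter_frequency_def convergent_LIMSEQ_iff)

lemma mean_tendsto:
  assumes "tower \<sigma> W"
  shows "mean l (W 0) \<longlonglongrightarrow> (\<Sum>a\<in>UNIV. l a * letter_frequency (W 0) a)"
proof -
  have "mean l (W 0) m = (\<Sum>a\<in>UNIV. l a * letter_ratio (W 0) a m)" for m
    unfolding mean_def letter_ratio_def wsum_eq_sum by (simp add: sum_divide_distrib)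
  then have "mean l (W 0) = (\<lambda>m. \<Sum>a\<in>UNIV. l a * letter_ratio (W 0) a m)" by (rule ext)
  moreover have "(\<lambda>m. \<Sum>a\<in>UNIV. l a * letter_ratio (W 0) a m)
      \<longlonglongrightarrow> (\<Sum>a\<in>UNIV. l a * letter_frequency (W 0) a)"
    by (intro tendsto_intros letter_ratio_tendsto[OF assms])
  ultimately show ?thesis by simp
qed

section \<open>Rational independence\<close>

text \<open>Primitivity in terms of words: from each level on, some block of substitutions maps every letter
  to a word that contains all letters.\<close>

definition spreading :: "(nat \<Rightarrow> 3 \<Rightarrow> 3 list) \<Rightarrow> bool" where
  "spreading \<sigma> \<longleftrightarrow> (\<forall>r. \<exists>k>0. \<forall>a b. a \<in> set (directive_word (\<lambda>j. \<sigma> (r + j)) k [b]))"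

definition strictly_mixed :: "(3 \<Rightarrow> int) \<Rightarrow> bool" where
  "strictly_mixed p \<longleftrightarrow> (\<exists>a. p a < 0) \<and> (\<exists>a. p a > 0)"

lemma level_sum_nonzero:
  fixes p :: "3 \<Rightarrow> int"
  assumes "\<And>n. is_C (\<sigma> n)" "\<exists>a. p a \<noteq> 0"
  shows "\<exists>a. level_sum \<sigma> n p a \<noteq> 0"
proof (induction n)
  case (Suc n)
  show ?case
    using assms(1)[of n]
  proof (cases rule: is_C_cases)
    case c1
    show ?thesis using Suc unfolding ex_letter level_sum_c1[of \<sigma> n, OF c1] by auto
  next
    case c2
    show ?thesis using Suc unfolding ex_letter level_sum_c2[of \<sigma> n, OF c2] by auto
  qed
qed (use assms(2) in simp)

lemma wsum_pos:
  fixes p :: "3 \<Rightarrow> int"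
  assumes "\<And>a. p a \<ge> 0" "p a > 0" "a \<in> set u"
  shows "wsum p u > 0"
  using assms(3)
proof (induction u)
  case (Cons x u)
  have "wsum p u \<ge> 0" using assms(1) by (rule wsum_nonneg)
  then show ?case using Cons assms(1)[of x] assms(2) by (cases "x = a") simp_all
qed simp

text \<open>A nonzero dual vector without negative entries becomes positive at a later level, and then the
  means are bounded below by a positive number.\<close>

lemma relation_not_nonneg:
  fixes p :: "3 \<Rightarrow> int"
  assumes t: "tower \<sigma> W" and sp: "spreading \<sigma>" and nz: "\<exists>a. p a \<noteq> 0"
    and lim: "mean (\<lambda>a. of_int (p a)) (W 0) \<longlonglongrightarrow> 0"
  shows "\<exists>a. level_sum \<sigma> n p a < 0"
proof (rule ccontr)
  assume "\<not> ?thesis"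
  then have nonneg: "level_sum \<sigma> n p a \<ge> 0" for a by (meson not_le)
  obtain a0 where "level_sum \<sigma> n p a0 \<noteq> 0" using level_sum_nonzero[of \<sigma>, OF tower_is_C[OF t] nz] by blast
  then have a0: "level_sum \<sigma> n p a0 > 0" using nonneg[of a0] by simp
  obtain k where k: "\<And>a b. a \<in> set (directive_word (\<lambda>j. \<sigma> (n + j)) k [b])"
    using sp unfolding spreading_def by blast
  have pos: "level_sum \<sigma> (n + k) p b \<ge> 1" for b
    using wsum_pos[of "level_sum \<sigma> n p", OF nonneg a0 k[of a0 b]]
    by (simp add: level_sum_add level_sum_def[of "\<lambda>j. \<sigma> (n + j)" k])
  define H where "H = Max (range (\<lambda>b. length (directive_word \<sigma> (n + k) [b])))"
  have H: "length (directive_word \<sigma> (n + k) [b]) \<le> H" for b unfolding H_def by (rule Max_ge) auto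
  \<comment> \<open>small enough for the weight \<open>p - e\<close> to be nonnegative at level \<open>n + k\<close>\<close>
  define e where "e = 1 / (real H + 1)"
  have e: "e > 0" by (simp add: e_def add_nonneg_pos)
  have "level_sum \<sigma> (n + k) (\<lambda>a. of_int (p a) - e) b \<ge> 0" for b
  proof -
    have "e * real (length (directive_word \<sigma> (n + k) [b])) \<le> e * (real H + 1)"
      using H[of b] e by (intro mult_left_mono) auto
    also have "\<dots> = 1" by (simp add: e_def add_nonneg_eq_0_iff)
    also have "\<dots> \<le> real_of_int (level_sum \<sigma> (n + k) p b)" using pos[of b] by simp
    finally show ?thesis
      using level_sum_diff[of \<sigma> "n + k" "\<lambda>a. of_int (p a)" e "\<lambda>_. 1" b]
      by (simp add: level_sum_const level_sum_of_int)
  qed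
  from mean_lower[OF t this, of "e / 2"] e
  have "\<forall>\<^sub>F m in sequentially. mean (\<lambda>a. of_int (p a)) (W 0) m > e / 2"
    by (auto elim: eventually_mono)
  moreover have "\<forall>\<^sub>F m in sequentially. mean (\<lambda>a. of_int (p a)) (W 0) m < e / 2"
    using lim e by (intro order_tendstoD) auto
  ultimately have "\<forall>\<^sub>F m::nat in sequentially. False" by eventually_elim simp
  then show False by simp
qed

lemma relation_strictly_mixed:
  fixes p :: "3 \<Rightarrow> int"
  assumes t: "tower \<sigma> W" and sp: "spreading \<sigma>" and nz: "\<exists>a. p a \<noteq> 0"
    and lim: "mean (\<lambda>a. of_int (p a)) (W 0) \<longlonglongrightarrow> 0"
  shows "strictly_mixed (level_sum \<sigma> n p)"
proof -
  have "mean (\<lambda>a. of_int (- p a)) (W 0) = (\<lambda>m. - mean (\<lambda>a. of_int (p a)) (W 0) m)"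
    by (rule ext) (simp add: mean_uminus)
  then have "mean (\<lambda>a. of_int (- p a)) (W 0) \<longlonglongrightarrow> 0"
    using tendsto_minus[OF lim] by simp
  then have "\<exists>a. level_sum \<sigma> n (\<lambda>a. - p a) a < 0"
    using nz by (intro relation_not_nonneg[OF t sp]) auto
  then show ?thesis
    using relation_not_nonneg[OF t sp nz lim, of n]
    by (simp add: strictly_mixed_def level_sum_uminus)
qed

text \<open>An integral relation between the frequencies has strictly mixed dual vectors, whose norms
  are eventually constant. Up to sign and mirror symmetry such a vector is of one of the forms
  \<open>(x, -m, z)\<close> and \<open>(x, y, -m)\<close>. In the following cases a vector of constant norm
  must change to one of the same kind, while the number \<open>m\<close> decreases every other step.\<close>

definition descending :: "int \<Rightarrow> int \<Rightarrow> int \<Rightarrow> bool" where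
  "descending x y z \<longleftrightarrow>
     (x > 0 \<and> y < 0 \<and> z > 0) \<or> (x < 0 \<and> y > 0 \<and> z < 0)
     \<or> (z < 0 \<and> 0 < x \<and> x \<le> y) \<or> (z > 0 \<and> 0 > x \<and> x \<ge> y)
     \<or> (x < 0 \<and> 0 < z \<and> z \<le> y) \<or> (x > 0 \<and> 0 > z \<and> z \<ge> y)"

text \<open>Twice the number \<open>m\<close> of the odd entry out, plus 1 for the form \<open>(x, -m, z)\<close>: this form is reached
  with a decrease of \<open>m\<close>, and it is left with \<open>m\<close> unchanged.\<close>

definition descent_measure :: "int \<Rightarrow> int \<Rightarrow> int \<Rightarrow> int" where
  "descent_measure x y z =
     (if x > 0 \<and> z > 0 \<or> x < 0 \<and> z < 0 then 2 * \<bar>y\<bar> + 1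
      else if x > 0 \<and> y > 0 \<or> x < 0 \<and> y < 0 then 2 * \<bar>z\<bar>
      else 2 * \<bar>x\<bar>)"

text \<open>A vanishing outer entry either stays, which determines the next substitution, or leads to
  one of the cases above.\<close>

definition pinned :: "int \<Rightarrow> int \<Rightarrow> int \<Rightarrow> bool" where
  "pinned x y z \<longleftrightarrow> x = 0 \<and> (y < 0 \<and> z > 0 \<or> y > 0 \<and> z < 0)"

definition norm3 :: "int \<Rightarrow> int \<Rightarrow> int \<Rightarrow> int" where
  "norm3 x y z = max \<bar>x\<bar> (max \<bar>z\<bar> (max \<bar>x - y\<bar> (max \<bar>y - z\<bar> \<bar>x - y + z\<bar>)))"

definition mixed3 :: "int \<Rightarrow> int \<Rightarrow> int \<Rightarrow> bool" where
  "mixed3 x y z \<longleftrightarrow> (x < 0 \<or> y < 0 \<or> z < 0) \<and> (x > 0 \<or> y > 0 \<or> z > 0)"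

lemma norm3_lt_iff: "norm3 x y z < b \<longleftrightarrow>
    \<bar>x\<bar> < b \<and> \<bar>z\<bar> < b \<and> \<bar>x - y\<bar> < b \<and> \<bar>y - z\<bar> < b \<and> \<bar>x - y + z\<bar> < b"
  by (simp add: norm3_def)

lemma norm3_ge: "\<bar>x\<bar> \<le> norm3 x y z \<and> \<bar>z\<bar> \<le> norm3 x y z \<and> \<bar>x - y\<bar> \<le> norm3 x y z
    \<and> \<bar>y - z\<bar> \<le> norm3 x y z \<and> \<bar>x - y + z\<bar> \<le> norm3 x y z"
  unfolding norm3_def by (simp add: le_max_iff_disj)

lemma descending_mirror: "descending z y x \<longleftrightarrow> descending x y z"
  unfolding descending_def by auto

lemma norm3_mirror: "norm3 z y x = norm3 x y z"
  unfolding norm3_def by (simp add: abs_minus_commute algebra_simps max.left_commute)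

lemma mixed3_mirror: "mixed3 z y x \<longleftrightarrow> mixed3 x y z"
  unfolding mixed3_def by auto

lemma descent_measure_mirror:
  "descending x y z \<Longrightarrow> descent_measure z y x = descent_measure x y z"
  unfolding descending_def descent_measure_def by auto

lemma descending_step1:
  assumes "descending x y z" "mixed3 x (x + z) y" "norm3 x (x + z) y = norm3 x y z"
  shows "descending x (x + z) y \<and> descent_measure x (x + z) y < descent_measure x y z"
proof -
  define N where "N = norm3 x y z"
  have "\<not> norm3 x (x + z) y < N" using assms(3) by (simp add: N_def)
  then have d: "descending x (x + z) y"
    using assms(1,2) norm3_ge[of x y z, folded N_def]
    unfolding norm3_lt_iff descending_def mixed3_def by (smt (verit))
  then have "descent_measure x (x + z) y < descent_measure x y z"
    using assms(1) unfolding descending_def descent_measure_def by (smt (verit))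
  with d show ?thesis by blast
qed

lemma descending_step2:
  assumes "descending x y z" "mixed3 y (x + z) z" "norm3 y (x + z) z = norm3 x y z"
  shows "descending y (x + z) z \<and> descent_measure y (x + z) z < descent_measure x y z"
proof -
  have "descending z (x + z) y \<and> descent_measure z (x + z) y < descent_measure z y x"
    using descending_step1[of z y x] assms descending_mirror[of x y z] mixed3_mirror[of z "x + z" y]
      norm3_mirror[of z "x + z" y] norm3_mirror[of x y z]
    by (simp add: add.commute)
  then show ?thesis
    using descending_mirror[of z "x + z" y] descent_measure_mirror[of z "x + z" y]
      descent_measure_mirror[OF assms(1)] by simp
qed

text \<open>The remaining forms have a vanishing outer entry or lead in one step to a descending or pinned one;
  otherwise the norm decreases.\<close>

lemma reach_descending_step1:
  assumes "mixed3 x y z" "mixed3 x (x + z) y" "norm3 x (x + z) y = norm3 x y z"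
  shows "descending x y z \<or> pinned x y z \<or> pinned z y x
    \<or> descending x (x + z) y \<or> pinned x (x + z) y \<or> pinned y (x + z) x"
proof -
  define N where "N = norm3 x y z"
  have "\<not> norm3 x (x + z) y < N" using assms(3) by (simp add: N_def)
  then show ?thesis
    using assms(1,2) norm3_ge[of x y z, folded N_def]
    unfolding norm3_lt_iff descending_def mixed3_def pinned_def by (smt (verit))
qed

lemma reach_descending_step2:
  assumes "mixed3 x y z" "mixed3 y (x + z) z" "norm3 y (x + z) z = norm3 x y z"
  shows "descending x y z \<or> pinned x y z \<or> pinned z y x
    \<or> descending y (x + z) z \<or> pinned y (x + z) z \<or> pinned z (x + z) y"
  using reach_descending_step1[of z y x] assms descending_mirror[of x y z]
    descending_mirror[of y "x + z" z] norm3_mirror[of x y z] norm3_mirror[of y "x + z" z]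
    mixed3_mirror[of x y z] mixed3_mirror[of y "x + z" z]
  by (auto simp: add.commute)

lemma pinned_step:
  assumes "pinned x y z"
  shows "pinned x (x + z) y" "descending y (x + z) z"
  using assms unfolding pinned_def descending_def by auto

lemma dual_norm_norm3: "dual_norm p = norm3 (p 1) (p 2) (p 3)"
  by (simp add: dual_norm_def norm3_def)

lemma c1_neq_c2: "c1 \<noteq> c2"
  using c1_letters(1) c2_letters(1) by force

text \<open>When the norm is constant, no vector can be descending, because the measure would decrease for
  ever. So the vector is pinned, and the directive sequence is constant from there on.\<close>

lemma no_integer_relation:
  fixes p :: "3 \<Rightarrow> int"
  assumes t: "tower \<sigma> W" and sp: "spreading \<sigma>"
    and inf1: "\<And>n. \<exists>m\<ge>n. \<sigma> m = c1" and inf2: "\<And>n. \<exists>m\<ge>n. \<sigma> m = c2"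
    and lim: "mean (\<lambda>a. of_int (p a)) (W 0) \<longlonglongrightarrow> 0"
  shows "p a = 0"
proof (rule ccontr)
  assume "p a \<noteq> 0"
  then have nz: "\<exists>a. p a \<noteq> 0" by blast
  define x y z where "x n = level_sum \<sigma> n p 1" and "y n = level_sum \<sigma> n p 2"
    and "z n = level_sum \<sigma> n p 3" for n
  define N where "N n = norm3 (x n) (y n) (z n)" for n
  have smixed: "strictly_mixed (level_sum \<sigma> n p)" for n
    by (rule relation_strictly_mixed[OF t sp nz lim])
  then have mixed: "mixed3 (x n) (y n) (z n)" for n
    using smixed[of n] unfolding strictly_mixed_def mixed3_def ex_letter x_def y_def z_def by blast
  have "mixed (level_sum \<sigma> n p)" for n
    using smixed[of n] unfolding strictly_mixed_def mixed_def by (meson less_imp_le)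
  then have N_step: "N (Suc n) \<le> N n" for n
    using dual_norm_step[of \<sigma> n p, OF tower_is_C[OF t]]
    by (simp add: N_def dual_norm_norm3 x_def y_def z_def)
  have N_nonneg: "N n \<ge> 0" for n using norm3_ge[of "x n" "y n" "z n"] unfolding N_def by linarith
  obtain n0 where n0: "\<And>n. nat (N n0) \<le> nat (N n)"
    using ex_has_least_nat[of "\<lambda>_. True" 0 "\<lambda>n. nat (N n)"] by blast
  have N_const: "N (Suc n) = N n" if "n \<ge> n0" for n
  proof -
    have le: "N m \<le> N n0" if "m \<ge> n0" for m
      using that N_step by (induction rule: dec_induct) (auto intro: order.trans)
    have ge: "N n0 \<le> N m" for m using n0[of m] N_nonneg[of m] N_nonneg[of n0] by linarith
    show ?thesis using le[of n] le[of "Suc n"] ge[of n] ge[of "Suc n"] that by linarith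
  qed
  have stp: "(\<sigma> n = c1 \<and> x (Suc n) = x n \<and> y (Suc n) = x n + z n \<and> z (Suc n) = y n)
      \<or> (\<sigma> n = c2 \<and> x (Suc n) = y n \<and> y (Suc n) = x n + z n \<and> z (Suc n) = z n)" for n
    using tower_is_C[OF t, of n] level_sum_c1[of \<sigma> n p] level_sum_c2[of \<sigma> n p]
    unfolding is_C_def x_def y_def z_def by blast
  define D where "D n = descending (x n) (y n) (z n)" for n
  define M where "M n = descent_measure (x n) (y n) (z n)" for n
  have D_step: "D (Suc n) \<and> M (Suc n) < M n" if "n \<ge> n0" "D n" for n
    using stp[of n] descending_step1[of "x n" "y n" "z n"] descending_step2[of "x n" "y n" "z n"]
      mixed[of "Suc n"] N_const[OF that(1)] that(2)
    unfolding D_def M_def N_def by (elim disjE conjE) simp_all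
  have noD: "\<not> D n" if n: "n \<ge> n0" for n
  proof
    assume "D n"
    have "D (n + k) \<and> M (n + k) + int k \<le> M n" for k
    proof (induction k)
      case (Suc k)
      then show ?case using D_step[of "n + k"] n by auto
    qed (use \<open>D n\<close> in simp)
    from this[of "Suc (nat (M n))"] have "M (n + Suc (nat (M n))) < 0" by linarith
    then show False by (auto simp: M_def descent_measure_def split: if_splits)
  qed
  have no1: "\<not> pinned (x n) (y n) (z n)" if n: "n \<ge> n0" for n
  proof
    assume f: "pinned (x n) (y n) (z n)"
    have "pinned (x m) (y m) (z m) \<and> \<sigma> m = c1" if "m \<ge> n" for m
      using that
    proof (induction rule: dec_induct)
      case base
      show ?case using f pinned_step(2)[OF f] stp[of n] noD[of "Suc n"] n by (auto simp: D_def)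
    next
      case (step m)
      then have f': "pinned (x (Suc m)) (y (Suc m)) (z (Suc m))"
        using pinned_step(1)[of "x m" "y m" "z m"] stp[of m] c1_neq_c2 by auto
      then show ?case
        using pinned_step(2)[OF f'] stp[of "Suc m"] noD[of "Suc (Suc m)"] step n
        by (auto simp: D_def)
    qed
    then show False using inf2[of n] c1_neq_c2 by metis
  qed
  have no3: "\<not> pinned (z n) (y n) (x n)" if n: "n \<ge> n0" for n
  proof
    assume f: "pinned (z n) (y n) (x n)"
    have "pinned (z m) (y m) (x m) \<and> \<sigma> m = c2" if "m \<ge> n" for m
      using that
    proof (induction rule: dec_induct)
      case base
      show ?case
        using f pinned_step(2)[OF f] stp[of n] noD[of "Suc n"] n
          descending_mirror[of "x n" "x n + z n" "y n"]
        by (auto simp: D_def add.commute)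
    next
      case (step m)
      then have f': "pinned (z (Suc m)) (y (Suc m)) (x (Suc m))"
        using pinned_step(1)[of "z m" "y m" "x m"] stp[of m] c1_neq_c2
        by (auto simp: add.commute)
      then show ?case
        using pinned_step(2)[OF f'] stp[of "Suc m"] noD[of "Suc (Suc m)"] step n
          descending_mirror[of "x (Suc m)" "x (Suc m) + z (Suc m)" "y (Suc m)"]
        by (auto simp: D_def add.commute)
    qed
    then show False using inf1[of n] c1_neq_c2 by metis
  qed
  have "D n0 \<or> pinned (x n0) (y n0) (z n0) \<or> pinned (z n0) (y n0) (x n0) \<or> D (Suc n0)
      \<or> pinned (x (Suc n0)) (y (Suc n0)) (z (Suc n0))
      \<or> pinned (z (Suc n0)) (y (Suc n0)) (x (Suc n0))"
    using stp[of n0] reach_descending_step1[of "x n0" "y n0" "z n0"]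
      reach_descending_step2[of "x n0" "y n0" "z n0"] mixed[of n0] mixed[of "Suc n0"] N_const[of n0]
    unfolding D_def N_def by (elim disjE conjE) simp_all
  then show False using noD[of n0] noD[of "Suc n0"] no1[of n0] no1[of "Suc n0"] no3[of n0]
      no3[of "Suc n0"] by simp
qed

section \<open>Primitivity\<close>

definition paired_from :: "(nat \<Rightarrow> 'a) \<Rightarrow> nat \<Rightarrow> bool" where
  "paired_from \<sigma> N \<longleftrightarrow> (\<forall>k. \<sigma> (N + 2 * k) = \<sigma> (Suc (N + 2 * k)))"

text \<open>The row of a letter consists of the numbers of its occurrences in the images of the
  letters.\<close>

abbreviation letter_row :: "(nat \<Rightarrow> 3 \<Rightarrow> 3 list) \<Rightarrow> 3 \<Rightarrow> nat \<Rightarrow> 3 \<Rightarrow> int" where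
  "letter_row \<sigma> a k \<equiv> level_sum \<sigma> k (\<lambda>x. of_bool (x = a))"

lemma row_count: "letter_row \<sigma> a k b = int (count_list (directive_word \<sigma> k [b]) a)"
  by (simp add: level_sum_def wsum_count)

lemma count_list_pos: "0 < count_list u a \<longleftrightarrow> a \<in> set u"
  using count_list_0_iff[of u a] by auto

lemma row_nonneg: "letter_row \<sigma> a k b \<ge> 0"
  by (simp add: row_count)

lemma row_pos: "letter_row \<sigma> a k b > 0 \<longleftrightarrow> a \<in> set (directive_word \<sigma> k [b])"
  unfolding row_count using count_list_pos[of "directive_word \<sigma> k [b]" a] by simp

lemma row_pos_step:
  assumes "is_C (\<sigma> k)" "\<forall>b. letter_row \<sigma> a k b > 0"
  shows "\<forall>b. letter_row \<sigma> a (Suc k) b > 0"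
  using assms(1)
proof (cases rule: is_C_cases)
  case c1
  show ?thesis using assms(2) unfolding forall_3 level_sum_c1[of \<sigma> k, OF c1] by simp
next
  case c2
  show ?thesis using assms(2) unfolding forall_3 level_sum_c2[of \<sigma> k, OF c2] by simp
qed

lemma row_pos_mono:
  assumes "\<And>n. is_C (\<sigma> n)" "\<forall>b. letter_row \<sigma> a k b > 0" "k \<le> m"
  shows "\<forall>b. letter_row \<sigma> a m b > 0"
  using assms(3,2)
proof (induction rule: dec_induct)
  case (step m)
  then show ?case using row_pos_step[of \<sigma> m a, OF assms(1)] by blast
qed

text \<open>With positive entries 1 and 2 only a further \<open>c1\<close> is needed, and \<open>c2\<close> does no
  harm.\<close>

lemma row_pos_12:
  assumes C: "\<And>n. is_C (\<sigma> n)" and inf1: "\<And>n. \<exists>m\<ge>n. \<sigma> m = c1"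
    and pos: "letter_row \<sigma> a k 1 > 0" "letter_row \<sigma> a k 2 > 0"
  shows "\<exists>m\<ge>k. \<forall>b. letter_row \<sigma> a m b > 0"
proof -
  obtain m where "m \<ge> k" "\<sigma> m = c1" using inf1 by blast
  then obtain m where m: "m \<ge> k" "\<sigma> m = c1" "\<forall>j<m. \<not> (j \<ge> k \<and> \<sigma> j = c1)"
    using exists_least_iff[of "\<lambda>m. m \<ge> k \<and> \<sigma> m = c1"] by blast
  have "letter_row \<sigma> a j 1 > 0 \<and> letter_row \<sigma> a j 2 > 0" if "k \<le> j" "j \<le> m" for j
    using that
  proof (induction rule: dec_induct)
    case (step j)
    then have "\<sigma> j = c2" using m(3) C[of j] by (auto simp: is_C_def)
    then show ?case using step row_nonneg[of \<sigma> j a 3] by (simp add: level_sum_c2)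
  qed (use pos in simp)
  from this[of m] m have "\<forall>b. letter_row \<sigma> a (Suc m) b > 0"
    using row_nonneg[of \<sigma> m a 3] unfolding forall_3 level_sum_c1[of \<sigma> m, OF m(2)] by simp
  then show ?thesis using m(1) by (intro exI[of _ "Suc m"]) simp
qed

lemma row_pos_23:
  assumes C: "\<And>n. is_C (\<sigma> n)" and inf2: "\<And>n. \<exists>m\<ge>n. \<sigma> m = c2"
    and pos: "letter_row \<sigma> a k 2 > 0" "letter_row \<sigma> a k 3 > 0"
  shows "\<exists>m\<ge>k. \<forall>b. letter_row \<sigma> a m b > 0"
proof -
  obtain m where "m \<ge> k" "\<sigma> m = c2" using inf2 by blast
  then obtain m where m: "m \<ge> k" "\<sigma> m = c2" "\<forall>j<m. \<not> (j \<ge> k \<and> \<sigma> j = c2)"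
    using exists_least_iff[of "\<lambda>m. m \<ge> k \<and> \<sigma> m = c2"] by blast
  have "letter_row \<sigma> a j 2 > 0 \<and> letter_row \<sigma> a j 3 > 0" if "k \<le> j" "j \<le> m" for j
    using that
  proof (induction rule: dec_induct)
    case (step j)
    then have "\<sigma> j = c1" using m(3) C[of j] by (auto simp: is_C_def)
    then show ?case using step row_nonneg[of \<sigma> j a 1] by (simp add: level_sum_c1)
  qed (use pos in simp)
  from this[of m] m have "\<forall>b. letter_row \<sigma> a (Suc m) b > 0"
    using row_nonneg[of \<sigma> m a 1] unfolding forall_3 level_sum_c2[of \<sigma> m, OF m(2)] by simp
  then show ?thesis using m(1) by (intro exI[of _ "Suc m"]) simp
qed

text \<open>The row \<open>(0, 1, 0)\<close> returns to itself under \<open>c1 c1\<close> and \<open>c2 c2\<close>. This is the only way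
  in which positivity can fail.\<close>

lemma row_2_paired:
  assumes "\<And>j. j < k \<Longrightarrow> \<sigma> (n + 2 * j) = \<sigma> (Suc (n + 2 * j))" "\<And>n. is_C (\<sigma> n)"
    and "level_sum \<sigma> n p = (\<lambda>x. of_bool (x = 2) :: int)"
  shows "level_sum \<sigma> (n + 2 * k) p = (\<lambda>x. of_bool (x = 2))"
  using assms(1)
proof (induction k)
  case (Suc k)
  let ?m = "n + 2 * k"
  have IH: "level_sum \<sigma> ?m p = (\<lambda>x. of_bool (x = 2))" using Suc by simp
  have eq: "\<sigma> ?m = \<sigma> (Suc ?m)" using Suc.prems[of k] by simp
  have "level_sum \<sigma> (Suc (Suc ?m)) p x = of_bool (x = 2)" for x
    using assms(2)[of ?m]
  proof (cases rule: is_C_cases)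
    case c1
    have "\<sigma> (Suc ?m) = c1" using eq c1 by simp
    note s = level_sum_c1[of \<sigma> "Suc ?m" p, OF this] level_sum_c1[of \<sigma> ?m p, OF c1]
    show ?thesis by (cases x rule: letter_cases) (simp_all add: s IH)
  next
    case c2
    have "\<sigma> (Suc ?m) = c2" using eq c2 by simp
    note s = level_sum_c2[of \<sigma> "Suc ?m" p, OF this] level_sum_c2[of \<sigma> ?m p, OF c2]
    show ?thesis by (cases x rule: letter_cases) (simp_all add: s IH)
  qed
  then show ?case by (simp add: fun_eq_iff)
qed (use assms(3) in simp)

lemma not_paired_infinitely_often:
  assumes "\<And>n. is_C (\<sigma> n)" "\<And>N. \<not> paired_from \<sigma> N"
  shows "\<exists>m\<ge>n. \<sigma> m = c1" "\<exists>m\<ge>n. \<sigma> m = c2"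
proof -
  have *: "\<exists>m\<ge>n. \<sigma> m \<noteq> c" for c
  proof (rule ccontr)
    assume "\<not> (\<exists>m\<ge>n. \<sigma> m \<noteq> c)"
    then have "paired_from \<sigma> n" by (simp add: paired_from_def)
    then show False using assms(2) by blast
  qed
  show "\<exists>m\<ge>n. \<sigma> m = c1" using *[of c2] assms(1) unfolding is_C_def by metis
  show "\<exists>m\<ge>n. \<sigma> m = c2" using *[of c1] assms(1) unfolding is_C_def by metis
qed

text \<open>A row reaches \<open>(0, 1, 0)\<close> or two adjacent positive entries in at most one step. From
  \<open>(0, 1, 0)\<close>, the first block that is not \<open>c1 c1\<close> or \<open>c2 c2\<close> leads to two adjacent positive
  entries as well.\<close>

lemma row_eventually_pos:
  assumes C: "\<And>n. is_C (\<sigma> n)" and np: "\<And>N. \<not> paired_from \<sigma> N"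
  shows "\<exists>m. \<forall>b. letter_row \<sigma> a m b > 0"
proof -
  note inf = not_paired_infinitely_often[OF C np]
  have from2: "\<exists>m. \<forall>b. letter_row \<sigma> a m b > 0" if r: "letter_row \<sigma> a n = (\<lambda>x. of_bool (x = 2))" for n
  proof -
    obtain j where "\<sigma> (n + 2 * j) \<noteq> \<sigma> (Suc (n + 2 * j))" using np[of n] by (auto simp: paired_from_def)
    then obtain k where k: "\<sigma> (n + 2 * k) \<noteq> \<sigma> (Suc (n + 2 * k))"
        "\<And>j. j < k \<Longrightarrow> \<sigma> (n + 2 * j) = \<sigma> (Suc (n + 2 * j))"
      using exists_least_iff[of "\<lambda>j. \<sigma> (n + 2 * j) \<noteq> \<sigma> (Suc (n + 2 * j))"] by blast
    let ?m = "n + 2 * k"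
    have r': "letter_row \<sigma> a ?m = (\<lambda>x. of_bool (x = 2))" by (rule row_2_paired[OF k(2) C r])
    show ?thesis
      using C[of ?m]
    proof (cases rule: is_C_cases)
      case c1
      then have c2: "\<sigma> (Suc ?m) = c2" using k(1) C[of "Suc ?m"] by (auto simp: is_C_def)
      have "letter_row \<sigma> a (Suc (Suc ?m)) 2 > 0" "letter_row \<sigma> a (Suc (Suc ?m)) 3 > 0"
        by (simp_all add: level_sum_c2[of \<sigma> "Suc ?m", OF c2] level_sum_c1[of \<sigma> ?m, OF c1] r')
      from row_pos_23[OF C inf(2) this] show ?thesis by blast
    next
      case c2
      then have c1: "\<sigma> (Suc ?m) = c1" using k(1) C[of "Suc ?m"] by (auto simp: is_C_def)
      have "letter_row \<sigma> a (Suc (Suc ?m)) 1 > 0" "letter_row \<sigma> a (Suc (Suc ?m)) 2 > 0"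
        by (simp_all add: level_sum_c1[of \<sigma> "Suc ?m", OF c1] level_sum_c2[of \<sigma> ?m, OF c2] r')
      from row_pos_12[OF C inf(1) this] show ?thesis by blast
    qed
  qed
  show ?thesis
  proof (cases a rule: letter_cases)
    case 1
    show ?thesis
      using C[of 0]
    proof (cases rule: is_C_cases)
      case c1
      have "letter_row \<sigma> a (Suc 0) 1 > 0" "letter_row \<sigma> a (Suc 0) 2 > 0"
        by (simp_all add: level_sum_c1[of \<sigma> 0, OF c1] 1)
      from row_pos_12[OF C inf(1) this] show ?thesis by blast
    next
      case c2
      have "letter_row \<sigma> a (Suc 0) x = of_bool (x = 2)" for x
        by (cases x rule: letter_cases) (simp_all add: level_sum_c2[of \<sigma> 0, OF c2] 1)
      then show ?thesis by (intro from2[of "Suc 0"]) (simp add: fun_eq_iff)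
    qed
  next
    case 2
    show ?thesis by (rule from2[of 0]) (simp add: 2)
  next
    case 3
    show ?thesis
      using C[of 0]
    proof (cases rule: is_C_cases)
      case c1
      have "letter_row \<sigma> a (Suc 0) x = of_bool (x = 2)" for x
        by (cases x rule: letter_cases) (simp_all add: level_sum_c1[of \<sigma> 0, OF c1] 3)
      then show ?thesis by (intro from2[of "Suc 0"]) (simp add: fun_eq_iff)
    next
      case c2
      have "letter_row \<sigma> a (Suc 0) 2 > 0" "letter_row \<sigma> a (Suc 0) 3 > 0"
        by (simp_all add: level_sum_c2[of \<sigma> 0, OF c2] 3)
      from row_pos_23[OF C inf(2) this] show ?thesis by blast
    qed
  qed
qed

lemma spreading_iff_not_paired:
  assumes C: "\<And>n. is_C (\<sigma> n)"
  shows "spreading \<sigma> \<longleftrightarrow> (\<forall>N. \<not> paired_from \<sigma> N)"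
proof
  assume sp: "spreading \<sigma>"
  show "\<forall>N. \<not> paired_from \<sigma> N"
  proof (intro allI notI)
    fix N assume p: "paired_from \<sigma> N"
    let ?\<sigma> = "\<lambda>j. \<sigma> (N + j)"
    obtain k where k: "k > 0" "\<And>a b. a \<in> set (directive_word ?\<sigma> k [b])"
      using sp unfolding spreading_def by blast
    then have pos: "letter_row ?\<sigma> 2 k b > 0" for b by (simp add: row_pos)
    have row2: "letter_row ?\<sigma> 2 (0 + 2 * j) = (\<lambda>x. of_bool (x = 2))" for j
      using p C by (intro row_2_paired) (auto simp: paired_from_def)
    show False
    proof (cases "even k")
      case True
      then obtain j where "k = 2 * j" by blast
      then show False using row2[of j] pos[of 1] by simp
    next
      case False
      then obtain j where j: "k = Suc (2 * j)" using oddE by fastforce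
      show False
        using C[of "N + 2 * j"]
      proof (cases rule: is_C_cases)
        case c1
        then have "letter_row ?\<sigma> 2 k 1 = 0" using row2[of j] by (simp add: j level_sum_c1[of ?\<sigma> "2 * j"])
        then show False using pos[of 1] by simp
      next
        case c2
        then have "letter_row ?\<sigma> 2 k 3 = 0" using row2[of j] by (simp add: j level_sum_c2[of ?\<sigma> "2 * j"])
        then show False using pos[of 3] by simp
      qed
    qed
  qed
next
  assume np: "\<forall>N. \<not> paired_from \<sigma> N"
  show "spreading \<sigma>"
    unfolding spreading_def
  proof
    fix r
    let ?\<sigma> = "\<lambda>j. \<sigma> (r + j)"
    have "\<not> paired_from ?\<sigma> N" for N
      using np[rule_format, of "r + N"] by (simp add: paired_from_def add.assoc)
    then have "\<exists>m. \<forall>b. letter_row ?\<sigma> a m b > 0" for a using C by (intro row_eventually_pos)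
    then obtain m where m: "\<And>a. \<forall>b. letter_row ?\<sigma> a (m a) b > 0" by metis
    define k where "k = Suc (m 1 + m 2 + m 3)"
    have "m a \<le> k" for a by (cases a rule: letter_cases) (simp_all add: k_def)
    then have "\<forall>b. letter_row ?\<sigma> a k b > 0" for a using row_pos_mono[OF _ m] C by blast
    then show "\<exists>k>0. \<forall>a b. a \<in> set (directive_word ?\<sigma> k [b])"
      by (intro exI[of _ k]) (auto simp: row_pos k_def)
  qed
qed

lemma count_list_app: "count_list (app c (u :: 3 list)) (a::3) = (\<Sum>b\<in>UNIV. count_list (c b) a * count_list u b)"
proof (induction u)
  case (Cons x u)
  have "(\<Sum>b\<in>UNIV. count_list (c b) a * count_list (x # u) b)
      = (\<Sum>b\<in>UNIV. (if b = x then count_list (c b) a else 0) + count_list (c b) a * count_list u b)"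
    by (intro sum.cong) auto
  also have "\<dots> = count_list (c x) a + (\<Sum>b\<in>UNIV. count_list (c b) a * count_list u b)"
    using sum.delta[of UNIV x "\<lambda>b. count_list (c b) a"] by (simp add: sum.distrib)
  finally show ?case using Cons by simp
qed simp

lemma incidence_matrix_product:
  fixes \<sigma> :: "nat \<Rightarrow> 3 \<Rightarrow> 3 list"
  shows "foldr (**) (map (\<lambda>n. incidence_matrix (\<sigma> n)) [r..<r + k]) (mat 1) $ a $ b
    = real (count_list (directive_word (\<lambda>j. \<sigma> (r + j)) k [b]) a)"
proof (induction k arbitrary: r a b)
  case 0
  show ?case by (simp add: mat_def)
next
  case (Suc k)
  define rest where
    "rest = foldr (**) (map (\<lambda>n. incidence_matrix (\<sigma> n)) [Suc r..<Suc r + k]) (mat 1)"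
  have "[r..<r + Suc k] = r # [Suc r..<Suc r + k]"
    by (simp add: upt_conv_Cons del: upt_Suc)
  then have "foldr (**) (map (\<lambda>n. incidence_matrix (\<sigma> n)) [r..<r + Suc k]) (mat 1)
      = incidence_matrix (\<sigma> r) ** rest"
    by (simp only: rest_def list.map foldr.simps comp_apply)
  moreover have "rest $ x $ b = real (count_list (directive_word (\<lambda>j. \<sigma> (Suc r + j)) k [b]) x)" for x
    unfolding rest_def by (rule Suc.IH)
  ultimately have "foldr (**) (map (\<lambda>n. incidence_matrix (\<sigma> n)) [r..<r + Suc k]) (mat 1) $ a $ b
      = (\<Sum>x\<in>UNIV. real (count_list (\<sigma> r x) a)
          * real (count_list (directive_word (\<lambda>j. \<sigma> (Suc r + j)) k [b]) x))"
    by (simp add: matrix_matrix_mult_def incidence_matrix_def)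
  also have "\<dots> = real (count_list (app (\<sigma> r) (directive_word (\<lambda>j. \<sigma> (Suc r + j)) k [b])) a)"
    by (simp add: count_list_app)
  finally show ?case by (simp add: directive_word_Suc)
qed

lemma primitive_seq_iff_spreading:
  "primitive_seq (\<lambda>n. incidence_matrix (\<sigma> n)) \<longleftrightarrow> spreading \<sigma>"
proof -
  have "(\<exists>s>r. \<forall>a b. foldr (**) (map (\<lambda>n. incidence_matrix (\<sigma> n)) [r..<s]) (mat 1) $ a $ b > 0)
      \<longleftrightarrow> (\<exists>k>0. \<forall>a b. a \<in> set (directive_word (\<lambda>j. \<sigma> (r + j)) k [b]))" for r
  proof -
    have "(\<exists>s>r. P s) \<longleftrightarrow> (\<exists>k>0. P (r + k))" for P :: "nat \<Rightarrow> bool"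
      by (metis less_add_same_cancel1 less_imp_add_positive)
    then show ?thesis by (simp add: incidence_matrix_product count_list_pos)
  qed
  moreover have "incidence_matrix (\<sigma> n) $ a $ b \<ge> 0" for n a b
    by (simp add: incidence_matrix_def)
  ultimately show ?thesis unfolding primitive_seq_def spreading_def by blast
qed

text \<open>A paired sequence fixes the row \<open>(0, 1, 0)\<close>, and the inverse incidence matrices are
  integral; so the frequency 0 of the letter 2 at the level where the pairing begins is an
  integral relation for the word.\<close>

lemma level_sum_surj:
  fixes q :: "3 \<Rightarrow> int"
  assumes "\<And>n. is_C (\<sigma> n)"
  shows "\<exists>p. level_sum \<sigma> n p = q"
proof (induction n arbitrary: q)
  case (Suc n)
  show ?case
    using assms(1)[of n]
  proof (cases rule: is_C_cases)
    case c1
    obtain p where p: "level_sum \<sigma> n p = (\<lambda>a. if a = 1 then q 1 else if a = 2 then q 3 else q 2 - q 1)"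
      using Suc by blast
    have "level_sum \<sigma> (Suc n) p a = q a" for a
      by (cases a rule: letter_cases) (simp_all add: level_sum_c1[of \<sigma> n, OF c1] p)
    then show ?thesis by blast
  next
    case c2
    obtain p where p: "level_sum \<sigma> n p = (\<lambda>a. if a = 1 then q 2 - q 3 else if a = 2 then q 1 else q 3)"
      using Suc by blast
    have "level_sum \<sigma> (Suc n) p a = q a" for a
      by (cases a rule: letter_cases) (simp_all add: level_sum_c2[of \<sigma> n, OF c2] p)
    then show ?thesis by blast
  qed
qed auto

lemma level_sum_1_pos:
  assumes "\<And>n. is_C (\<sigma> n)"
  shows "level_sum \<sigma> m (\<lambda>_. 1 :: int) b \<ge> 1"
proof (induction m arbitrary: b)
  case (Suc m)
  show ?case
    using assms(1)[of m]
  proof (cases rule: is_C_cases)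
    case c1
    then show ?thesis using Suc[of 1] Suc[of 2] Suc[of 3]
      by (cases b rule: letter_cases) (simp_all add: level_sum_c1[of \<sigma> m])
  next
    case c2
    then show ?thesis using Suc[of 1] Suc[of 2] Suc[of 3]
      by (cases b rule: letter_cases) (simp_all add: level_sum_c2[of \<sigma> m])
  qed
qed simp

text \<open>Each pair of substitutions adds the length of the image of the letter 1 or 3.\<close>

lemma length_2_paired:
  assumes "paired_from \<sigma> n" "\<And>n. is_C (\<sigma> n)"
  shows "level_sum \<sigma> (n + 2 * k) (\<lambda>_. 1 :: int) 2 \<ge> int k + 1"
proof (induction k)
  case 0
  show ?case using level_sum_1_pos[of \<sigma> n 2, OF assms(2)] by simp
next
  case (Suc k)
  let ?m = "n + 2 * k"
  have ge1: "level_sum \<sigma> ?m (\<lambda>_. 1 :: int) b \<ge> 1" for b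
    using level_sum_1_pos[of \<sigma> ?m b, OF assms(2)] .
  have eq: "\<sigma> ?m = \<sigma> (Suc ?m)" using assms(1) by (simp add: paired_from_def)
  show ?case
    using assms(2)[of ?m]
  proof (cases rule: is_C_cases)
    case c1
    then have "\<sigma> (Suc ?m) = c1" using eq by simp
    then show ?thesis using Suc ge1[of 1] c1 level_sum_c1[of \<sigma> ?m "\<lambda>_. 1 :: int"]
        level_sum_c1[of \<sigma> "Suc ?m" "\<lambda>_. 1 :: int"] by simp
  next
    case c2
    then have "\<sigma> (Suc ?m) = c2" using eq by simp
    then show ?thesis using Suc ge1[of 3] c2 level_sum_c2[of \<sigma> ?m "\<lambda>_. 1 :: int"]
        level_sum_c2[of \<sigma> "Suc ?m" "\<lambda>_. 1 :: int"] by simp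
  qed
qed

lemma paired_relation:
  assumes t: "tower \<sigma> W" and p: "paired_from \<sigma> N"
  shows "\<exists>p :: 3 \<Rightarrow> int. (\<exists>a. p a \<noteq> 0) \<and> mean (\<lambda>a. of_int (p a)) (W 0) \<longlonglongrightarrow> 0"
proof -
  note C = tower_is_C[OF t]
  obtain q :: "3 \<Rightarrow> int" where q: "level_sum \<sigma> N q = (\<lambda>x. of_bool (x = 2))"
    using level_sum_surj[of \<sigma>, OF C] by blast
  have q0: "\<exists>a. q a \<noteq> 0"
  proof (rule ccontr)
    assume "\<not> ?thesis"
    then have "q = (\<lambda>_. 0)" by auto
    then have "level_sum \<sigma> N q 2 = 0" by (simp add: level_sum_def wsum_def)
    then show False using q by simp
  qed
  have row: "level_sum \<sigma> (N + 2 * k) q = (\<lambda>x. of_bool (x = 2))" for k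
    using p by (intro row_2_paired[OF _ C q]) (simp add: paired_from_def)
  have upper: "level_sum \<sigma> (N + 2 * k) (\<lambda>a. of_int (q a) - 1 / (real k + 1)) b \<le> 0" for k b
  proof -
    have len: "level_sum \<sigma> (N + 2 * k) (\<lambda>_. 1 :: real) b = real (length (directive_word \<sigma> (N + 2 * k) [b]))"
      by (simp add: level_sum_const)
    have "level_sum \<sigma> (N + 2 * k) (\<lambda>a. of_int (q a) - 1 / (real k + 1)) b
        = of_bool (b = 2) - 1 / (real k + 1) * real (length (directive_word \<sigma> (N + 2 * k) [b]))"
      using level_sum_diff[of \<sigma> "N + 2 * k" "\<lambda>a. of_int (q a)" "1 / (real k + 1)" "\<lambda>_. 1" b]
        level_sum_of_int[of \<sigma> "N + 2 * k" q b, where ?'a = real] row[of k]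
      by (simp add: level_sum_const)
    moreover have "real (length (directive_word \<sigma> (N + 2 * k) [2])) \<ge> real k + 1"
      using length_2_paired[OF p C, of k] by (simp add: level_sum_const)
    then have "1 / (real k + 1) * real (length (directive_word \<sigma> (N + 2 * k) [2]))
        \<ge> 1 / (real k + 1) * (real k + 1)" by (intro mult_left_mono) auto
    then have "1 / (real k + 1) * real (length (directive_word \<sigma> (N + 2 * k) [2])) \<ge> 1" by simp
    moreover have "1 / (real k + 1) * real (length (directive_word \<sigma> (N + 2 * k) [b])) \<ge> 0" by simp
    ultimately show ?thesis by (cases "b = 2") simp_all
  qed
  have "mean (\<lambda>a. of_int (q a)) (W 0) \<longlonglongrightarrow> 0"
    unfolding tendsto_iff dist_real_def
  proof (intro allI impI)
    fix e :: real assume e: "e > 0"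
    obtain k :: nat where k: "1 / (real k + 1) < e / 2"
      using e by (metis half_gt_zero nat_approx_posE of_nat_Suc add.commute)
    have "\<forall>\<^sub>F m in sequentially. mean (\<lambda>a. of_int (q a)) (W 0) m < 1 / (real k + 1) + e / 2"
      using e by (intro mean_upper[OF t upper]) auto
    moreover have "level_sum \<sigma> N (\<lambda>a. of_int (q a) - 0 :: real) b \<ge> 0" for b
      using level_sum_of_int[of \<sigma> N q b, where ?'a = real] q by simp
    then have "\<forall>\<^sub>F m in sequentially. mean (\<lambda>a. of_int (q a)) (W 0) m > 0 - e"
      using e by (intro mean_lower[OF t]) auto
    ultimately show "\<forall>\<^sub>F m in sequentially. \<bar>mean (\<lambda>a. of_int (q a)) (W 0) m - 0\<bar> < e"
      by eventually_elim (use k in auto)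
  qed
  then show ?thesis using q0 by blast
qed

text \<open>Clearing denominators, rational relations are integral ones.\<close>

lemma rationally_independent_iff:
  assumes t: "tower \<sigma> W"
  shows "frequencies_rationally_independent (W 0) \<longleftrightarrow>
    (\<forall>p :: 3 \<Rightarrow> int. mean (\<lambda>a. of_int (p a)) (W 0) \<longlonglongrightarrow> 0 \<longrightarrow> (\<forall>a. p a = 0))"
    (is "_ \<longleftrightarrow> ?R")
proof -
  let ?f = "letter_frequency (W 0)"
  have lim: "mean l (W 0) \<longlonglongrightarrow> 0 \<longleftrightarrow> (\<Sum>a\<in>UNIV. l a * ?f a) = 0" for l
    using mean_tendsto[OF t, of l] LIMSEQ_unique by metis
  show ?thesis
  proof
    assume ind: "frequencies_rationally_independent (W 0)"
    show ?R
    proof (intro allI impI)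
      fix p :: "3 \<Rightarrow> int" and a
      assume "mean (\<lambda>a. of_int (p a)) (W 0) \<longlonglongrightarrow> 0"
      then have "(\<Sum>a\<in>UNIV. of_rat (of_int (p a)) * ?f a) = 0" by (simp add: lim)
      then have "\<forall>a. (of_int (p a) :: rat) = 0"
        using ind unfolding frequencies_rationally_independent_def
        by (elim conjE allE[of _ "\<lambda>a. of_int (p a)"]) simp
      then show "p a = 0" by simp
    qed
  next
    assume R: ?R
    have "\<forall>a. q a = 0" if q: "(\<Sum>a\<in>UNIV. of_rat (q a) * ?f a) = 0" for q :: "3 \<Rightarrow> rat"
    proof -
      define d where "d a = snd (quotient_of (q a))" for a
      have d: "d a > 0" for a by (simp add: d_def quotient_of_denom_pos')
      define D where "D = (\<Prod>a\<in>UNIV. d a)"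
      have D: "D > 0" unfolding D_def using d by (intro prod_pos) auto
      define p where "p a = fst (quotient_of (q a)) * (\<Prod>b\<in>UNIV - {a}. d b)" for a
      have "of_int (p a) = of_int D * q a" for a
      proof -
        have "q a = of_int (fst (quotient_of (q a))) / of_int (d a)"
          by (metis d_def quotient_of_div surjective_pairing)
        then have "of_int (d a) * q a = of_int (d a) * (of_int (fst (quotient_of (q a))) / of_int (d a))"
          by (rule arg_cong)
        also have "\<dots> = of_int (fst (quotient_of (q a)))" using d[of a] by simp
        finally have "of_int (d a) * q a = of_int (fst (quotient_of (q a)))" .
        moreover have "D = d a * (\<Prod>b\<in>UNIV - {a}. d b)" unfolding D_def by (rule prod.remove) auto
        ultimately show ?thesis by (simp add: p_def algebra_simps)
      qed
      then have p: "real_of_int (p a) = of_int D * of_rat (q a)" for a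
        by (metis of_rat_mult of_rat_of_int_eq)
      have "(\<Sum>a\<in>UNIV. real_of_int (p a) * ?f a) = of_int D * (\<Sum>a\<in>UNIV. of_rat (q a) * ?f a)"
        unfolding p sum_distrib_left by (simp add: mult.assoc)
      then have "\<forall>a. p a = 0" using R q lim by simp
      then show ?thesis using p D by (metis mult_eq_0_iff of_int_0 of_int_eq_0_iff of_rat_eq_0_iff less_irrefl)
    qed
    then show "frequencies_rationally_independent (W 0)"
      unfolding frequencies_rationally_independent_def using letter_ratio_tendsto(1)[OF t] by blast
  qed
qed

theorem rationally_independent_iff_spreading:
  assumes t: "tower \<sigma> W"
  shows "frequencies_rationally_independent (W 0) \<longleftrightarrow> spreading \<sigma>"
proof
  assume "spreading \<sigma>"
  then have "\<And>N. \<not> paired_from \<sigma> N" using spreading_iff_not_paired tower_is_C[OF t] by blast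
  note inf = not_paired_infinitely_often[OF tower_is_C[OF t] this]
  show "frequencies_rationally_independent (W 0)"
    unfolding rationally_independent_iff[OF t]
    using no_integer_relation[OF t \<open>spreading \<sigma>\<close> inf] by blast
next
  assume "frequencies_rationally_independent (W 0)"
  then have "\<not> paired_from \<sigma> N" for N
    using paired_relation[OF t] unfolding rationally_independent_iff[OF t] by blast
  then show "spreading \<sigma>" using spreading_iff_not_paired tower_is_C[OF t] by blast
qed

section \<open>Recurrence\<close>

definition syndetic :: "(nat \<Rightarrow> 'a) \<Rightarrow> bool" where
  "syndetic w \<longleftrightarrow> (\<forall>u\<in>language w. \<exists>H. \<forall>q. \<exists>k\<ge>q. k \<le> q + H \<and> occurs_at w u k)"

lemma syndetic_uniformly_recurrent:
  assumes "syndetic w"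
  shows "uniformly_recurrent w"
  unfolding uniformly_recurrent_def
proof
  fix u assume "u \<in> language w"
  then obtain H where H: "\<And>q. \<exists>k\<ge>q. k \<le> q + H \<and> occurs_at w u k"
    using assms unfolding syndetic_def by blast
  have "infinite {k. occurs_at w u k}"
    unfolding infinite_nat_iff_unbounded_le using H by blast
  moreover have "l - k \<le> Suc H"
    if "k < l" "\<forall>j. k < j \<and> j < l \<longrightarrow> \<not> occurs_at w u j" for k l
  proof -
    obtain j where "j \<ge> Suc k" "j \<le> Suc k + H" "occurs_at w u j" using H by blast
    then have "\<not> j < l" using that(2) by auto
    then show ?thesis using \<open>j \<le> Suc k + H\<close> by simp
  qed
  ultimately show "infinite {k. occurs_at w u k} \<and>
      (\<exists>N. \<forall>k l. occurs_at w u k \<and> occurs_at w u l \<and> k < l \<and>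
        (\<forall>j. k < j \<and> j < l \<longrightarrow> \<not> occurs_at w u j) \<longrightarrow> l - k \<le> N)"
    by blast
qed

lemma uniformly_recurrent_biextendable:
  assumes "uniformly_recurrent w"
  shows "biextendable (language w)"
  unfolding biextendable_def
proof
  fix u assume u: "u \<in> language w"
  then have "infinite {k. occurs_at w u k}" using assms by (simp add: uniformly_recurrent_def)
  then obtain k where k: "k \<ge> 1" "occurs_at w u k"
    unfolding infinite_nat_iff_unbounded_le by blast
  have "map w [k - 1..<k + length u] = w (k - 1) # u"
    using k by (simp add: occurs_at_def upt_conv_Cons)
  then have "w (k - 1) # u \<in> language w"
    using in_language_map[of w "k - 1" "Suc (length u)"] k(1) by simp
  then show "(\<exists>a. a # u \<in> language w) \<and> (\<exists>b. u @ [b] \<in> language w)"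
    using language_right_extendable[OF u] by blast
qed

text \<open>If at some level the images of all letters contain \<open>u\<close>, then so does every window that
  covers the image of a letter.\<close>

lemma syndetic_from_images:
  assumes t: "tower \<sigma> W"
    and sub: "\<And>u. u \<in> language (W 0) \<Longrightarrow> \<exists>m. \<forall>b. sublist u (directive_word \<sigma> m [b])"
  shows "syndetic (W 0)"
  unfolding syndetic_def
proof
  fix u assume "u \<in> language (W 0)"
  then obtain m where m: "\<And>b. sublist u (directive_word \<sigma> m [b])" using sub by blast
  let ?\<tau> = "level_image \<sigma> m" and ?x = "W m"
  define H where "H = Max (range (\<lambda>b. length (?\<tau> b)))"
  have H: "length (?\<tau> b) \<le> H" for b unfolding H_def by (rule Max_ge) auto
  note ne = tower_nonerasing[OF t, of m]
  \<comment> \<open>one image to reach the next cut, and another one to contain the occurrence\<close>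
  have "\<exists>k\<ge>q. k \<le> q + (H + H) \<and> occurs_at (W 0) u k" for q
  proof -
    obtain j where j: "cut_pos ?\<tau> ?x j \<le> q" "q < cut_pos ?\<tau> ?x (Suc j)"
      using cut_pos_between[OF ne] by blast
    obtain p s where ps: "?\<tau> (?x (Suc j)) = p @ u @ s" using m[of "?x (Suc j)"] by (auto simp: sublist_def)
    have "prefix_of (W 0) (cut_pos ?\<tau> ?x (Suc (Suc j))) = app ?\<tau> (prefix_of ?x (Suc (Suc j)))"
      using img_prefix[OF ne, of ?x "Suc (Suc j)"] tower_level[OF t, of m] by simp
    also have "\<dots> = (app ?\<tau> (prefix_of ?x (Suc j)) @ p) @ u @ s" using ps by simp
    finally have "occurs_at (W 0) u (cut_pos ?\<tau> ?x (Suc j) + length p)"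
      using occurs_at_prefix[of "W 0" _ "app ?\<tau> (prefix_of ?x (Suc j)) @ p" u s]
      by (simp add: cut_pos_def add.assoc)
    moreover have "length p \<le> H" using H[of "?x (Suc j)"] ps by simp
    moreover have "cut_pos ?\<tau> ?x (Suc j) \<le> q + H" using j H[of "?x j"] by (simp add: cut_pos_Suc)
    ultimately show ?thesis using j(2)
      by (intro exI[of _ "cut_pos ?\<tau> ?x (Suc j) + length p"]) auto
  qed
  then show "\<exists>H. \<forall>q. \<exists>k\<ge>q. k \<le> q + H \<and> occurs_at (W 0) u k" by blast
qed

lemma sublist_directive_word:
  fixes \<sigma> :: "nat \<Rightarrow> 3 \<Rightarrow> 3 list"
  assumes "a \<in> set (directive_word (\<lambda>k. \<sigma> (n + k)) m [b])"
  shows "sublist (directive_word \<sigma> n [a]) (directive_word \<sigma> (n + m) [b])"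
proof -
  obtain p s where "directive_word (\<lambda>k. \<sigma> (n + k)) m [b] = p @ [a] @ s"
    using split_list[OF assms] by auto
  then have "sublist [a] (directive_word (\<lambda>k. \<sigma> (n + k)) m [b])"
    using sublist_appendI[of "[a]" p s] by simp
  then have "sublist (app (level_image \<sigma> n) [a])
      (app (level_image \<sigma> n) (directive_word (\<lambda>k. \<sigma> (n + k)) m [b]))"
    by (rule sublist_app)
  then show ?thesis
    unfolding directive_word_add directive_word_conv_app[symmetric] .
qed

lemma spreading_shift: "spreading \<sigma> \<Longrightarrow> spreading (\<lambda>k. \<sigma> (n + k))"
  unfolding spreading_def
proof
  fix r
  assume "\<forall>r. \<exists>k>0. \<forall>a b. a \<in> set (directive_word (\<lambda>j. \<sigma> (r + j)) k [b])"
  from spec[OF this, of "n + r"]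
  show "\<exists>k>0. \<forall>a b. a \<in> set (directive_word (\<lambda>j. \<sigma> (n + (r + j))) k [b])"
    by (simp add: add.assoc)
qed

lemma infinitely_often_shift:
  assumes "\<And>n::nat. \<exists>m\<ge>n. P m"
  shows "\<exists>m\<ge>n. P (k + m)"
proof -
  obtain m where "m \<ge> k + n" "P m" using assms by blast
  then show ?thesis by (intro exI[of _ "m - k"]) simp
qed

lemma spreading_syndetic:
  assumes t: "tower \<sigma> W" and sp: "spreading \<sigma>"
  shows "syndetic (W 0)"
proof (rule syndetic_from_images[OF t])
  fix u assume "u \<in> language (W 0)"
  then obtain N where N: "sublist u (prefix_of (W 0) N)" by (auto simp: language_iff_prefix)
  have "C_adic (W 0) \<sigma>" using tower_C_adic[OF t, of 0] by simp
  then obtain a where "words_tendsto (\<lambda>n. directive_word \<sigma> n [a n]) (W 0)"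
    by (auto simp: C_adic_def)
  then obtain n where "take N (directive_word \<sigma> n [a n]) = prefix_of (W 0) N"
    unfolding words_tendsto_def eventually_sequentially by blast
  then have u: "sublist u (directive_word \<sigma> n [a n])"
    using N sublist_take sublist_order.order.trans by metis
  obtain k where "\<And>a b. a \<in> set (directive_word (\<lambda>j. \<sigma> (n + j)) k [b])"
    using sp unfolding spreading_def by blast
  then have "sublist u (directive_word \<sigma> (n + k) [b])" for b
    by (intro sublist_order.order.trans[OF u] sublist_directive_word)
  then show "\<exists>m. \<forall>b. sublist u (directive_word \<sigma> m [b])" by blast
qed

section \<open>Non-primitive directive sequences\<close>

lemma tower_hd: "tower \<sigma> W \<Longrightarrow> W n 0 = hd (\<sigma> n (W (Suc n) 0))"
  using img_0[OF nonerasing_C[OF tower_is_C]] tower_img by metis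

lemma paired_from_shift:
  assumes "paired_from \<sigma> N" "n \<ge> N" "even (n - N)"
  shows "paired_from (\<lambda>k. \<sigma> (n + k)) 0"
proof -
  obtain j where "n - N = 2 * j" using assms(3) by blast
  then have n: "n = N + 2 * j" using assms(2) by simp
  have "\<sigma> (N + 2 * (j + k)) = \<sigma> (Suc (N + 2 * (j + k)))" for k
    using assms(1) by (simp only: paired_from_def)
  then show ?thesis by (simp add: paired_from_def n algebra_simps)
qed

text \<open>In a paired sequence with infinitely many blocks \<open>c1 c1\<close> every word at an even distance
  begins with 1, because the images under \<open>c1 c1\<close> do, and \<open>c2 c2\<close> preserves first letters.\<close>

lemma paired_first_letter:
  assumes t: "tower \<sigma> W" and p: "paired_from \<sigma> 0" and inf1: "\<And>n. \<exists>m\<ge>n. \<sigma> m = c1"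
  shows "W 0 0 = 1"
proof -
  obtain m where m: "\<sigma> m = c1" using inf1 by blast
  have "\<exists>j. \<sigma> (2 * j) = c1"
  proof (cases "even m")
    case True
    then show ?thesis using m by (metis evenE)
  next
    case False
    then obtain j where "m = Suc (2 * j)" using oddE by fastforce
    then show ?thesis using m p by (metis paired_from_def add_0)
  qed
  then obtain j where j: "\<sigma> (2 * j) = c1" "\<And>k. k < j \<Longrightarrow> \<sigma> (2 * k) \<noteq> c1"
    using exists_least_iff[of "\<lambda>j. \<sigma> (2 * j) = c1"] by blast
  have pair: "\<sigma> (Suc (2 * k)) = \<sigma> (2 * k)" for k using p by (simp add: paired_from_def)
  have hd2: "W (2 * k) 0 = hd (\<sigma> (2 * k) (hd (\<sigma> (2 * k) (W (2 * Suc k) 0))))" for k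
    using tower_hd[OF t, of "2 * k"] tower_hd[OF t, of "Suc (2 * k)"] pair[of k] by simp
  have "W (2 * k) 0 = 1" if "k \<le> j" for k
    using that
  proof (induction rule: inc_induct)
    case base
    show ?case using hd2[of j] j(1)
      by (cases "W (2 * Suc j) 0" rule: letter_cases) simp_all
  next
    case (step k)
    then have "\<sigma> (2 * k) = c2" using j(2)[of k] tower_is_C[OF t, of "2 * k"] by (auto simp: is_C_def)
    then show ?case using hd2[of k] step by (simp add: c2_letters)
  qed
  from this[of 0] show ?thesis by simp
qed

lemma paired_step_1:
  fixes l :: "3 \<Rightarrow> int"
  assumes "paired_from \<sigma> 0" "\<And>n. is_C (\<sigma> n)"
  shows "level_sum \<sigma> (2 * Suc k) l 1 = level_sum \<sigma> (2 * k) l 1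
    + (if \<sigma> (2 * k) = c2 then level_sum \<sigma> (2 * k) l 3 else 0)"
proof -
  have eq: "\<sigma> (Suc (2 * k)) = \<sigma> (2 * k)" using assms(1) by (simp add: paired_from_def)
  show ?thesis
    using assms(2)[of "2 * k"]
  proof (cases rule: is_C_cases)
    case c1
    then show ?thesis using eq c1_neq_c2
      by (simp add: level_sum_c1[of \<sigma> "2 * k"] level_sum_c1[of \<sigma> "Suc (2 * k)"])
  next
    case c2
    then show ?thesis using eq
      by (simp add: level_sum_c2[of \<sigma> "2 * k"] level_sum_c2[of \<sigma> "Suc (2 * k)"])
  qed
qed

lemma paired_even_index:
  assumes "paired_from \<sigma> 0" "\<And>n. \<exists>m\<ge>n. \<sigma> m = c"
  shows "\<exists>k\<ge>n. \<sigma> (2 * k) = c"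
proof -
  obtain m where m: "m \<ge> Suc (2 * n)" "\<sigma> m = c" using assms(2) by blast
  show ?thesis
  proof (cases "even m")
    case True
    then obtain j where "m = 2 * j" by blast
    then show ?thesis using m by (intro exI[of _ j]) auto
  next
    case False
    then obtain j where j: "m = Suc (2 * j)" using oddE by fastforce
    then have "\<sigma> (2 * j) = c" using m(2) assms(1) by (simp add: paired_from_def)
    then show ?thesis using m(1) j by (intro exI[of _ j]) auto
  qed
qed

lemma paired_length_1_unbounded:
  assumes p: "paired_from \<sigma> 0" and C: "\<And>n. is_C (\<sigma> n)" and inf2: "\<And>n. \<exists>m\<ge>n. \<sigma> m = c2"
  shows "\<exists>k. length (directive_word \<sigma> (2 * k) [1]) \<ge> B"
proof -
  let ?h = "\<lambda>k. level_sum \<sigma> (2 * k) (\<lambda>_. 1 :: int) 1"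
  have mono1: "?h k \<le> ?h (Suc k)" for k
    using paired_step_1[OF p C, of k "\<lambda>_. 1"] level_sum_1_pos[of \<sigma> "2 * k" 3, OF C] by auto
  have mono: "?h j \<le> ?h k" if "j \<le> k" for j k using mono1 that by (rule lift_Suc_mono_le)
  have "\<exists>k. ?h k \<ge> int B"
  proof (induction B)
    case (Suc B)
    then obtain j where j: "?h j \<ge> int B" by blast
    obtain k where k: "k \<ge> j" "\<sigma> (2 * k) = c2" using paired_even_index[OF p inf2] by blast
    have "?h (Suc k) \<ge> int (Suc B)"
      using paired_step_1[OF p C, of k "\<lambda>_. 1"] level_sum_1_pos[of \<sigma> "2 * k" 3, OF C] k(2) j mono[OF k(1)]
      by simp
    then show ?case by blast
  qed (auto intro: exI[of _ 0])
  then show ?thesis by (simp add: level_sum_const)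
qed

text \<open>In particular the images of the letter 1 are prefixes of unbounded length.\<close>

lemma paired_prefix:
  assumes t: "tower \<sigma> W" and p: "paired_from \<sigma> 0"
    and inf1: "\<And>n. \<exists>m\<ge>n. \<sigma> m = c1" and inf2: "\<And>n. \<exists>m\<ge>n. \<sigma> m = c2"
  shows "\<exists>k s. directive_word \<sigma> (2 * k) [1] = prefix_of (W 0) B @ s"
proof -
  note C = tower_is_C[OF t]
  obtain k where k: "length (directive_word \<sigma> (2 * k) [1]) \<ge> B"
    using paired_length_1_unbounded[of \<sigma>, OF p C inf2] by blast
  let ?\<tau> = "level_image \<sigma> (2 * k)"
  have "W (2 * k) 0 = 1"
  proof -
    have "paired_from (\<lambda>j. \<sigma> (2 * k + j)) 0"
      by (rule paired_from_shift[OF p]) simp_all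
    moreover have "\<exists>m\<ge>n. \<sigma> (2 * k + m) = c1" for n
      using inf1 by (rule infinitely_often_shift)
    ultimately show ?thesis
      using paired_first_letter[OF tower_shift[OF t, of "2 * k"]] by simp
  qed
  then have "prefix_of (W 0) (cut_pos ?\<tau> (W (2 * k)) 1) = directive_word \<sigma> (2 * k) [1]"
    using img_prefix[OF tower_nonerasing[OF t], of "2 * k" "W (2 * k)" 1] tower_level[OF t, of "2 * k"]
    by simp
  moreover from this have "cut_pos ?\<tau> (W (2 * k)) 1 = B + (cut_pos ?\<tau> (W (2 * k)) 1 - B)"
    using k by (metis le_add_diff_inverse length_map length_upt minus_nat.diff_0)
  ultimately show ?thesis using prefix_of_add by metis
qed

lemma paired_syndetic:
  assumes t: "tower \<sigma> W" and p: "paired_from \<sigma> 0"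
    and inf1: "\<And>n. \<exists>m\<ge>n. \<sigma> m = c1" and inf2: "\<And>n. \<exists>m\<ge>n. \<sigma> m = c2"
  shows "syndetic (W 0)"
proof (rule syndetic_from_images[OF t])
  note C = tower_is_C[OF t]
  fix u assume "u \<in> language (W 0)"
  then obtain N where N: "sublist u (prefix_of (W 0) N)" by (auto simp: language_iff_prefix)
  obtain k s where "directive_word \<sigma> (2 * k) [1] = prefix_of (W 0) N @ s"
    using paired_prefix[OF t p inf1 inf2] by blast
  then have u: "sublist u (directive_word \<sigma> (2 * k) [1])"
    using N by (metis sublist_append_rightI sublist_order.order.trans)
  let ?\<sigma> = "\<lambda>j. \<sigma> (2 * k + j)"
  have p': "paired_from ?\<sigma> 0"
    by (rule paired_from_shift[OF p]) simp_all
  have C': "is_C (?\<sigma> n)" for n by (rule C)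
  have "\<exists>m\<ge>n. ?\<sigma> m = c1" for n
    using inf1 by (rule infinitely_often_shift)
  then obtain j where j: "?\<sigma> (2 * j) = c1" using paired_even_index[OF p', of c1] by blast
  have "letter_row ?\<sigma> 1 (2 * i) 1 \<ge> 1" for i
  proof (induction i)
    case (Suc i)
    then show ?case
      using paired_step_1[OF p' C', of i "\<lambda>x. of_bool (x = 1)"] row_nonneg[of ?\<sigma> "2 * i" 1 3] by auto
  qed simp
  from this[of j] have r1: "letter_row ?\<sigma> 1 (2 * j) 1 > 0" by linarith
  have j': "?\<sigma> (Suc (2 * j)) = c1" using p' j by (simp add: paired_from_def)
  have "letter_row ?\<sigma> 1 (Suc (Suc (2 * j))) b > 0" for b
    using r1 row_nonneg[of ?\<sigma> "2 * j" 1 2] row_nonneg[of ?\<sigma> "2 * j" 1 3]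
    by (cases b rule: letter_cases)
      (simp_all add: level_sum_c1[of ?\<sigma> "Suc (2 * j)", OF j'] level_sum_c1[of ?\<sigma> "2 * j", OF j])
  then have "1 \<in> set (directive_word ?\<sigma> (Suc (Suc (2 * j))) [b])" for b by (simp add: row_pos)
  then have "sublist u (directive_word \<sigma> (2 * k + Suc (Suc (2 * j))) [b])" for b
    by (intro sublist_order.order.trans[OF u] sublist_directive_word)
  then show "\<exists>m. \<forall>b. sublist u (directive_word \<sigma> m [b])" by blast
qed

text \<open>The letter 2 does not occur in the images of the letter 1, which are arbitrarily long prefixes.\<close>

lemma paired_without_2:
  assumes t: "tower \<sigma> W" and p: "paired_from \<sigma> 0"
    and inf1: "\<And>n. \<exists>m\<ge>n. \<sigma> m = c1" and inf2: "\<And>n. \<exists>m\<ge>n. \<sigma> m = c2"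
  shows "2 \<notin> range (W 0)"
proof
  assume "2 \<in> range (W 0)"
  then obtain q where q: "W 0 q = 2" by auto
  obtain k s where k: "directive_word \<sigma> (2 * k) [1] = prefix_of (W 0) (Suc q) @ s"
    using paired_prefix[OF t p inf1 inf2] by blast
  have "letter_row \<sigma> 2 (0 + 2 * k) = (\<lambda>x. of_bool (x = 2))"
    using p tower_is_C[OF t] by (intro row_2_paired) (auto simp: paired_from_def)
  then have "letter_row \<sigma> 2 (2 * k) 1 = 0" by simp
  then have "2 \<notin> set (directive_word \<sigma> (2 * k) [1])" using row_pos[of \<sigma> "2 * k" 2 1] by simp
  then show False using k q by simp
qed

text \<open>At odd distances the word is the image under \<open>c1\<close> or \<open>c2\<close> of a word without the letter 2.\<close>

lemma paired_misses_letter: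
  assumes t: "tower \<sigma> W" and p: "paired_from \<sigma> N" and n: "n \<ge> N"
    and inf1: "\<And>n. \<exists>m\<ge>n. \<sigma> m = c1" and inf2: "\<And>n. \<exists>m\<ge>n. \<sigma> m = c2"
  shows "range (W n) \<noteq> UNIV"
proof -
  have inf: "\<exists>m\<ge>j. \<sigma> (k + m) = c1" "\<exists>m\<ge>j. \<sigma> (k + m) = c2" for j k
    using infinitely_often_shift[of "\<lambda>m. \<sigma> m = c1", OF inf1]
      infinitely_often_shift[of "\<lambda>m. \<sigma> m = c2", OF inf2] by blast+
  have no2: "2 \<notin> range (W k)" if "k \<ge> N" "even (k - N)" for k
    using paired_without_2[OF tower_shift[OF t, of k] paired_from_shift[OF p that] inf] by simp
  show ?thesis
  proof (cases "even (n - N)")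
    case True
    then show ?thesis using no2[OF n] by blast
  next
    case False
    then have no2': "2 \<notin> range (W (Suc n))" using no2[of "Suc n"] n by (simp add: Suc_diff_le)
    have letters: "a \<in> range (W n) \<Longrightarrow> \<exists>b. b \<noteq> 2 \<and> a \<in> set (\<sigma> n b)" for a
      using letter_image_lang[OF factorial_language, of a "\<sigma> n" "W (Suc n)"] no2'
      unfolding tower_language[OF t, of n, symmetric] letter_in_language by metis
    show ?thesis
      using tower_is_C[OF t, of n]
    proof (cases rule: is_C_cases)
      case c1
      have "3 \<notin> range (W n)" using letters[of 3] in_c1_iff(2) by (auto simp: c1)
      then show ?thesis by blast
    next
      case c2
      have "1 \<notin> set (c2 b)" if "b \<noteq> 2" for b
        using that by (cases b rule: letter_cases) (simp_all add: c2_letters)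
      then have "1 \<notin> range (W n)" using letters[of 1] by (auto simp: c2)
      then show ?thesis by blast
    qed
  qed
qed

text \<open>A word whose directive sequence is eventually constant is eventually periodic; this is
  expressed by the finiteness of its set of shifts, which the images inherit.\<close>

definition shifts :: "(nat \<Rightarrow> 'a) \<Rightarrow> (nat \<Rightarrow> 'a) set" where
  "shifts x = range (\<lambda>n k. x (n + k))"

lemma finite_shifts_img:
  assumes "nonerasing c" "\<And>a. length (c a) \<le> B" "finite (shifts x)"
  shows "finite (shifts (img c x))"
proof -
  have "shifts (img c x) \<subseteq> (\<lambda>(y, j) k. img c y (j + k)) ` (shifts x \<times> {..B})"
  proof
    fix f assume "f \<in> shifts (img c x)"
    then obtain q where f: "f = (\<lambda>k. img c x (q + k))" by (auto simp: shifts_def)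
    obtain n where n: "cut_pos c x n \<le> q" "q < cut_pos c x (Suc n)"
      using cut_pos_between[OF assms(1)] by blast
    define j where "j = q - cut_pos c x n"
    have "j \<le> B" using n assms(2)[of "x n"] by (simp add: j_def cut_pos_Suc)
    moreover have "f = (\<lambda>k. img c (\<lambda>i. x (n + i)) (j + k))"
    proof
      fix k
      have q: "q + k = cut_pos c x n + (j + k)" using n(1) by (simp add: j_def)
      show "f k = img c (\<lambda>i. x (n + i)) (j + k)"
        unfolding f q by (rule img_shift[OF assms(1)])
    qed
    ultimately show "f \<in> (\<lambda>(y, j) k. img c y (j + k)) ` (shifts x \<times> {..B})"
      by (intro image_eqI[of _ _ "(\<lambda>i. x (n + i), j)"]) (auto simp: shifts_def)
  qed
  then show ?thesis using assms(3) by (auto intro: finite_subset)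
qed

lemma factor_complexity_le_shifts:
  assumes "finite (shifts w)"
  shows "factor_complexity w n \<le> card (shifts w)"
proof -
  have "{u \<in> language w. length u = n} \<subseteq> (\<lambda>x. prefix_of x n) ` shifts w"
  proof
    fix u assume "u \<in> {u \<in> language w. length u = n}"
    then obtain k where k: "map w [k..<k + n] = u" by (auto simp: language_def occurs_at_def)
    have "u = prefix_of (\<lambda>j. w (k + j)) n"
      unfolding k[symmetric] by (rule nth_equalityI) auto
    then show "u \<in> (\<lambda>x. prefix_of x n) ` shifts w" by (auto simp: shifts_def)
  qed
  then have "card {u \<in> language w. length u = n} \<le> card ((\<lambda>x. prefix_of x n) ` shifts w)"
    using assms by (intro card_mono) auto
  also have "\<dots> \<le> card (shifts w)" by (rule card_image_le[OF assms])
  finally show ?thesis by (simp add: factor_complexity_def)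
qed

lemma app_replicate: "c a = [a] \<Longrightarrow> app c (replicate k a) = replicate k a"
  by (induction k) simp_all

text \<open>The powers of \<open>c1 c1\<close> fix 1 and put a block of letters 1 in front of the other letters; those of
  \<open>c2 c2\<close> fix 3 and append a block of letters 3 to the others.\<close>

lemma directive_word_const_c1:
  "directive_word (\<lambda>_. c1) (2 * k) [a] = (if a = 1 then [1] else replicate k 1 @ [a])"
proof (induction k)
  case (Suc k)
  have *: "directive_word (\<lambda>_. c1) (2 * Suc k) [a] = app c1 (app c1 (directive_word (\<lambda>_. c1) (2 * k) [a]))"
    by (simp add: directive_word_Suc)
  show ?case
    unfolding * Suc
    by (cases a rule: letter_cases)
      (simp_all add: c1_letters app_replicate replicate_app_Cons_same)
qed simp

lemma directive_word_const_c2: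
  "directive_word (\<lambda>_. c2) (2 * k) [a] = (if a = 3 then [3] else a # replicate k 3)"
proof (induction k)
  case (Suc k)
  have *: "directive_word (\<lambda>_. c2) (2 * Suc k) [a] = app c2 (app c2 (directive_word (\<lambda>_. c2) (2 * k) [a]))"
    by (simp add: directive_word_Suc)
  show ?case
    unfolding * Suc
    by (cases a rule: letter_cases) (simp_all add: c2_letters app_replicate)
qed simp

lemma eventually_constant_shifts:
  assumes x: "C_adic x (\<lambda>_. c)" and c: "is_C c"
  shows "finite (shifts x)"
proof -
  obtain a where a: "words_tendsto (\<lambda>n. directive_word (\<lambda>_. c) n [a n]) x"
    using x by (auto simp: C_adic_def)
  have pref: "\<exists>k\<ge>m. m \<le> length (directive_word (\<lambda>_. c) (2 * k) [a (2 * k)])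
      \<and> take m (directive_word (\<lambda>_. c) (2 * k) [a (2 * k)]) = prefix_of x m" for m
  proof -
    obtain K where K: "\<And>n. n \<ge> K \<Longrightarrow> m \<le> length (directive_word (\<lambda>_. c) n [a n])
      \<and> take m (directive_word (\<lambda>_. c) n [a n]) = prefix_of x m"
      using a unfolding words_tendsto_def eventually_sequentially by meson
    show ?thesis using K[of "2 * (m + K)"] by (intro exI[of _ "m + K"]) simp
  qed
  have const: "x (Suc q) = (if c = c1 then 1 else 3)" for q
  proof -
    obtain k where k: "k \<ge> Suc (Suc q)"
      "Suc (Suc q) \<le> length (directive_word (\<lambda>_. c) (2 * k) [a (2 * k)])"
      "take (Suc (Suc q)) (directive_word (\<lambda>_. c) (2 * k) [a (2 * k)]) = prefix_of x (Suc (Suc q))"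
      using pref by blast
    have "x (Suc q) = prefix_of x (Suc (Suc q)) ! Suc q"
      by (simp add: nth_append)
    also have "\<dots> = directive_word (\<lambda>_. c) (2 * k) [a (2 * k)] ! Suc q"
      unfolding k(3)[symmetric] by simp
    finally have eq: "x (Suc q) = directive_word (\<lambda>_. c) (2 * k) [a (2 * k)] ! Suc q" .
    show ?thesis
      using c
    proof (cases rule: is_C_cases)
      case c1
      then show ?thesis
        using eq k(1,2) by (simp add: directive_word_const_c1 nth_append split: if_splits)
    next
      case c2
      then show ?thesis
        using eq k(1,2) c1_neq_c2 by (simp add: directive_word_const_c2 split: if_splits)
    qed
  qed
  define y where "y = (\<lambda>_::nat. if c = c1 then 1 else (3::3))"
  have "shifts x \<subseteq> {x, y}"
  proof
    fix f assume "f \<in> shifts x"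
    then obtain n where f: "f = (\<lambda>k. x (n + k))" by (auto simp: shifts_def)
    show "f \<in> {x, y}"
    proof (cases n)
      case (Suc m)
      then show ?thesis using const by (auto simp: f y_def)
    qed (simp add: f)
  qed
  then show ?thesis by (rule finite_subset) simp
qed

lemma tower_finite_shifts:
  assumes t: "tower \<sigma> W" and const: "\<And>m. m \<ge> N \<Longrightarrow> \<sigma> m = c"
  shows "finite (shifts (W 0))"
proof -
  have "C_adic (W N) (\<lambda>k. \<sigma> (N + k))" by (rule tower_C_adic[OF t])
  moreover have "(\<lambda>k. \<sigma> (N + k)) = (\<lambda>_. c)" using const by auto
  ultimately have "finite (shifts (W N))"
    using eventually_constant_shifts tower_is_C[OF t, of N] const[of N] by simp
  then have "finite (shifts (W (N - k)))" for k
  proof (induction k)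
    case (Suc k)
    show ?case
    proof (cases "k < N")
      case True
      then have "N - k = Suc (N - Suc k)" by simp
      then have "W (N - Suc k) = img (\<sigma> (N - Suc k)) (W (N - k))"
        using tower_img[OF t, of "N - Suc k"] by simp
      then show ?thesis
        using finite_shifts_img[OF nonerasing_C[OF tower_is_C[OF t]] length_C_le[OF tower_is_C[OF t]]] Suc
        by simp
    qed (use Suc in simp)
  qed simp
  from this[of N] show ?thesis by simp
qed

section \<open>Factor complexity\<close>

abbreviation factors :: "(nat \<Rightarrow> 'a) \<Rightarrow> nat \<Rightarrow> 'a list set" where
  "factors w n \<equiv> {u \<in> language w. length u = n}"

lemma finite_factors: "finite (factors (w :: nat \<Rightarrow> 'a::finite) n)"
proof -
  have "factors w n \<subseteq> {u. set u \<subseteq> UNIV \<and> length u = n}" by auto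
  then show ?thesis by (rule finite_subset) (rule finite_lists_length_eq, simp)
qed

lemma sum_right_ext:
  fixes w :: "nat \<Rightarrow> 3"
  shows "(\<Sum>u\<in>factors w n. card (right_ext w u)) = factor_complexity w (Suc n)"
proof -
  have "bij_betw (\<lambda>(u, b). u @ [b]) (SIGMA u:factors w n. right_ext w u) (factors w (Suc n))"
  proof (rule bij_betw_imageI)
    show "inj_on (\<lambda>(u, b). u @ [b]) (SIGMA u:factors w n. right_ext w u)" by (auto simp: inj_on_def)
    show "(\<lambda>(u, b). u @ [b]) ` (SIGMA u:factors w n. right_ext w u) = factors w (Suc n)"
    proof (intro equalityI subsetI)
      fix v assume v: "v \<in> factors w (Suc n)"
      then obtain u b where ub: "v = u @ [b]" by (cases v rule: rev_cases) auto
      then have "sublist u v" by simp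
      then have "u \<in> language w" using v factorial_langD[OF factorial_language] by blast
      then show "v \<in> (\<lambda>(u, b). u @ [b]) ` (SIGMA u:factors w n. right_ext w u)"
        using v by (intro image_eqI[of _ _ "(u, b)"]) (auto simp: ub right_ext_def)
    qed (auto simp: right_ext_def)
  qed
  from bij_betw_same_card[OF this] show ?thesis
    using finite_factors[of w n] by (simp add: factor_complexity_def card_SigmaI)
qed

lemma sum_left_ext:
  fixes w :: "nat \<Rightarrow> 3"
  shows "(\<Sum>u\<in>factors w n. card (left_ext w u)) = factor_complexity w (Suc n)"
proof -
  have "bij_betw (\<lambda>(u, a). a # u) (SIGMA u:factors w n. left_ext w u) (factors w (Suc n))"
  proof (rule bij_betw_imageI)
    show "inj_on (\<lambda>(u, a). a # u) (SIGMA u:factors w n. left_ext w u)" by (auto simp: inj_on_def)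
    show "(\<lambda>(u, a). a # u) ` (SIGMA u:factors w n. left_ext w u) = factors w (Suc n)"
    proof (intro equalityI subsetI)
      fix v assume v: "v \<in> factors w (Suc n)"
      then obtain u a where ua: "v = a # u" by (cases v) auto
      then have "sublist u v" by (simp add: sublist_Cons_right)
      then have "u \<in> language w" using v factorial_langD[OF factorial_language] by blast
      then show "v \<in> (\<lambda>(u, a). a # u) ` (SIGMA u:factors w n. left_ext w u)"
        using v by (intro image_eqI[of _ _ "(u, a)"]) (auto simp: ua left_ext_def)
    qed (auto simp: left_ext_def)
  qed
  from bij_betw_same_card[OF this] show ?thesis
    using finite_factors[of w n] by (simp add: factor_complexity_def card_SigmaI)
qed

lemma sum_both_ext:
  fixes w :: "nat \<Rightarrow> 3"
  shows "(\<Sum>u\<in>factors w n. card (ext (language w) u)) = factor_complexity w (Suc (Suc n))"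
proof -
  let ?S = "SIGMA u:factors w n. ext (language w) u" and ?f = "\<lambda>(u, a, b). a # u @ [b]"
  have "bij_betw ?f ?S (factors w (Suc (Suc n)))"
  proof (rule bij_betw_imageI)
    show "inj_on ?f ?S" by (auto simp: inj_on_def)
    show "?f ` ?S = factors w (Suc (Suc n))"
    proof (intro equalityI subsetI)
      fix v assume v: "v \<in> factors w (Suc (Suc n))"
      then obtain a v' where v': "v = a # v'" by (cases v) auto
      then obtain u b where ub: "v = a # u @ [b]" using v by (cases v' rule: rev_cases) auto
      then have "v = [a] @ u @ [b]" by simp
      then have "sublist u v" by (metis sublist_appendI)
      then have "u \<in> language w" using v factorial_langD[OF factorial_language] by blast
      then show "v \<in> ?f ` ?S"
        using v by (intro image_eqI[of _ _ "(u, a, b)"]) (auto simp: ub)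
    qed auto
  qed
  from bij_betw_same_card[OF this] show ?thesis
    using finite_factors[of w n] by (simp add: factor_complexity_def card_SigmaI)
qed

definition excess :: "(nat \<Rightarrow> 3) \<Rightarrow> 3 list \<Rightarrow> int" where
  "excess w u = int (card (ext (language w) u)) - int (card (left_ext w u))
     - int (card (right_ext w u)) + 1"

text \<open>A factor of length \<open>n + 2\<close> is counted once, at its inner part, and a factor of length \<open>n + 1\<close>
  twice, at its prefix and at its suffix.\<close>

lemma sum_excess:
  "(\<Sum>u\<in>factors w n. excess w u) = int (factor_complexity w (Suc (Suc n)))
    - 2 * int (factor_complexity w (Suc n)) + int (factor_complexity w n)"
proof -
  have "(\<Sum>u\<in>factors w n. excess w u) = int (\<Sum>u\<in>factors w n. card (ext (language w) u))
    - int (\<Sum>u\<in>factors w n. card (left_ext w u)) - int (\<Sum>u\<in>factors w n. card (right_ext w u))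
    + int (card (factors w n))"
    by (simp add: excess_def sum.distrib sum_subtractf)
  then show ?thesis
    unfolding sum_right_ext sum_left_ext sum_both_ext by (simp add: factor_complexity_def)
qed

lemma ext_subset: "fst ` ext (language w) u \<subseteq> left_ext w u" "snd ` ext (language w) u \<subseteq> right_ext w u"
proof -
  have "a # u \<in> language w" "u @ [b] \<in> language w" if "a # u @ [b] \<in> language w" for a b
    using factorial_langD[OF factorial_language that, of "a # u"]
      factorial_langD[OF factorial_language that, of "u @ [b]"]
    by (simp_all add: sublist_Cons_right)
  then show "fst ` ext (language w) u \<subseteq> left_ext w u" "snd ` ext (language w) u \<subseteq> right_ext w u"
    by (auto simp: left_ext_def right_ext_def)
qed

lemma biextendable_ext:
  assumes "biextendable (language w)"
  shows "fst ` ext (language w) u = left_ext w u" "snd ` ext (language w) u = right_ext w u"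
proof -
  have "a \<in> fst ` ext (language w) u" if a: "a # u \<in> language w" for a
  proof -
    obtain b where "(a # u) @ [b] \<in> language w" using language_right_extendable[OF a] by blast
    then show ?thesis by (intro image_eqI[of _ _ "(a, b)"]) auto
  qed
  moreover have "b \<in> snd ` ext (language w) u" if b: "u @ [b] \<in> language w" for b
  proof -
    obtain a where "a # (u @ [b]) \<in> language w" using assms b unfolding biextendable_def by blast
    then show ?thesis by (intro image_eqI[of _ _ "(a, b)"]) auto
  qed
  ultimately show "fst ` ext (language w) u = left_ext w u" "snd ` ext (language w) u = right_ext w u"
    using ext_subset[of w u] by (auto simp: left_ext_def right_ext_def)
qed

lemma ext_nonempty:
  assumes "biextendable (language w)" "u \<in> language w"
  shows "ext (language w) u \<noteq> {}"
proof -
  obtain a where "a # u \<in> language w" using assms by (auto simp: biextendable_def)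
  then obtain b where "(a # u) @ [b] \<in> language w" using language_right_extendable by blast
  then have "(a, b) \<in> ext (language w) u" by simp
  then show ?thesis by blast
qed

lemma excess_eq_mult:
  assumes "biextendable (language w)" "u \<in> language w"
  shows "excess w u = mult (ext (language w) u)"
  using ext_nonempty[OF assms] biextendable_ext[OF assms(1), of u]
  by (simp add: excess_def mult_def)

lemma ext_empty: "u \<notin> language w \<Longrightarrow> ext (language w) u = {}"
proof (rule ccontr)
  assume u: "u \<notin> language w" and "ext (language w) u \<noteq> {}"
  then obtain a b where "[a] @ u @ [b] \<in> language w" by auto
  then show False using u factorial_langD[OF factorial_language] by (metis sublist_appendI)
qed

text \<open>Extensions of \<open>u\<close> to one side that cannot be continued to the other side count as isolated
  vertices.\<close>

lemma excess_le_mult: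
  assumes "u \<in> language w"
  shows "excess w u \<le> mult (ext (language w) u)"
proof -
  have l: "card (fst ` ext (language w) u) \<le> card (left_ext w u)"
    and r: "card (snd ` ext (language w) u) \<le> card (right_ext w u)"
    using ext_subset[of w u] by (intro card_mono; simp)+
  show ?thesis
  proof (cases "ext (language w) u = {}")
    case True
    obtain b where "b \<in> right_ext w u"
      using language_right_extendable[OF assms] by (auto simp: right_ext_def)
    then have "card (right_ext w u) > 0" by (auto simp: card_gt_0_iff)
    moreover have "excess w u = 1 - int (card (left_ext w u)) - int (card (right_ext w u))"
      by (simp add: excess_def True)
    ultimately have "excess w u \<le> 0" by linarith
    then show ?thesis by (simp add: True)
  next
    case False
    then show ?thesis using l r by (simp add: excess_def mult_def)
  qed
qed

lemma factor_complexity_0: "factor_complexity w 0 = 1"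
proof -
  have "factors w 0 = {[]}" by (auto simp: language_def occurs_at_def)
  then show ?thesis by (simp add: factor_complexity_def)
qed

lemma factor_complexity_1: "factor_complexity w 1 = card (range w)"
proof -
  have "factors w 1 = (\<lambda>a. [a]) ` range w"
    by (auto simp: length_Suc_conv letter_in_language[symmetric] simp del: letter_in_language)
      (auto simp: letter_in_language)
  then show ?thesis by (simp add: factor_complexity_def card_image inj_on_def)
qed

text \<open>The second difference of the complexity vanishes, and it is a sum of terms that are at most 0.\<close>

lemma complexity_imp_full_neutral:
  assumes t: "tower \<sigma> W" and p: "\<And>n. factor_complexity (W 0) n = 2 * n + 1"
  shows "full_neutral (language (W 0))"
proof -
  have "mult (ext (language (W 0)) u) = 0" for u
  proof (cases "u \<in> language (W 0)")
    case True
    let ?F = "factors (W 0) (length u)"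
    have le: "excess (W 0) v \<le> 0" if "v \<in> ?F" for v
      using excess_le_mult[of v "W 0"] mult_nonpos[OF tower_subtree[OF t, of 0 v]] that by simp
    have "(\<Sum>v\<in>?F. - excess (W 0) v) = 0"
      using sum_excess[of "W 0" "length u"] by (simp add: p sum_negf)
    then have "- excess (W 0) u = 0"
      using le True finite_factors[of "W 0" "length u"]
      by (subst (asm) sum_nonneg_eq_0_iff) auto
    then show ?thesis
      using excess_le_mult[OF True] mult_nonpos[OF tower_subtree[OF t, of 0 u]] by simp
  qed (simp add: ext_empty)
  moreover have "range (W 0) = UNIV"
  proof (rule card_subset_eq)
    show "card (range (W 0)) = card (UNIV :: 3 set)" using p[of 1] factor_complexity_1[of "W 0"] by simp
  qed auto
  ultimately show ?thesis by (simp add: full_neutral_def neutral_def letter_in_language)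
qed

lemma full_neutral_imp_complexity:
  assumes bi: "biextendable (language w)" and full: "full_neutral (language w)"
  shows "factor_complexity w n = 2 * n + 1"
proof -
  have "range w = UNIV" using full by (auto simp: full_neutral_def letter_in_language)
  then have p1: "factor_complexity w 1 = 3" unfolding factor_complexity_1 by simp
  have step: "int (factor_complexity w (Suc (Suc n)))
      - 2 * int (factor_complexity w (Suc n)) + int (factor_complexity w n) = 0" for n
  proof -
    have "(\<Sum>u\<in>factors w n. excess w u) = (\<Sum>u\<in>factors w n. 0)"
      using excess_eq_mult[OF bi] full by (intro sum.cong) (auto simp: full_neutral_def neutral_def)
    then show ?thesis using sum_excess[of w n] by simp
  qed
  have "factor_complexity w n = 2 * n + 1 \<and> factor_complexity w (Suc n) = 2 * Suc n + 1"
  proof (induction n)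
    case 0
    then show ?case using p1 factor_complexity_0[of w] by simp
  next
    case (Suc n)
    then show ?case using step[of n] by simp
  qed
  then show ?thesis by blast
qed

section \<open>The equivalences\<close>

lemma biextendable_image_lang:
  assumes "nonerasing c" "biextendable L"
  shows "biextendable (image_lang c L)"
  unfolding biextendable_def
proof
  fix u assume "u \<in> image_lang c L"
  then obtain v p s where v: "v \<in> L" "app c v = p @ u @ s" by (auto simp: image_lang_iff)
  obtain a b where ab: "a # v \<in> L" "v @ [b] \<in> L" using assms(2) v(1) unfolding biextendable_def by blast
  obtain p' x where p': "c a @ p = p' @ [x]"
    using nonerasingD[OF assms(1), of a] by (cases "c a @ p" rule: rev_cases) auto
  obtain y s' where s': "s @ c b = y # s'"
    using nonerasingD[OF assms(1), of b] by (cases "s @ c b") auto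
  have "app c (a # v) = (c a @ p) @ u @ s" using v(2) by simp
  also have "\<dots> = p' @ (x # u) @ s" unfolding p' by simp
  finally have "x # u \<in> image_lang c L" using ab(1) unfolding image_lang_iff by blast
  moreover have "app c (v @ [b]) = p @ u @ (s @ c b)" using v(2) by simp
  then have "app c (v @ [b]) = p @ (u @ [y]) @ s'" unfolding s' by simp
  then have "u @ [y] \<in> image_lang c L" using ab(2) unfolding image_lang_iff by blast
  ultimately show "(\<exists>a. a # u \<in> image_lang c L) \<and> (\<exists>b. u @ [b] \<in> image_lang c L)" by blast
qed

lemma letters_of_spreading:
  assumes t: "tower \<sigma> W" and sp: "spreading \<sigma>"
  shows "range (W 0) = UNIV"
proof -
  obtain k where k: "\<And>a b. a \<in> set (directive_word (\<lambda>j. \<sigma> (0 + j)) k [b])"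
    using sp unfolding spreading_def by blast
  have "prefix_of (W 0) (cut_pos (level_image \<sigma> k) (W k) 1) = directive_word \<sigma> k [W k 0]"
    using img_prefix[OF tower_nonerasing[OF t], of k "W k" 1] tower_level[OF t, of k] by simp
  moreover have "set (prefix_of (W 0) m) \<subseteq> range (W 0)" for m by auto
  ultimately have "set (directive_word \<sigma> k [W k 0]) \<subseteq> range (W 0)" by metis
  then show ?thesis using k by auto
qed

text \<open>A missing edge in the extension graph of the empty word would allow to label the left and
  the right copies of the letters in such a way that the differences of the labels telescope
  along the word: a relation between the frequencies.\<close>

lemma spreading_ext_Nil:
  assumes t: "tower \<sigma> W" and sp: "spreading \<sigma>"
  shows "mult (ext (language (W 0)) []) = 0"
proof -
  let ?w = "W 0" and ?E = "ext (language (W 0)) []"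
  obtain T where T: "T \<in> max_trees" "?E \<subseteq> T"
    using tower_subtree[OF t, of 0 "[]"] by (auto simp: subtree_of_max_def)
  have "?E = T"
  proof (rule ccontr)
    assume "?E \<noteq> T"
    then obtain e where e: "e \<in> T" "e \<notin> ?E" using T(2) by blast
    obtain \<alpha> \<beta> :: "3 \<Rightarrow> int" where lab: "\<forall>(a, b)\<in>T - {e}. \<alpha> a = \<beta> b" "\<alpha> (fst e) \<noteq> \<beta> (snd e)"
      using btree_separating_labels[OF max_trees_btree[OF T(1)] e(1)] by blast
    have step: "\<alpha> (?w k) = \<beta> (?w (Suc k))" for k
    proof -
      have "[?w k, ?w (Suc k)] \<in> language ?w" using in_language_map[of ?w k 2] by (simp add: upt_rec)
      then have "(?w k, ?w (Suc k)) \<in> ?E" by simp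
      then have "(?w k, ?w (Suc k)) \<in> T - {e}" using T(2) e(2) by blast
      then show ?thesis using lab(1) by blast
    qed
    define p where "p a = \<alpha> a - \<beta> a" for a
    have tele: "wsum p (prefix_of ?w m) = \<beta> (?w m) - \<beta> (?w 0)" for m
      by (induction m) (simp_all add: p_def step)
    define B where "B = real_of_int (Max (range (\<lambda>a. \<bar>\<beta> a\<bar>)))"
    have B: "\<bar>real_of_int (\<beta> a)\<bar> \<le> B" for a
    proof -
      have "\<bar>\<beta> a\<bar> \<le> Max (range (\<lambda>a. \<bar>\<beta> a\<bar>))" by (rule Max_ge) auto
      then show ?thesis unfolding B_def by linarith
    qed
    have "mean (\<lambda>a. of_int (p a)) ?w \<longlonglongrightarrow> 0"
    proof (rule Lim_null_comparison)
      show "(\<lambda>m. 2 * B / real m) \<longlonglongrightarrow> 0" by real_asymp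
      have "\<bar>mean (\<lambda>a. of_int (p a)) ?w m\<bar> \<le> 2 * B / real m" for m
      proof -
        have "\<bar>real_of_int (\<beta> (?w m) - \<beta> (?w 0))\<bar> \<le> 2 * B" using B[of "?w m"] B[of "?w 0"] by simp
        then have "\<bar>real_of_int (\<beta> (?w m) - \<beta> (?w 0))\<bar> / real m \<le> 2 * B / real m"
          by (intro divide_right_mono) auto
        then show ?thesis by (simp add: mean_def wsum_of_int tele)
      qed
      then show "\<forall>\<^sub>F m in sequentially. norm (mean (\<lambda>a. of_int (p a)) ?w m) \<le> 2 * B / real m"
        by simp
    qed
    then have "p a = 0" for a
      using rationally_independent_iff_spreading[OF t] rationally_independent_iff[OF t] sp by blast
    then have eq: "\<alpha> a = \<beta> a" for a by (simp add: p_def)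
    have "\<beta> (?w k) = \<beta> (?w 0)" for k
      by (induction k) (simp_all add: eq flip: step)
    then have "\<beta> a = \<beta> (?w 0)" for a
      using letters_of_spreading[OF t sp] by (metis UNIV_I imageE)
    then show False using lab(2) eq by metis
  qed
  then show ?thesis
    using max_trees_card[OF T(1)] max_trees_spanning[OF T(1)] by (auto simp: mult_def)
qed

text \<open>The multiplicity of the empty word vanishes at all levels, and from there the other ones do.\<close>

lemma spreading_full_neutral:
  assumes t: "tower \<sigma> W" and sp: "spreading \<sigma>"
  shows "syndetic (W 0)" "full_neutral (language (W 0))"
proof -
  note t' = tower_shift[OF t] and sp' = spreading_shift[OF sp]
  show "syndetic (W 0)" by (rule spreading_syndetic[OF t sp])
  have bi: "biextendable (language (W n))" for n
    using uniformly_recurrent_biextendable[OF syndetic_uniformly_recurrent[OF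
        spreading_syndetic[OF t'[of n] sp'[of n]]]] by simp
  have eps: "mult (ext (language (W n)) []) = 0" for n
    using spreading_ext_Nil[OF t'[of n] sp'[of n]] by simp
  have "neutral (language (W 0))" by (rule tower_neutral[OF t bi eps])
  then show "full_neutral (language (W 0))"
    using letters_of_spreading[OF t sp] by (simp add: full_neutral_def letter_in_language)
qed

text \<open>Otherwise the directive sequence is paired from some level on. If it were eventually constant, the
  complexity would be bounded. So the words are recurrent, and at some late level all letters
  occur, which a paired sequence does not allow.\<close>

lemma complexity_imp_spreading:
  assumes t: "tower \<sigma> W" and p: "\<And>n. factor_complexity (W 0) n = 2 * n + 1"
  shows "spreading \<sigma>"
proof (rule ccontr)
  note C = tower_is_C[OF t]
  assume "\<not> spreading \<sigma>"
  then obtain N where N: "paired_from \<sigma> N" using spreading_iff_not_paired[of \<sigma>, OF C] by blast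
  have not_const: "\<exists>m\<ge>n. \<sigma> m \<noteq> c" for n c
  proof (rule ccontr)
    assume "\<not> (\<exists>m\<ge>n. \<sigma> m \<noteq> c)"
    then have "finite (shifts (W 0))" using tower_finite_shifts[OF t, of n c] by blast
    from factor_complexity_le_shifts[OF this, of "card (shifts (W 0))"] show False by (simp add: p)
  qed
  have inf1: "\<exists>m\<ge>n. \<sigma> m = c1" for n using not_const[of n c2] C unfolding is_C_def by metis
  have inf2: "\<exists>m\<ge>n. \<sigma> m = c2" for n using not_const[of n c1] C unfolding is_C_def by metis
  have inf: "\<exists>m\<ge>j. \<sigma> (k + m) = c1" "\<exists>m\<ge>j. \<sigma> (k + m) = c2" for j k
    using infinitely_often_shift[of "\<lambda>m. \<sigma> m = c1", OF inf1]
      infinitely_often_shift[of "\<lambda>m. \<sigma> m = c2", OF inf2] by blast+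
  have "syndetic (W (N + 2 * k))" for k
    using paired_syndetic[OF tower_shift[OF t, of "N + 2 * k"] paired_from_shift[OF N] inf] by simp
  then have bi': "biextendable (language (W (N + 2 * k)))" for k
    by (intro uniformly_recurrent_biextendable syndetic_uniformly_recurrent)
  have bi: "biextendable (language (W n))" for n
  proof (rule inc_induct[of n "N + 2 * n" "\<lambda>n. biextendable (language (W n))"])
    fix m assume "biextendable (language (W (Suc m)))"
    then show "biextendable (language (W m))"
      unfolding tower_language[OF t, of m]
      by (rule biextendable_image_lang[OF nonerasing_C[OF C]])
  qed (use bi' in auto)
  have "\<exists>m\<ge>n. full_neutral (language (W m))" for n
  proof (induction n)
    case 0
    show ?case using complexity_imp_full_neutral[OF t p] by blast
  next
    case (Suc n)
    then obtain m where m: "m \<ge> n" "full_neutral (language (W m))" by blast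
    show ?case
    proof (cases "m = n")
      case True
      then show ?thesis using tower_full_neutral[OF t bi m(2)] by (metis Suc_n_not_le_n nat_le_linear le_SucI)
    next
      case False
      then show ?thesis using m by (intro exI[of _ m]) auto
    qed
  qed
  then obtain m where m: "m \<ge> N" "full_neutral (language (W m))" by blast
  then have "range (W m) = UNIV" by (auto simp: full_neutral_def letter_in_language)
  then show False using paired_misses_letter[OF t N m(1) inf1 inf2] by blast
qed

lemma ext_graph:
  "ext_graph_edges w u = bip_edges (ext (language w) u)"
  by (auto simp: ext_graph_edges_def bip_edges_def both_ext_def)

lemma full_neutral_dendric:
  assumes t: "tower \<sigma> W" and bi: "biextendable (language (W 0))"
    and full: "full_neutral (language (W 0))"
  shows "dendric (W 0)"
  unfolding dendric_def
proof (intro allI impI)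
  fix u assume "bispecial (W 0) u"
  then have "ext (language (W 0)) u \<noteq> {}" using ext_nonempty[OF bi] by (simp add: bispecial_def)
  then have "btree (ext (language (W 0)) u)"
    using mult_0_btree[OF tower_subtree[OF t, of 0 u]] full by (simp add: full_neutral_def neutral_def)
  from graph_tree_bip_edges[OF this]
  show "graph_tree (ext_graph_verts (W 0) u) (ext_graph_edges (W 0) u)"
    by (simp add: ext_graph ext_graph_verts_def biextendable_ext[OF bi])
qed

text \<open>Connectedness bounds the number of edges below; the upper bound holds for all extension graphs
  here.\<close>

lemma dendric_full_neutral:
  assumes t: "tower \<sigma> W" and bi: "biextendable (language (W 0))"
    and dendric: "dendric (W 0)" and range: "range (W 0) = UNIV"
  shows "full_neutral (language (W 0))"
proof -
  have "mult (ext (language (W 0)) u) = 0" for u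
  proof (cases "bispecial (W 0) u")
    case True
    let ?E = "ext (language (W 0)) u" and ?V = "ext_graph_verts (W 0) u"
    have "graph_connected ?V (bip_edges ?E)"
      using dendric True by (simp add: dendric_def graph_tree_def flip: ext_graph)
    then have "card ?V \<le> card (bip_edges ?E) + 1"
      by (rule connected_card_le) (simp_all add: ext_graph_verts_def finite_bip_edges)
    then have "card (left_ext (W 0) u) + card (right_ext (W 0) u) \<le> card ?E + 1"
      by (simp add: ext_graph_verts_def card_Plus card_bip_edges)
    then have "excess (W 0) u \<ge> 0" by (simp add: excess_def)
    then show ?thesis
      using mult_nonpos[OF tower_subtree[OF t, of 0 u]] excess_eq_mult[OF bi, of u] True
      by (simp add: bispecial_def)
  next
    case False
    show ?thesis
    proof (cases "u \<in> language (W 0)")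
      case True
      have "\<not> two_sided (ext (language (W 0)) u)"
      proof
        assume two: "two_sided (ext (language (W 0)) u)"
        have card_gt_1: "card A > 1" if "x \<in> A" "y \<in> A" "x \<noteq> y" for x y and A :: "3 set"
          using that card_le_Suc0_iff_eq[of A] by (metis finite not_less One_nat_def)
        obtain a b a' b' where 1: "(a, b) \<in> ext (language (W 0)) u"
          "(a', b') \<in> ext (language (W 0)) u" "a \<noteq> a'"
          using two unfolding two_sided_def by blast
        obtain c d c' d' where 2: "(c, d) \<in> ext (language (W 0)) u"
          "(c', d') \<in> ext (language (W 0)) u" "d \<noteq> d'"
          using two unfolding two_sided_def by blast
        have "card (fst ` ext (language (W 0)) u) > 1"
          using imageI[OF 1(1), of fst] imageI[OF 1(2), of fst] 1(3) card_gt_1[of a _ a'] by simp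
        moreover have "card (snd ` ext (language (W 0)) u) > 1"
          using imageI[OF 2(1), of snd] imageI[OF 2(2), of snd] 2(3) card_gt_1[of d _ d'] by simp
        ultimately show False using False True by (simp add: bispecial_def biextendable_ext[OF bi])
      qed
      then show ?thesis by (rule not_two_sided_mult)
    qed (simp add: ext_empty)
  qed
  then show ?thesis using range by (simp add: full_neutral_def neutral_def letter_in_language)
qed

theorem theorem2:
  fixes w :: "nat \<Rightarrow> 3" and i :: "nat \<Rightarrow> nat"
  assumes "\<And>n. i n \<in> {1, 2}"
    and "C_adic w (\<lambda>n. subst_c (i n))"
  shows "((\<forall>n. factor_complexity w n = 2 * n + 1) \<longleftrightarrow> frequencies_rationally_independent w)
    \<and> (frequencies_rationally_independent w \<longleftrightarrow> primitive_seq (\<lambda>n. mat_C (i n)))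
    \<and> (primitive_seq (\<lambda>n. mat_C (i n)) \<longleftrightarrow> uniformly_recurrent w \<and> dendric w \<and> range w = UNIV)"
proof -
  define \<sigma> where "\<sigma> n = subst_c (i n)" for n
  have "C_adic w \<sigma>" using assms(2) by (simp add: \<sigma>_def[abs_def])
  then obtain W where t: "tower \<sigma> W" and w: "W 0 = w" using C_adic_tower by blast
  have "mat_C (i n) = incidence_matrix (\<sigma> n)" for n
    by (simp add: \<sigma>_def mat_C_def subst_c_def incidence_matrix_c1 incidence_matrix_c2)
  then have primitive: "primitive_seq (\<lambda>n. mat_C (i n)) \<longleftrightarrow> spreading \<sigma>"
    by (simp add: primitive_seq_iff_spreading)
  have independent: "frequencies_rationally_independent w \<longleftrightarrow> spreading \<sigma>"
    using rationally_independent_iff_spreading[OF t] by (simp add: w)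
  have spreading_imp: "uniformly_recurrent w" "full_neutral (language w)" if "spreading \<sigma>"
    using spreading_full_neutral[OF t that] syndetic_uniformly_recurrent by (simp_all add: w)
  have full_imp: "factor_complexity w n = 2 * n + 1"
    if "uniformly_recurrent w" "full_neutral (language w)" for n
    using that by (intro full_neutral_imp_complexity uniformly_recurrent_biextendable)
  have complexity_imp: "spreading \<sigma>" if "\<forall>n. factor_complexity w n = 2 * n + 1"
    using complexity_imp_spreading[OF t] that by (simp add: w)
  have complexity: "(\<forall>n. factor_complexity w n = 2 * n + 1) \<longleftrightarrow> spreading \<sigma>"
    using spreading_imp full_imp complexity_imp by blast
  have "dendric w" "range w = UNIV" if "uniformly_recurrent w" "full_neutral (language w)"
    using full_neutral_dendric[OF t] uniformly_recurrent_biextendable that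
    by (auto simp: w full_neutral_def letter_in_language)
  moreover have "full_neutral (language w)"
    if "uniformly_recurrent w" "dendric w" "range w = UNIV"
    using dendric_full_neutral[OF t] uniformly_recurrent_biextendable[OF that(1)] that(2,3)
    by (simp add: w)
  ultimately have dendric: "spreading \<sigma> \<longleftrightarrow> uniformly_recurrent w \<and> dendric w \<and> range w = UNIV"
    using spreading_imp full_imp complexity_imp by blast
  show ?thesis using primitive independent complexity dendric by blast
qed

end
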